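(* Let $p>2$. Let $G$ be a star-graph with $N\ge1$ infinite edges and a single vertex at the origin. (i) If $N$ is even, there are infinitely many non-negative, not identically zero (actually positive) solutions to the Kirkhoff-ODE system in $G$. If $N>2$ is even, none of them is a minimizer for $$\frac1{C_p(G)}=\inf_{v\in H^1_0(G)\setminus\{0\}}\frac{\int_G(|v'|^2+|v|^2)\,dx}{\left(\int_G|v|^p\,dx\right)^{2/p}}.$$ If $N=2$, all the non-negative, not identically zero solutions to the Kirkhoff-ODE system in $G$ are minimizers for this problem (equivalently, extremals for the inequality defining $C_p(G)$). (ii) If $N=1$, there is no not identically zero solution to the Kirkhoff-ODE system in $G$. (iii) If $N$ is odd and larger than $1$, there is a unique non-negative, not identically zero solution $v$ to the Kirkhoff-ODE system in $G$; it is such that $v(0)=\bar v(0)$ and all the outward derivatives at the origin, in the direction of all the edges of the graph, are equal to $0$. This $v$ is not a minimizer for the minimization problem $$\frac1{C_p(G)}=\inf_{w\in H^1_0(G)\setminus\{0\}}\frac{\int_G(|w'|^2+|w|^2)\,dx}{\left(\int_G|w|^p\,dx\right)^{2/p}},$$ and that minimization problem has no solution.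
   Context: A star-graph with $N$ infinite edges is the graph composed of $N$ half-lines meeting at the origin, which is the only vertex. A vertex is outer if it belongs to only one edge (so the origin is outer when $N=1$) and inner otherwise. $H^1(G)$ is the set of continuous functions on $G$ belonging to $H^1(e)$ for each edge $e$ with $\sum_e\|f\|_{H^1(e)}^2<\infty$; $H^1_0(G)$ is the subspace of functions vanishing at all outer vertices (so $H^1_0(G)=H^1(G)$ if $N\ge2$, and functions vanish at $0$ if $N=1$). Integrals over $G$ are sums over edges of arc-length integrals. $C_p(G)$ is the best constant in $\left(\int_G|v|^p\,dx\right)^{2/p}\le C_p(G)\int_G(|v'|^2+|v|^2)\,dx$ for all $v\in H^1_0(G)$. A solution to the Kirkhoff-ODE system in $G$ is a function $v\in H^1_0(G)$ satisfying $-v''+v=|v|^{p-2}v$ in each edge of $G$ and, at each inner vertex, the Kirkhoff condition: the sum of the outward derivatives of $v$ at that vertex, taken in the direction of each edge issued from it, equals $0$. The function $\bar v$ is $\bar v(s)=\left(\frac p2\right)^{\frac1{p-2}}\left(\cosh\frac{(p-2)s}{2}\right)^{-\frac2{p-2}}$, $s\in\mathbb{R}$, so $\bar v(0)=\left(\frac p2\right)^{\frac1{p-2}}$. *)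

theory Defs
  imports "HOL-Analysis.Analysis"
begin

text \<open>
  The star-graph with \<open>N\<close> infinite edges consists of the half-lines \<open>{0..}\<close> indexed by \<open>i < N\<close>, all
  glued at \<open>0\<close>. A function on it is a map \<open>v :: nat \<Rightarrow> real \<Rightarrow> real\<close>, where \<open>v i s\<close> is the value at
  distance \<open>s\<close> from the origin on edge \<open>i\<close>. Values at indices \<open>i \<ge> N\<close> and at \<open>s < 0\<close> have no
  meaning; they are normalised to \<open>0\<close>, so that equality in HOL is equality of functions on the
  graph.
\<close>

definition cont_star :: "nat \<Rightarrow> (nat \<Rightarrow> real \<Rightarrow> real) set" where
  "cont_star N = {v.
     (\<forall>i s. \<not> (i < N \<and> 0 \<le> s) \<longrightarrow> v i s = 0) \<and>
     (\<forall>i<N. continuous_on {0..} (v i)) \<and>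
     (\<forall>i<N. \<forall>j<N. v i 0 = v j 0)}"

definition nontrivial :: "nat \<Rightarrow> (nat \<Rightarrow> real \<Rightarrow> real) \<Rightarrow> bool" where
  "nontrivial N v \<longleftrightarrow> (\<exists>i<N. \<exists>s\<ge>0. v i s \<noteq> 0)"

definition nonneg_star :: "nat \<Rightarrow> (nat \<Rightarrow> real \<Rightarrow> real) \<Rightarrow> bool" where
  "nonneg_star N v \<longleftrightarrow> (\<forall>i<N. \<forall>s\<ge>0. 0 \<le> v i s)"

definition positive_star :: "nat \<Rightarrow> (nat \<Rightarrow> real \<Rightarrow> real) \<Rightarrow> bool" where
  "positive_star N v \<longleftrightarrow> (\<forall>i<N. \<forall>s\<ge>0. 0 < v i s)"

definition L2_half :: "(real \<Rightarrow> real) \<Rightarrow> bool" where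
  "L2_half f \<longleftrightarrow> set_borel_measurable lborel {0..} f \<and>
     set_integrable lborel {0..} (\<lambda>s. (f s)\<^sup>2)"

definition test_function :: "(real \<Rightarrow> real) \<Rightarrow> bool" where
  "test_function \<phi> \<longleftrightarrow>
     (\<forall>x. \<phi> field_differentiable (at x)) \<and> continuous_on UNIV (deriv \<phi>) \<and>
     (\<exists>a b. 0 < a \<and> (\<forall>x. x \<notin> {a..b} \<longrightarrow> \<phi> x = 0))"

text \<open>
  Weak derivatives in \<open>L\<^sup>2(0,\<infinity>)\<close> are tested against \<open>C\<^sup>1\<close> functions with compact support in the open
  half-line; by mollification this gives the same notion as smooth test functions. A weak derivative
  is unique up to null sets, so the choice made by \<open>weak_deriv\<close> does not affect any integral.
\<close>

definition has_weak_deriv :: "(real \<Rightarrow> real) \<Rightarrow> (real \<Rightarrow> real) \<Rightarrow> bool" where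
  "has_weak_deriv f g \<longleftrightarrow> L2_half g \<and>
     (\<forall>\<phi>. test_function \<phi> \<longrightarrow>
        (LINT s:{0..}|lborel. f s * deriv \<phi> s) = - (LINT s:{0..}|lborel. g s * \<phi> s))"

definition weak_deriv :: "(real \<Rightarrow> real) \<Rightarrow> real \<Rightarrow> real" where
  "weak_deriv f = (SOME g. has_weak_deriv f g)"

definition H1_half :: "(real \<Rightarrow> real) \<Rightarrow> bool" where
  "H1_half f \<longleftrightarrow> L2_half f \<and> (\<exists>g. has_weak_deriv f g)"

definition H1_star :: "nat \<Rightarrow> (nat \<Rightarrow> real \<Rightarrow> real) set" where
  "H1_star N = {v \<in> cont_star N. \<forall>i<N. H1_half (v i)}"

text \<open>The origin is an outer vertex exactly when \<open>N = 1\<close>.\<close>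

definition H10_star :: "nat \<Rightarrow> (nat \<Rightarrow> real \<Rightarrow> real) set" where
  "H10_star N = {v \<in> H1_star N. N = 1 \<longrightarrow> v 0 0 = 0}"

definition energy :: "nat \<Rightarrow> (nat \<Rightarrow> real \<Rightarrow> real) \<Rightarrow> real" where
  "energy N v = (\<Sum>i<N. LINT s:{0..}|lborel. \<bar>weak_deriv (v i) s\<bar>\<^sup>2 + \<bar>v i s\<bar>\<^sup>2)"

definition Lp_integral :: "real \<Rightarrow> nat \<Rightarrow> (nat \<Rightarrow> real \<Rightarrow> real) \<Rightarrow> real" where
  "Lp_integral p N v = (\<Sum>i<N. LINT s:{0..}|lborel. \<bar>v i s\<bar> powr p)"

definition best_const :: "real \<Rightarrow> nat \<Rightarrow> real" where
  "best_const p N =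
     Inf {C. \<forall>v\<in>H10_star N. Lp_integral p N v powr (2 / p) \<le> C * energy N v}"

definition energy_quotient :: "real \<Rightarrow> nat \<Rightarrow> (nat \<Rightarrow> real \<Rightarrow> real) \<Rightarrow> real" where
  "energy_quotient p N v = energy N v / Lp_integral p N v powr (2 / p)"

definition minimizer :: "real \<Rightarrow> nat \<Rightarrow> (nat \<Rightarrow> real \<Rightarrow> real) \<Rightarrow> bool" where
  "minimizer p N v \<longleftrightarrow> v \<in> H10_star N \<and> nontrivial N v \<and>
     (\<forall>w\<in>H10_star N. nontrivial N w \<longrightarrow> energy_quotient p N v \<le> energy_quotient p N w)"

definition extremal :: "real \<Rightarrow> nat \<Rightarrow> (nat \<Rightarrow> real \<Rightarrow> real) \<Rightarrow> bool" where
  "extremal p N v \<longleftrightarrow> v \<in> H10_star N \<and> nontrivial N v \<and>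
     Lp_integral p N v powr (2 / p) = best_const p N * energy N v"

text \<open>
  The outward derivative at the origin along edge \<open>i\<close> is the one-sided derivative of \<open>v i\<close> at \<open>0\<close>.
  The condition at the vertex is imposed only when the origin is an inner vertex.
\<close>

definition kirchhoff :: "nat \<Rightarrow> (nat \<Rightarrow> real \<Rightarrow> real) \<Rightarrow> bool" where
  "kirchhoff N v \<longleftrightarrow>
     (\<exists>d. (\<forall>i<N. (v i has_real_derivative d i) (at 0 within {0..})) \<and> (\<Sum>i<N. d i) = 0)"

definition kirchhoff_solution :: "real \<Rightarrow> nat \<Rightarrow> (nat \<Rightarrow> real \<Rightarrow> real) \<Rightarrow> bool" where
  "kirchhoff_solution p N v \<longleftrightarrow> v \<in> H10_star N \<and>
     (\<forall>i<N. \<forall>s>0. v i field_differentiable (at s) \<and> deriv (v i) field_differentiable (at s) \<and>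
        - deriv (deriv (v i)) s + v i s = \<bar>v i s\<bar> powr (p - 2) * v i s) \<and>
     (N \<ge> 2 \<longrightarrow> kirchhoff N v)"

definition nonneg_solution :: "real \<Rightarrow> nat \<Rightarrow> (nat \<Rightarrow> real \<Rightarrow> real) \<Rightarrow> bool" where
  "nonneg_solution p N v \<longleftrightarrow> kirchhoff_solution p N v \<and> nonneg_star N v \<and> nontrivial N v"

definition vbar :: "real \<Rightarrow> real \<Rightarrow> real" where
  "vbar p s = (p / 2) powr (1 / (p - 2)) * cosh ((p - 2) * s / 2) powr (- 2 / (p - 2))"

end

theory Submission
  imports Defs
begin

text \<open>
  Along an edge, Young's inequality gives
  \<open>v'\<^sup>2 + v\<^sup>2 - (2/p) \<bar>v\<bar>\<^bsup>p\<^esup> \<ge> 2 \<bar>v'\<bar> g(v)\<close> with \<open>g(t)\<^sup>2 = t\<^sup>2 - (2/p) \<bar>t\<bar>\<^bsup>p\<^esup>\<close>, as long as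
  \<open>\<bar>v\<bar> \<le> M = vbar p 0\<close>. Normalise \<open>v\<close> so that \<open>max \<bar>v\<bar> = M\<close>. On a star with \<open>N \<ge> 2\<close> edges every level
  in \<open>(0, M)\<close> is crossed at least twice, so the energy \<open>E\<close> and the \<open>L\<^sup>p\<close> integral \<open>L\<close> satisfy
  \<open>E - (2/p) L \<ge> 4 \<integral>\<^sub>0\<^sup>M g = (1 - 2/p) m\<close>, where \<open>m\<close> is both the energy and the \<open>L\<^sup>p\<close> integral of the
  soliton \<open>vbar\<close> on the line. The weighted arithmetic-geometric mean inequality turns this into
  \<open>E \<ge> m\<^bsup>1-2/p\<^esup> L\<^bsup>2/p\<^esup>\<close>. For \<open>N \<ge> 3\<close> the levels below \<open>\<bar>v(0)\<bar>\<close> are crossed \<open>N\<close> times, so equality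
  forces \<open>v(0) = 0\<close> together with \<open>\<bar>v'\<bar> = g(v)\<close>, which is impossible. A soliton moving away from the
  vertex along one edge shows that the constant is optimal.

  Solutions in \<open>H\<^sup>1\<close> have zero energy, and \<open>w = v\<^bsup>-(p-2)/2\<^esup>\<close> solves a linear equation, so on each edge a
  non-negative solution is a translate of \<open>vbar\<close>. Continuity at the vertex makes all translations
  equal up to sign, and the Kirchhoff condition balances the two signs.
\<close>

subsection \<open>Weak derivatives and the fundamental theorem of calculus\<close>

text \<open>No compactness argument is used: every function is compared with the number
  \<open>mass p\<close>, and attainment is read off from the remainder. Young's inequality is
  therefore kept as an identity whose defect is the integral of (|v'| - g(v))^2. Crossings of levels
  are not counted literally. Each edge is measured with the primitive G = \<open>level p\<close> of
  g: an edge that starts at c = v(0) and tends to 0 at infinity has flux at least G(|c|), and the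
  edge carrying the maximum M has at least (G(M) - G(|c|)) + G(M). The sum 2 G(M) + (N - 2) G(|c|)
  shows where N >= 2 enters and why N = 2 is special. Normalising the maximum is dictated by g: v^2
  - (2/p)|v|^p is nonnegative exactly for |v| <= M. The scale a cancels later, since the weights 2/p
  and 1 - 2/p leave a factor a^2 on both sides. The energy contains \<open>weak_deriv\<close>, an
  arbitrary choice among functions equal almost everywhere. Estimates are therefore stated for pairs
  (f, d) with f an indefinite integral of d, and the choice is removed only when the energy of a
  concrete function is computed.\<close>

lemma has_real_derivative_half_max_sq:
  "((\<lambda>x::real. (max 0 x)\<^sup>2 / 2) has_real_derivative max 0 x) (at x)"
proof -
  consider "x < 0" | "x = 0" | "x > 0" by linarith
  then show ?thesis
  proof cases
    case 1
    have "((\<lambda>x::real. 0) has_real_derivative 0) (at x)" by simp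
    then have "((\<lambda>x::real. (max 0 x)\<^sup>2 / 2) has_real_derivative 0) (at x)"
      by (rule DERIV_cong_ev[THEN iffD1, rotated 3])
         (use 1 in \<open>auto intro!: eventually_mono[OF eventually_nhds_in_open[of "{..<0}"]]\<close>)
    then show ?thesis using 1 by simp
  next
    case 3
    have "((\<lambda>x::real. x\<^sup>2 / 2) has_real_derivative x) (at x)"
      by (auto intro!: derivative_eq_intros)
    then have "((\<lambda>x::real. (max 0 x)\<^sup>2 / 2) has_real_derivative x) (at x)"
      by (rule DERIV_cong_ev[THEN iffD1, rotated 3])
         (use 3 in \<open>auto intro!: eventually_mono[OF eventually_nhds_in_open[of "{0<..}"]]\<close>)
    then show ?thesis using 3 by simp
  next
    case 2
    have "((\<lambda>h. (max 0 h)\<^sup>2 / 2 / h) \<longlongrightarrow> 0) (at (0::real))"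
    proof (rule Lim_null_comparison)
      show "\<forall>\<^sub>F h in at (0::real). norm ((max 0 h)\<^sup>2 / 2 / h) \<le> \<bar>h\<bar>"
        by (rule always_eventually) (auto simp: max_def power2_eq_square)
      show "((\<lambda>h::real. \<bar>h\<bar>) \<longlongrightarrow> 0) (at 0)"
        by (rule tendsto_rabs_zero) (rule tendsto_ident_at)
    qed
    then show ?thesis using 2 by (simp add: DERIV_def)
  qed
qed

text \<open>A \<open>C\<^sup>1\<close> step: differences of its rescaled translates are test functions that tend to the
  indicator of an interval.\<close>

definition ramp :: "real \<Rightarrow> real" where
  "ramp x = (max 0 x)\<^sup>2 / 2 - 2 * ((max 0 (x - 1))\<^sup>2 / 2) + (max 0 (x - 2))\<^sup>2 / 2"

text \<open>A hat on [0, 2] of area 1, so \<open>m * tent (m * (x - a) - 1)\<close> is an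
  approximate Dirac mass at \<open>a\<close>. The offset 1 moves its support to [a + 1/m, a + 3/m],
  which lies in the open half-line even for a = 0.\<close>

definition tent :: "real \<Rightarrow> real" where
  "tent x = max 0 x - 2 * max 0 (x - 1) + max 0 (x - 2)"

lemma ramp_has_derivative: "(ramp has_real_derivative tent x) (at x)"
proof -
  have q: "((\<lambda>x. (max 0 (x - c))\<^sup>2 / 2) has_real_derivative max 0 (x - c)) (at x)" for c :: real
  proof -
    have "((\<lambda>x. x - c) has_real_derivative 1) (at x)" by (auto intro!: derivative_eq_intros)
    from DERIV_chain2[OF has_real_derivative_half_max_sq this] show ?thesis by simp
  qed
  show ?thesis
    unfolding ramp_def[abs_def] tent_def
    by (intro DERIV_add DERIV_diff DERIV_cmult q has_real_derivative_half_max_sq)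
qed

lemma ramp_affine_has_derivative:
  "((\<lambda>x. ramp (m * (x - a) - 1)) has_real_derivative m * tent (m * (x - a) - 1)) (at x)"
proof -
  have "((\<lambda>x. m * (x - a) - 1) has_real_derivative m) (at x)" by (auto intro!: derivative_eq_intros)
  from DERIV_chain2[OF ramp_has_derivative this] show ?thesis by (simp add: mult.commute)
qed

lemma tent_nonneg: "0 \<le> tent x"
  by (auto simp: tent_def max_def)

lemma tent_eq_0: "x \<le> 0 \<or> 2 \<le> x \<Longrightarrow> tent x = 0"
  by (auto simp: tent_def max_def)

lemma ramp_eq_0: "x \<le> 0 \<Longrightarrow> ramp x = 0"
  by (auto simp: ramp_def)

lemma ramp_eq_1: "2 \<le> x \<Longrightarrow> ramp x = 1"
  by (auto simp: ramp_def max_def power2_eq_square field_simps)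

lemma ramp_bounds: "0 \<le> ramp x" "ramp x \<le> 1"
proof -
  have mono: "ramp x \<le> ramp y" if "x \<le> y" for x y
    by (rule DERIV_nonneg_imp_nondecreasing[OF that]) (use ramp_has_derivative tent_nonneg in blast)
  show "0 \<le> ramp x" using mono[of "min x 0" x] ramp_eq_0[of "min x 0"] by simp
  show "ramp x \<le> 1" using mono[of x "max x 2"] ramp_eq_1[of "max x 2"] by simp
qed

lemma continuous_on_tent [continuous_intros]:
  "continuous_on S f \<Longrightarrow> continuous_on S (\<lambda>x. tent (f x))"
  unfolding tent_def by (intro continuous_intros)

text \<open>The weights are nonnegative, have integral 1 and live in [a, a + 3/m], where continuity
  keeps \<open>f\<close> within e/2 of \<open>f a\<close>. Approaching \<open>a\<close> from the
  right only is what admits the endpoint a = 0.\<close>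

lemma tendsto_integral_tent:
  fixes f :: "real \<Rightarrow> real"
  assumes f: "continuous_on {0..} f" and a: "0 \<le> a"
  shows "(\<lambda>n. LINT x:{0..}|lborel. f x * (real (Suc n) * tent (real (Suc n) * (x - a) - 1)))
           \<longlonglongrightarrow> f a"
proof (rule LIMSEQ_I)
  fix e :: real assume e: "0 < e"
  obtain d where d: "d > 0" and fd: "\<And>x. x \<ge> 0 \<Longrightarrow> dist x a < d \<Longrightarrow> dist (f x) (f a) < e / 2"
    using f a e unfolding continuous_on_iff by (metis atLeast_iff half_gt_zero)
  obtain n0 where n0: "3 / d < real n0" using reals_Archimedean2 by blast
  have "norm ((LINT x:{0..}|lborel. f x * (real (Suc n) * tent (real (Suc n) * (x - a) - 1))) - f a) < e"
    if n: "n \<ge> n0" for n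
  proof -
    define m where "m = real (Suc n)"
    have m: "m > 0" "3 / m < d"
    proof -
      show "m > 0" by (simp add: m_def)
      have "3 / d < m" using n0 n by (simp add: m_def)
      then show "3 / m < d" using d \<open>m > 0\<close> by (simp add: field_simps)
    qed
    define w where "w x = m * tent (m * (x - a) - 1)" for x
    define I where "I = {a..a + 3 / m}"
    have w0: "w x = 0" if "x \<notin> I" for x
    proof -
      have "m * (x - a) - 1 \<le> 0 \<or> 2 \<le> m * (x - a) - 1"
      proof (cases "x < a")
        case True
        then have "m * (x - a) < 0" using m by (simp add: mult_pos_neg)
        then show ?thesis by simp
      next
        case False
        then have "3 / m < x - a" using that by (auto simp: I_def)
        then show ?thesis using m by (auto simp: field_simps)
      qed
      then show ?thesis by (simp add: w_def tent_eq_0)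
    qed
    have wnn: "0 \<le> w x" for x using m by (simp add: w_def tent_nonneg)
    have cw: "continuous_on S w" for S unfolding w_def by (intro continuous_intros)
    have cf: "continuous_on I f" using f by (rule continuous_on_subset) (use a in \<open>auto simp: I_def\<close>)
    have iI: "set_integrable lborel I h" if "continuous_on I h" for h :: "real \<Rightarrow> real"
      using that unfolding I_def by (rule borel_integrable_atLeastAtMost')
    have "(LINT x:I|lborel. w x) = ramp (m * (a + 3 / m - a) - 1) - ramp (m * (a - a) - 1)"
      unfolding I_def set_lebesgue_integral_def
    proof (rule integral_FTC_atLeastAtMost)
      show "a \<le> a + 3 / m" using m by simp
      fix x
      have "((\<lambda>x. ramp (m * (x - a) - 1)) has_real_derivative w x) (at x within {a..a + 3 / m})"
        unfolding w_def by (rule has_field_derivative_at_within[OF ramp_affine_has_derivative])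
      then show "((\<lambda>x. ramp (m * (x - a) - 1)) has_vector_derivative w x) (at x within {a..a + 3 / m})"
        by (simp add: has_real_derivative_iff_has_vector_derivative)
    qed (rule cw)
    then have w1: "(LINT x:I|lborel. w x) = 1" using m by (simp add: ramp_eq_0 ramp_eq_1)
    have "(LINT x:{0..}|lborel. f x * w x) = (LINT x:I|lborel. f x * w x)"
      unfolding set_lebesgue_integral_def
      by (rule Bochner_Integration.integral_cong) (use w0 a in \<open>auto simp: indicator_def I_def\<close>)
    also have "\<dots> - f a = (LINT x:I|lborel. f x * w x - f a * w x)"
      by (subst set_integral_diff) (auto intro!: iI continuous_intros cf cw simp: w1)
    finally have eq: "(LINT x:{0..}|lborel. f x * w x) - f a = (LINT x:I|lborel. (f x - f a) * w x)"
      by (simp add: algebra_simps)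
    have "norm (LINT x:I|lborel. (f x - f a) * w x) \<le> (LINT x:I|lborel. norm ((f x - f a) * w x))"
      unfolding set_lebesgue_integral_def
      by (rule order_trans[OF integral_norm_bound]) (simp add: abs_mult)
    also have "\<dots> \<le> (LINT x:I|lborel. e / 2 * w x)"
    proof (rule set_integral_mono)
      fix x assume x: "x \<in> I"
      then have "dist (f x) (f a) < e / 2" using fd[of x] m a by (auto simp: I_def dist_real_def)
      then have "\<bar>f x - f a\<bar> \<le> e / 2" by (simp add: dist_real_def)
      then show "norm ((f x - f a) * w x) \<le> e / 2 * w x"
        using mult_right_mono[OF _ wnn[of x]] wnn[of x] by (simp only: real_norm_def abs_mult abs_of_nonneg)
    qed (auto intro!: iI continuous_intros cf cw)
    also have "\<dots> = e / 2" using w1 by simp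
    finally show ?thesis using eq e by (simp add: w_def m_def)
  qed
  then show "\<exists>no. \<forall>n\<ge>no. norm ((LINT x:{0..}|lborel. f x * (real (Suc n) * tent (real (Suc n) * (x - a) - 1))) - f a) < e"
    by blast
qed

section \<open>From test functions to indefinite integrals\<close>

lemma set_borel_measurable_continuous_half:
  fixes f :: "real \<Rightarrow> real"
  assumes "continuous_on {0..} f"
  shows "set_borel_measurable lborel {0..} f"
  using borel_measurable_continuous_on_indicator[OF _ assms]
  by (simp add: set_borel_measurable_def)

text \<open>On a bounded interval the pointwise bound |d| <= 1 + d^2 takes the place of the
  Cauchy-Schwarz inequality.\<close>

lemma set_integrable_Icc_of_square:
  fixes d :: "real \<Rightarrow> real"
  assumes d: "set_borel_measurable lborel {0..} d" "set_integrable lborel {0..} (\<lambda>s. (d s)\<^sup>2)"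
    and a: "0 \<le> a"
  shows "set_integrable lborel {a..b} d"
proof -
  have sub: "{a..b} \<subseteq> {0..}" using a by auto
  have "set_integrable lborel {a..b} (\<lambda>s. 1 + (d s)\<^sup>2)"
    by (rule set_integral_add)
       (auto intro: borel_integrable_atLeastAtMost' set_integrable_subset[OF d(2) _ sub])
  then show ?thesis
  proof (rule set_integrable_bound)
    show "set_borel_measurable lborel {a..b} d"
      by (rule set_borel_measurable_subset[OF d(1) _ sub]) simp
    have "norm (d x) \<le> norm (1 + (d x)\<^sup>2)" for x
      using zero_le_power2[of "\<bar>d x\<bar> - 1"] by (simp add: power2_eq_square algebra_simps)
    then show "AE x in lborel. x \<in> {a..b} \<longrightarrow> norm (d x) \<le> norm (1 + (d x)\<^sup>2)" by simp
  qed
qed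

text \<open>Both steps are 0 before a + 1/m and both are 1 after b + 3/m, so their difference has
  compact support in the open half-line.\<close>

lemma test_function_ramp:
  assumes "0 \<le> a" "a \<le> b" "0 < m"
  shows "test_function (\<lambda>x. ramp (m * (x - a) - 1) - ramp (m * (x - b) - 1))"
    and "deriv (\<lambda>x. ramp (m * (x - a) - 1) - ramp (m * (x - b) - 1)) =
         (\<lambda>x. m * tent (m * (x - a) - 1) - m * tent (m * (x - b) - 1))"
proof -
  let ?phi = "\<lambda>x. ramp (m * (x - a) - 1) - ramp (m * (x - b) - 1)"
  have D: "(?phi has_real_derivative (m * tent (m * (x - a) - 1) - m * tent (m * (x - b) - 1))) (at x)" for x
    by (intro DERIV_diff ramp_affine_has_derivative)
  show eq: "deriv ?phi = (\<lambda>x. m * tent (m * (x - a) - 1) - m * tent (m * (x - b) - 1))"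
    using D by (auto intro!: DERIV_imp_deriv)
  show "test_function ?phi"
    unfolding test_function_def
  proof (intro conjI allI exI impI)
    show "?phi field_differentiable at x" for x
      using D unfolding field_differentiable_def by blast
    show "continuous_on UNIV (deriv ?phi)" unfolding eq by (intro continuous_intros)
    show "0 < a + 1 / m" using assms by (simp add: add_nonneg_pos)
    fix x assume "x \<notin> {a + 1 / m..b + 3 / m}"
    then consider "x < a + 1 / m" | "x > b + 3 / m" by force
    then show "?phi x = 0"
    proof cases
      case 1
      then have "m * (x - a) - 1 \<le> 0" using assms by (simp add: field_simps)
      moreover have "m * (x - b) \<le> m * (x - a)" using assms by simp
      ultimately show ?thesis by (simp add: ramp_eq_0)
    next
      case 2
      then have "m * (x - b) - 1 \<ge> 2" using assms by (simp add: field_simps)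
      moreover have "m * (x - b) \<le> m * (x - a)" using assms by simp
      ultimately show ?thesis by (simp add: ramp_eq_1)
    qed
  qed
qed

text \<open>The absolutely continuous form of membership in H^1. All estimates use this form; test
  functions return only when translates of \<open>vbar\<close> are shown to lie in
  \<open>H1_half\<close>.\<close>

definition H1_pair :: "(real \<Rightarrow> real) \<Rightarrow> (real \<Rightarrow> real) \<Rightarrow> bool" where
  "H1_pair f d \<longleftrightarrow> continuous_on {0..} f \<and> set_borel_measurable lborel {0..} d \<and>
     set_integrable lborel {0..} (\<lambda>s. (f s)\<^sup>2) \<and> set_integrable lborel {0..} (\<lambda>s. (d s)\<^sup>2) \<and>
     (\<forall>a b. 0 \<le> a \<longrightarrow> a \<le> b \<longrightarrow> f b - f a = (LINT s:{a..b}|lborel. d s))"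

text \<open>Test with the steps \<open>phi n\<close>: their derivatives concentrate at
  \<open>a\<close> and \<open>b\<close> with opposite signs and give f a - f b in the limit, while
  \<open>phi n\<close> itself tends to the indicator of (a, b].\<close>

lemma weak_deriv_FTC:
  fixes f g :: "real \<Rightarrow> real"
  assumes f: "continuous_on {0..} f" and g: "has_weak_deriv f g" and ab: "0 \<le> a" "a \<le> b"
  shows "f b - f a = (LINT s:{a..b}|lborel. g s)"
proof -
  have gm: "set_borel_measurable lborel {0..} g" and g2: "set_integrable lborel {0..} (\<lambda>s. (g s)\<^sup>2)"
    using g by (auto simp: has_weak_deriv_def L2_half_def)
  define phi where "phi n x = ramp (real (Suc n) * (x - a) - 1) - ramp (real (Suc n) * (x - b) - 1)" for n x
  define wa where "wa n x = real (Suc n) * tent (real (Suc n) * (x - a) - 1)" for n x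
  define wb where "wb n x = real (Suc n) * tent (real (Suc n) * (x - b) - 1)" for n x
  have phi: "phi n = (\<lambda>x. ramp (real (Suc n) * (x - a) - 1) - ramp (real (Suc n) * (x - b) - 1))" for n
    by (auto simp: phi_def)
  have tf: "test_function (phi n)" "deriv (phi n) = (\<lambda>x. wa n x - wb n x)" for n
    using test_function_ramp[OF ab, of "real (Suc n)"] unfolding phi wa_def wb_def by auto
  have int: "set_integrable lborel {0..} (\<lambda>x. f x * (real (Suc n) * tent (real (Suc n) * (x - c) - 1)))"
    if "0 \<le> c" for n c
  proof -
    have "set_integrable lborel {0..c+3} (\<lambda>x. f x * (real (Suc n) * tent (real (Suc n) * (x - c) - 1)))"
      by (intro borel_integrable_atLeastAtMost' continuous_intros continuous_on_subset[OF f]) auto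
    then show ?thesis
      unfolding set_integrable_def
    proof (rule Bochner_Integration.integrable_cong[THEN iffD1, rotated 2])
      fix x
      have "tent (real (Suc n) * (x - c) - 1) = 0" if "x > c + 3"
      proof (rule tent_eq_0, rule disjI2)
        have "1 * 3 \<le> real (Suc n) * (x - c)" using that by (intro mult_mono) auto
        then show "2 \<le> real (Suc n) * (x - c) - 1" by simp
      qed
      then show "indicat_real {0..c + 3} x *\<^sub>R (f x * (real (Suc n) * tent (real (Suc n) * (x - c) - 1))) =
         indicat_real {0..} x *\<^sub>R (f x * (real (Suc n) * tent (real (Suc n) * (x - c) - 1)))"
        by (auto simp: indicator_def)
    qed simp
  qed
  have "(\<lambda>n. (LINT s:{0..}|lborel. f s * wa n s) - (LINT s:{0..}|lborel. f s * wb n s)) \<longlonglongrightarrow> f a - f b"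
    unfolding wa_def wb_def using ab by (intro tendsto_diff tendsto_integral_tent f) auto
  also have "(\<lambda>n. (LINT s:{0..}|lborel. f s * wa n s) - (LINT s:{0..}|lborel. f s * wb n s)) =
    (\<lambda>n. LINT s:{0..}|lborel. f s * deriv (phi n) s)"
  proof
    fix n
    show "(LINT s:{0..}|lborel. f s * wa n s) - (LINT s:{0..}|lborel. f s * wb n s) =
      (LINT s:{0..}|lborel. f s * deriv (phi n) s)"
      unfolding tf(2) right_diff_distrib
      by (rule set_integral_diff(2)[symmetric]) (use int ab in \<open>auto simp: wa_def wb_def\<close>)
  qed
  also have "\<dots> = (\<lambda>n. - (LINT s:{0..}|lborel. g s * phi n s))"
    using g tf(1) by (auto simp: has_weak_deriv_def)
  finally have lim1: "(\<lambda>n. - (LINT s:{0..}|lborel. g s * phi n s)) \<longlonglongrightarrow> f a - f b" .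
  have lim2: "(\<lambda>n. LINT s:{0..}|lborel. g s * phi n s) \<longlonglongrightarrow> (LINT s:{a<..b}|lborel. g s)"
    unfolding set_lebesgue_integral_def
  proof (rule integral_dominated_convergence)
    \<comment> \<open>Since \<open>Suc n\<close> is at least 1, every \<open>phi n\<close> is
      supported in [a, b + 3] and bounded by 1, so |g| on this interval dominates.\<close>
    let ?G = "\<lambda>s. indicat_real {a..b+3} s *\<^sub>R g s"
    have gi: "set_integrable lborel {a..b + 3} g"
      by (rule set_integrable_Icc_of_square[OF gm g2]) fact
    then show "integrable lborel (\<lambda>s. norm (?G s))" 
      unfolding set_integrable_def by (rule integrable_norm)
    have phim: "phi n \<in> borel_measurable lborel" for n
    proof -
      have "continuous_on UNIV (phi n)"
        using tf(1)[of n] by (auto simp: test_function_def intro!: field_differentiable_imp_continuous_at continuous_at_imp_continuous_on)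
      then show ?thesis by (auto intro: borel_measurable_continuous_onI)
    qed
    have "(\<lambda>x. (indicat_real {0..} x *\<^sub>R g x) * phi n x) \<in> borel_measurable lborel" for n
      using gm phim[of n] unfolding set_borel_measurable_def by (rule borel_measurable_times)
    then show "(\<lambda>x. indicat_real {0..} x *\<^sub>R (g x * phi n x)) \<in> borel_measurable lborel" for n
      by (simp add: mult.assoc)
    have "{a<..b} \<subseteq> {0..}" using ab by auto
    then show "(\<lambda>x. indicat_real {a<..b} x *\<^sub>R g x) \<in> borel_measurable lborel"
      using set_borel_measurable_subset[OF gm] by (simp add: set_borel_measurable_def)
    show "AE x in lborel. norm (indicat_real {0..} x *\<^sub>R (g x * phi n x)) \<le> norm (?G x)" for n
    proof (rule AE_I2)
      fix x
      have 1: "\<bar>phi n x\<bar> \<le> 1"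
        using ramp_bounds[of "real (Suc n) * (x - a) - 1"] ramp_bounds[of "real (Suc n) * (x - b) - 1"]
        by (auto simp: phi_def abs_le_iff)
      have "phi n x = 0" if "x < a"
      proof -
        have "real (Suc n) * (x - a) \<le> 0" "real (Suc n) * (x - b) \<le> 0"
          using that ab by (auto intro!: mult_nonneg_nonpos)
        then show ?thesis by (simp add: phi_def ramp_eq_0)
      qed
      moreover have "phi n x = 0" if "x > b + 3"
      proof -
        have "1 * 3 \<le> real (Suc n) * (x - a)" "1 * 3 \<le> real (Suc n) * (x - b)"
          using that ab by (intro mult_mono; simp)+
        then show ?thesis by (simp add: phi_def ramp_eq_1)
      qed
      ultimately have "phi n x = 0" if "x \<notin> {a..b+3}" using that by force
      then show "norm (indicat_real {0..} x *\<^sub>R (g x * phi n x)) \<le> norm (?G x)"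
        using 1 ab by (auto simp: indicator_def abs_mult mult_left_le)
    qed
    show "AE x in lborel. (\<lambda>n. indicat_real {0..} x *\<^sub>R (g x * phi n x)) \<longlonglongrightarrow> indicat_real {a<..b} x *\<^sub>R g x"
    proof (rule AE_I2)
      fix x
      have R: "(\<lambda>n. ramp (real (Suc n) * (x - c) - 1)) \<longlonglongrightarrow> (if x > c then 1 else 0)" for c
      proof (cases "x > c")
        case True
        obtain n0 where n0: "3 / (x - c) < real n0" using reals_Archimedean2 by blast
        have "ramp (real (Suc n) * (x - c) - 1) = 1" if "n \<ge> n0" for n
        proof (rule ramp_eq_1)
          have "3 / (x - c) < real (Suc n)" using n0 that by linarith
          then show "2 \<le> real (Suc n) * (x - c) - 1" using True by (simp add: field_simps)
        qed
        then have "\<forall>\<^sub>F n in sequentially. ramp (real (Suc n) * (x - c) - 1) = (if x > c then 1 else 0)"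
          unfolding eventually_sequentially using True by auto
        then show ?thesis by (rule tendsto_eventually)
      next
        case False
        have "ramp (real (Suc n) * (x - c) - 1) = 0" for n
        proof -
          have "real (Suc n) * (x - c) \<le> 0" using False by (intro mult_nonneg_nonpos) auto
          then show ?thesis by (simp add: ramp_eq_0)
        qed
        then show ?thesis using False by simp
      qed
      have "phi n x = ramp (real (Suc n) * (x - a) - 1) - ramp (real (Suc n) * (x - b) - 1)" for n
        by (simp add: phi_def)
      then have "(\<lambda>n. phi n x) \<longlonglongrightarrow> (if x > a then 1 else 0) - (if x > b then 1 else 0)"
        using tendsto_diff[OF R[of a] R[of b]] by presburger
      then have "(\<lambda>n. indicat_real {0..} x *\<^sub>R (g x * phi n x)) \<longlonglongrightarrow>
          indicat_real {0..} x *\<^sub>R (g x * ((if x > a then 1 else 0) - (if x > b then 1 else 0)))"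
        by (intro tendsto_intros)
      also have "indicat_real {0..} x *\<^sub>R (g x * ((if x > a then 1 else 0) - (if x > b then 1 else 0))) =
        indicat_real {a<..b} x *\<^sub>R g x"
        using ab by (auto simp: indicator_def)
      finally show "(\<lambda>n. indicat_real {0..} x *\<^sub>R (g x * phi n x)) \<longlonglongrightarrow> indicat_real {a<..b} x *\<^sub>R g x" .
    qed
  qed
  have "f a - f b = - (LINT s:{a<..b}|lborel. g s)"
    using LIMSEQ_unique[OF lim1 tendsto_minus[OF lim2]] .
  also have "(LINT s:{a<..b}|lborel. g s) = (LINT s:{a..b}|lborel. g s)"
  proof (rule set_integral_cong_set)
    show "set_borel_measurable lborel {a<..b} g"
      by (rule set_borel_measurable_subset[OF gm]) (use ab in auto)
    show "set_borel_measurable lborel {a..b} g"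
      by (rule set_borel_measurable_subset[OF gm]) (use ab in auto)
    show "AE x in lborel. (x \<in> {a..b}) = (x \<in> {a<..b})"
      using AE_lborel_singleton[of a] by eventually_elim auto
  qed
  finally show ?thesis by simp
qed

lemma H1_pair_weak_deriv:
  assumes "continuous_on {0..} f" "L2_half f" "has_weak_deriv f g"
  shows "H1_pair f g"
  using assms weak_deriv_FTC[OF assms(1,3)] unfolding H1_pair_def
  by (auto simp: has_weak_deriv_def L2_half_def)

text \<open>The difference of the two functions, cut off to [0, n], has integral 0 over every
  half-line to the right of a point x. Its positive and negative parts are thus densities of
  measures that agree on all these half-lines, hence everywhere, and densities of the same measure
  agree almost everywhere.\<close>

lemma AE_eq_of_interval_integrals:
  fixes g h :: "real \<Rightarrow> real"
  assumes g: "\<And>b. set_integrable lborel {0..b} g" and h: "\<And>b. set_integrable lborel {0..b} h"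
    and eq: "\<And>a b. 0 \<le> a \<Longrightarrow> a \<le> b \<Longrightarrow> (LINT s:{a..b}|lborel. g s) = (LINT s:{a..b}|lborel. h s)"
  shows "AE s in lborel. s \<in> {0..} \<longrightarrow> g s = h s"
proof -
  have *: "AE s in lborel. s \<in> {0..real n} \<longrightarrow> g s = h s" for n
  proof -
    define k where "k s = indicat_real {0..real n} s *\<^sub>R (g s - h s)" for s
    have ki: "integrable lborel k"
      using set_integral_diff(1)[OF g h, of "real n"] by (simp add: k_def[abs_def] set_integrable_def)
    then have [measurable]: "k \<in> borel_measurable borel" by simp
    \<comment> \<open>\<open>ennreal\<close> sends negative numbers to 0, so the two densities are
      the positive and the negative part of \<open>k\<close>.\<close>
    let ?M = "density lborel (\<lambda>s. ennreal (k s))" and ?N = "density lborel (\<lambda>s. ennreal (- k s))"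
    have em: "emeasure (density lborel (\<lambda>s. ennreal (u s))) {x<..} = ennreal (\<integral>s. max 0 (u s) * indicator {x<..} s \<partial>lborel)"
      if u: "integrable lborel u" for x and u :: "real \<Rightarrow> real"
    proof -
      have [measurable]: "u \<in> borel_measurable borel" using u by simp
      have "integrable lborel (\<lambda>s. indicator {x<..} s *\<^sub>R max 0 (u s))"
        by (intro integrable_mult_indicator integrable_max integrable_zero u) simp
      then have "(\<integral>\<^sup>+s. ennreal (max 0 (u s) * indicator {x<..} s) \<partial>lborel) = ennreal (\<integral>s. max 0 (u s) * indicator {x<..} s \<partial>lborel)"
        by (intro nn_integral_eq_integral) (auto simp: mult.commute)
      also have "(\<integral>\<^sup>+s. ennreal (max 0 (u s) * indicator {x<..} s) \<partial>lborel) = (\<integral>\<^sup>+s. ennreal (u s) * indicator {x<..} s \<partial>lborel)"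
        by (rule nn_integral_cong) (auto simp: indicator_def ennreal_max_0)
      also have "\<dots> = emeasure (density lborel (\<lambda>s. ennreal (u s))) {x<..}"
        by (subst emeasure_density) auto
      finally show ?thesis by simp
    qed
    have k0: "(\<integral>s. k s * indicator {x<..} s \<partial>lborel) = 0" for x
    proof -
      define a where "a = max 0 x"
      show ?thesis
      proof (cases "a \<le> real n")
        case True
        have sub: "{a..real n} \<subseteq> {0..real n}" by (auto simp: a_def)
        have gi: "set_integrable lborel {a..real n} g" "set_integrable lborel {a..real n} h"
          by (auto intro!: set_integrable_subset[OF g _ sub] set_integrable_subset[OF h _ sub])
        have "(\<integral>s. k s * indicator {x<..} s \<partial>lborel) = (LINT s:{a..real n}|lborel. g s - h s)"
          unfolding set_lebesgue_integral_def
        proof (rule integral_cong_AE)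
          show "(\<lambda>s. indicat_real {a..real n} s *\<^sub>R (g s - h s)) \<in> borel_measurable lborel"
            using set_integral_diff(1)[OF gi] by (auto simp: set_integrable_def dest: borel_measurable_integrable)
          show "AE s in lborel. k s * indicat_real {x<..} s = indicat_real {a..real n} s *\<^sub>R (g s - h s)"
            using AE_lborel_singleton[of x]
            by eventually_elim (auto simp: k_def a_def indicator_def)
        qed simp
        also have "\<dots> = 0" using eq[of a "real n"] True by (subst set_integral_diff(2)[OF gi]) (auto simp: a_def)
        finally show ?thesis .
      next
        case False
        then have "(\<lambda>s. k s * indicator {x<..} s) = (\<lambda>s. 0)" by (auto simp: k_def a_def indicator_def)
        then show ?thesis by (simp only: integral_zero)
      qed
    qed
    have "?M = ?N"
    proof (rule measure_eqI_lessThan)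
      fix x
      have km: "integrable lborel (\<lambda>s. - k s)" using ki by simp
      show "emeasure ?M {x<..} < \<infinity>" by (subst em[OF ki]) simp
      have i: "integrable lborel (\<lambda>s. max 0 (k s) * indicator {x<..} s)" "integrable lborel (\<lambda>s. max 0 (- k s) * indicator {x<..} s)"
        using ki km by (auto intro!: integrable_real_mult_indicator integrable_max)
      have "(\<integral>s. max 0 (k s) * indicator {x<..} s \<partial>lborel) - (\<integral>s. max 0 (- k s) * indicator {x<..} s \<partial>lborel)
         = (\<integral>s. max 0 (k s) * indicator {x<..} s - max 0 (- k s) * indicator {x<..} s \<partial>lborel)"
        by (rule Bochner_Integration.integral_diff[symmetric]) (use i in auto)
      also have "\<dots> = (\<integral>s. k s * indicator {x<..} s \<partial>lborel)"
        by (rule Bochner_Integration.integral_cong) (auto simp: max_def)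
      finally have "(\<integral>s. max 0 (k s) * indicator {x<..} s \<partial>lborel) = (\<integral>s. max 0 (- k s) * indicator {x<..} s \<partial>lborel)"
        using k0[of x] by simp
      then show "emeasure ?M {x<..} = emeasure ?N {x<..}" by (simp only: em[OF ki] em[OF km])
    qed auto
    then have "AE s in lborel. ennreal (k s) = ennreal (- k s)"
      by (subst (asm) sigma_finite_measure.density_unique_iff[OF sigma_finite_lborel]) auto
    then show ?thesis
    proof eventually_elim
      case (elim s)
      \<comment> \<open>At least one of the two sides is truncated to 0, so equality leaves no room
        for a nonzero value.\<close>
      then have "k s = 0" 
        by (metis ennreal_eq_0_iff ennreal_neg linear neg_0_le_iff_le neg_le_0_iff_le order_antisym)
      then show ?case by (auto simp: k_def)
    qed
  qed
  then have "AE s in lborel. \<forall>n::nat. s \<in> {0..real n} \<longrightarrow> g s = h s"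
    unfolding AE_all_countable using * by blast
  then show ?thesis
  proof eventually_elim
    case (elim s)
    obtain n where "s \<le> real n" using real_arch_simple by blast
    then show ?case using elim[rule_format, of n] by auto
  qed
qed

text \<open>Makes the energy independent of the choice hidden in \<open>weak_deriv\<close>, so that
  for translates of \<open>vbar\<close> it can be computed with \<open>vbar'\<close>.\<close>

lemma H1_pair_unique:
  assumes "H1_pair f d" "H1_pair f e"
  shows "AE s in lborel. s \<in> {0..} \<longrightarrow> d s = e s"
proof (rule AE_eq_of_interval_integrals)
  show "set_integrable lborel {0..b} d" "set_integrable lborel {0..b} e" for b
    using assms by (auto simp: H1_pair_def intro!: set_integrable_Icc_of_square)
  show "(LINT s:{a..b}|lborel. d s) = (LINT s:{a..b}|lborel. e s)" if "0 \<le> a" "a \<le> b" for a b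
    using assms that unfolding H1_pair_def by metis
qed

subsection \<open>Variation and decay of \<open>H\<^sup>1\<close> functions\<close>

lemma H1_pairD:
  assumes "H1_pair f d"
  shows "continuous_on {0..} f" "set_borel_measurable lborel {0..} d"
    "set_integrable lborel {0..} (\<lambda>s. (f s)\<^sup>2)" "set_integrable lborel {0..} (\<lambda>s. (d s)\<^sup>2)"
    "\<And>a b. 0 \<le> a \<Longrightarrow> a \<le> b \<Longrightarrow> f b - f a = (LINT s:{a..b}|lborel. d s)"
  using assms by (auto simp: H1_pair_def)

lemma H1_pair_Icc:
  assumes "H1_pair f d" "0 \<le> a"
  shows "set_integrable lborel {a..b} d"
  using assms by (auto simp: H1_pair_def intro!: set_integrable_Icc_of_square)

lemma set_integrable_mult_continuous:
  fixes d h :: "real \<Rightarrow> real"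
  assumes d: "set_integrable lborel {a..b} d" and h: "continuous_on {a..b} h"
  shows "set_integrable lborel {a..b} (\<lambda>s. h s * d s)"
proof -
  obtain B where B: "\<And>s. s \<in> {a..b} \<Longrightarrow> norm (h s) \<le> B"
    using compact_continuous_image[OF h] compact_imp_bounded bounded_iff by (metis compact_Icc imageI)
  have "set_integrable lborel {a..b} (\<lambda>s. B * d s)" using d by simp
  then show ?thesis
  proof (rule set_integrable_bound)
    have "(\<lambda>s. (indicator {a..b} s *\<^sub>R h s) * (indicator {a..b} s *\<^sub>R d s)) \<in> borel_measurable lborel"
      using borel_measurable_continuous_on_indicator[OF _ h] d
      by (intro borel_measurable_times) (auto simp: set_integrable_def)
    also have "(\<lambda>s. (indicator {a..b} s *\<^sub>R h s) * (indicator {a..b} s *\<^sub>R d s)) =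
       (\<lambda>s. indicator {a..b} s *\<^sub>R (h s * d s))"
      by (auto simp: indicator_def)
    finally show "set_borel_measurable lborel {a..b} (\<lambda>s. h s * d s)"
      by (simp add: set_borel_measurable_def)
    have "norm (h s * d s) \<le> norm (B * d s)" if "s \<in> {a..b}" for s
    proof -
      have "\<bar>h s\<bar> \<le> \<bar>B\<bar>" using B[OF that] by simp
      then show ?thesis by (simp add: abs_mult mult_right_mono)
    qed
    then show "AE s in lborel. s \<in> {a..b} \<longrightarrow> norm (h s * d s) \<le> norm (B * d s)" by simp
  qed
qed

lemma set_integral_Icc_split:
  fixes h :: "real \<Rightarrow> real"
  assumes "set_integrable lborel {a..c} h" "a \<le> b" "b \<le> c"
  shows "(LINT s:{a..c}|lborel. h s) = (LINT s:{a..b}|lborel. h s) + (LINT s:{b..c}|lborel. h s)"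
proof -
  have i: "set_integrable lborel {a..b} h" "set_integrable lborel {b..c} h"
    by (rule set_integrable_subset[OF assms(1)]; use assms in auto)+
  have "(LINT s:{a..b}\<union>{b..c}|lborel. h s) = (LINT s:{a..b}|lborel. h s) + (LINT s:{b..c}|lborel. h s)"
    by (rule set_integral_Un_AE[OF _ _ _ i]) (use AE_lborel_singleton[of b] in \<open>auto elim: eventually_mono\<close>)
  also have "{a..b}\<union>{b..c} = {a..c}" using assms by auto
  finally show ?thesis .
qed

lemma set_integral_atLeast_split:
  fixes h :: "real \<Rightarrow> real"
  assumes "set_integrable lborel {a..} h" "a \<le> b"
  shows "(LINT s:{a..}|lborel. h s) = (LINT s:{a..b}|lborel. h s) + (LINT s:{b..}|lborel. h s)"
proof -
  have i: "set_integrable lborel {a..b} h" "set_integrable lborel {b..} h"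
    by (rule set_integrable_subset[OF assms(1)]; use assms in auto)+
  have "(LINT s:{a..b}\<union>{b..}|lborel. h s) = (LINT s:{a..b}|lborel. h s) + (LINT s:{b..}|lborel. h s)"
    by (rule set_integral_Un_AE[OF _ _ _ i]) (use AE_lborel_singleton[of b] in \<open>auto elim: eventually_mono\<close>)
  also have "{a..b}\<union>{b..} = {a..}" using assms by auto
  finally show ?thesis .
qed

text \<open>Since \<open>f\<close> need not be differentiable anywhere in the classical sense, the chain rule is replaced
  by this inequality, which is local up to an error \<open>e \<integral>\<bar>d\<bar>\<close> and additive over adjacent intervals.\<close>

lemma H1_pair_chain:
  fixes f d g G :: "real \<Rightarrow> real"
  assumes H: "H1_pair f d" and ab: "0 \<le> a" "a \<le> b"
    and g: "continuous_on UNIV g" "\<And>t. 0 \<le> g t"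
    and G: "\<And>t. (G has_real_derivative g t) (at t)"
  shows "\<bar>G (f b) - G (f a)\<bar> \<le> (LINT s:{a..b}|lborel. g (f s) * \<bar>d s\<bar>)"
proof -
  have di: "set_integrable lborel {x..y} (\<lambda>s. \<bar>d s\<bar>)" if "0 \<le> x" for x y
    using H1_pair_Icc[OF H that] by (rule set_integrable_abs)
  have cf: "continuous_on {x..y} f" if "0 \<le> x" for x y
    by (rule continuous_on_subset[OF H1_pairD(1)[OF H]]) (use that in auto)
  have cg: "continuous_on {x..y} (\<lambda>s. g (f s))" if "0 \<le> x" for x y
    by (rule continuous_on_compose2[OF g(1) cf[OF that]]) simp
  have gi: "set_integrable lborel {x..y} (\<lambda>s. (g (f s) + e) * \<bar>d s\<bar>)" if "0 \<le> x" for x y e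
    by (rule set_integrable_mult_continuous[OF di[OF that]]) (intro continuous_intros cg that)
  define K where "K = (LINT s:{a..b}|lborel. \<bar>d s\<bar>)"
  have main: "\<bar>G (f b) - G (f a)\<bar> \<le> (LINT s:{a..b}|lborel. g (f s) * \<bar>d s\<bar>) + e * K" if e: "e > 0" for e
  proof -
    \<comment> \<open>A property of intervals suited to \<open>Bolzano\<close>: it passes to
      adjacent unions and holds on short intervals around each point. The slack \<open>e\<close> in
      the integrand is what makes the local part provable.\<close>
    define P where "P x y \<longleftrightarrow> 0 \<le> x \<longrightarrow> \<bar>G (f y) - G (f x)\<bar> \<le> (LINT s:{x..y}|lborel. (g (f s) + e) * \<bar>d s\<bar>)" for x y
    have "P a b" using ab(2)
    proof (induction rule: Bolzano)
      case (trans x y z)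
      then show ?case
        using set_integral_Icc_split[OF gi[of x z e], of y] unfolding P_def by auto
    next
      case (local x)
      then have x0: "0 \<le> x" using ab by simp
      \<comment> \<open>The slack is split in two: one e/2 bounds \<open>g\<close> at the mean value
        point from above, the other bounds \<open>g (f s)\<close> under the integral from
        below.\<close>
      obtain r where r: "r > 0" "\<And>t. dist t (f x) < r \<Longrightarrow> dist (g t) (g (f x)) < e / 2"
        using g(1) e unfolding continuous_on_iff by (metis UNIV_I half_gt_zero)
      obtain \<delta> where \<delta>: "\<delta> > 0" "\<And>y. y \<ge> 0 \<Longrightarrow> dist y x < \<delta> \<Longrightarrow> dist (f y) (f x) < r"
        using H1_pairD(1)[OF H] x0 r(1) unfolding continuous_on_iff by (metis atLeast_iff)
      show ?case
      proof (intro exI[of _ \<delta>] conjI allI impI \<delta>(1))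
        fix u v assume uv: "u \<le> x \<and> x \<le> v \<and> v - u < \<delta>"
        show "P u v" unfolding P_def
        proof
          assume u0: "0 \<le> u"
          have near: "dist (f y) (f x) < r" if "y \<in> {u..v}" for y
            using \<delta>(2)[of y] that uv u0 by (auto simp: dist_real_def)
          have low: "g (f x) - e / 2 \<le> g (f y)" if "y \<in> {u..v}" for y
            using r(2)[OF near[OF that]] unfolding dist_real_def abs_less_iff by linarith
          have "\<bar>G (f v) - G (f u)\<bar> \<le> (g (f x) + e / 2) * \<bar>f v - f u\<bar>"
          proof -
            have "\<bar>G s - G t\<bar> \<le> (g (f x) + e / 2) * \<bar>s - t\<bar>"
              if st: "dist s (f x) < r" "dist t (f x) < r" "t \<le> s" for s t
            proof (cases "t = s")
              case False
              then have "t < s" using st by simp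
              from MVT2[OF this G] obtain z where z: "t < z" "z < s" "G s - G t = (s - t) * g z" by blast
              have "dist z (f x) < r" using z st by (auto simp: dist_real_def)
              from r(2)[OF this] have "\<bar>g z\<bar> \<le> g (f x) + e / 2" 
                unfolding dist_real_def abs_less_iff abs_of_nonneg[OF g(2)] by linarith
              then have "\<bar>g z\<bar> * \<bar>s - t\<bar> \<le> (g (f x) + e / 2) * \<bar>s - t\<bar>" by (rule mult_right_mono) simp
              then show ?thesis using z by (simp add: abs_mult mult.commute)
            qed simp
            from this[of "f v" "f u"] this[of "f u" "f v"] near[of u] near[of v] uv
            show ?thesis by (cases "f u \<le> f v") (auto simp: abs_minus_commute)
          qed
          also have "\<dots> \<le> (g (f x) + e / 2) * (LINT s:{u..v}|lborel. \<bar>d s\<bar>)"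
          proof (rule mult_left_mono)
            have "f v - f u = (LINT s:{u..v}|lborel. d s)" using H1_pairD(5)[OF H u0] uv by simp
            then show "\<bar>f v - f u\<bar> \<le> (LINT s:{u..v}|lborel. \<bar>d s\<bar>)"
              unfolding set_lebesgue_integral_def
              using integral_abs_bound[of lborel "\<lambda>s. indicat_real {u..v} s *\<^sub>R d s"] by (simp add: abs_mult)
            show "0 \<le> g (f x) + e / 2" using g(2)[of "f x"] e by simp
          qed
          also have "\<dots> = (LINT s:{u..v}|lborel. (g (f x) + e / 2) * \<bar>d s\<bar>)" by simp
          also have "\<dots> \<le> (LINT s:{u..v}|lborel. (g (f s) + e) * \<bar>d s\<bar>)"
          proof (rule set_integral_mono)
            fix s assume "s \<in> {u..v}"
            from low[OF this] show "(g (f x) + e / 2) * \<bar>d s\<bar> \<le> (g (f s) + e) * \<bar>d s\<bar>"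
              by (intro mult_right_mono) auto
          qed (use di[OF u0] gi[OF u0] in auto)
          finally show "\<bar>G (f v) - G (f u)\<bar> \<le> (LINT s:{u..v}|lborel. (g (f s) + e) * \<bar>d s\<bar>)" .
        qed
      qed
    qed
    then have "\<bar>G (f b) - G (f a)\<bar> \<le> (LINT s:{a..b}|lborel. (g (f s) + e) * \<bar>d s\<bar>)"
      using ab by (simp add: P_def)
    also have "\<dots> = (LINT s:{a..b}|lborel. g (f s) * \<bar>d s\<bar> + e * \<bar>d s\<bar>)" by (simp add: algebra_simps)
    also have "\<dots> = (LINT s:{a..b}|lborel. g (f s) * \<bar>d s\<bar>) + e * K"
      unfolding K_def using gi[OF ab(1), of b 0] di[OF ab(1), of b] by (subst set_integral_add(2)) auto
    finally show ?thesis .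
  qed
  have K0: "0 \<le> K" unfolding K_def set_lebesgue_integral_def by (intro integral_nonneg_AE) auto
  show ?thesis
  proof (rule field_le_epsilon)
    fix e :: real assume e: "0 < e"
    \<comment> \<open>\<open>K + 1\<close> instead of \<open>K\<close>, because \<open>K\<close> may
      be 0.\<close>
    have "e / (K + 1) * K \<le> e" using K0 e by (simp add: field_simps)
    then show "\<bar>G (f b) - G (f a)\<bar> \<le> (LINT s:{a..b}|lborel. g (f s) * \<bar>d s\<bar>) + e"
      using main[of "e / (K + 1)"] K0 e by (smt (verit) divide_pos_pos)
  qed
qed

text \<open>\<open>H1_pair_chain\<close> needs a nonnegative derivative, which rules out t^2. The
  function t |t| has derivative 2 |t| and the same absolute value t^2.\<close>

lemma abs_mult_self_has_derivative:
  "((\<lambda>t::real. t * \<bar>t\<bar>) has_real_derivative 2 * \<bar>t\<bar>) (at t)"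
proof -
  have eq: "(\<lambda>t::real. t * \<bar>t\<bar>) = (\<lambda>t. 2 * ((max 0 t)\<^sup>2 / 2) - 2 * ((max 0 (- t))\<^sup>2 / 2))"
    by (rule ext) (auto simp: max_def power2_eq_square)
  have "((\<lambda>t::real. - t) has_real_derivative - 1) (at t)" by (auto intro!: derivative_eq_intros)
  from DERIV_chain2[OF has_real_derivative_half_max_sq this]
  have q: "((\<lambda>t. (max 0 (- t))\<^sup>2 / 2) has_real_derivative max 0 (- t) * - 1) (at t)" .
  show ?thesis unfolding eq
    by (rule DERIV_cong[OF DERIV_diff[OF DERIV_cmult[OF has_real_derivative_half_max_sq] DERIV_cmult[OF q]]])
       (auto simp: max_def)
qed

lemma set_integral_atLeast_tendsto_0:
  fixes h :: "real \<Rightarrow> real"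
  assumes "set_integrable lborel {a..} h"
  shows "((\<lambda>b. LINT s:{b..}|lborel. h s) \<longlongrightarrow> 0) at_top"
proof -
  have "((\<lambda>b. (LINT s:{a..}|lborel. h s) - (LINT s:{a..b}|lborel. h s)) \<longlongrightarrow>
      (LINT s:{a..}|lborel. h s) - (LINT s:{a..}|lborel. h s)) at_top"
    by (intro tendsto_diff tendsto_const tendsto_set_lebesgue_integral_at_top assms) auto
  then have "((\<lambda>b. (LINT s:{a..}|lborel. h s) - (LINT s:{a..b}|lborel. h s)) \<longlongrightarrow> 0) at_top" by simp
  then show ?thesis
  proof (rule Lim_transform_eventually)
    show "\<forall>\<^sub>F b in at_top. (LINT s:{a..}|lborel. h s) - (LINT s:{a..b}|lborel. h s) = (LINT s:{b..}|lborel. h s)"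
      using eventually_ge_at_top[of a] by eventually_elim (use set_integral_atLeast_split[OF assms] in simp)
  qed
qed

lemma set_integral_nonneg_mono_set:
  fixes h :: "real \<Rightarrow> real"
  assumes "set_integrable lborel B h" "A \<subseteq> B" "A \<in> sets borel" "\<And>s. s \<in> B \<Longrightarrow> 0 \<le> h s"
  shows "(LINT s:A|lborel. h s) \<le> (LINT s:B|lborel. h s)"
  unfolding set_lebesgue_integral_def
proof (rule integral_mono)
  show "integrable lborel (\<lambda>s. indicat_real A s *\<^sub>R h s)"
    using set_integrable_subset[OF assms(1) _ assms(2)] assms(3) by (simp add: set_integrable_def)
  show "integrable lborel (\<lambda>s. indicat_real B s *\<^sub>R h s)"
    using assms(1) by (simp add: set_integrable_def)
  show "indicat_real A s *\<^sub>R h s \<le> indicat_real B s *\<^sub>R h s" for s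
    using assms(2,4) by (auto simp: indicator_def)
qed

text \<open>By 2 |f| |d| <= f^2 + d^2, the drop of f^2 beyond x is at most the tail integral of f^2
  + d^2. If f^2 were at least e at a point far out, it would stay above e/2 from there on, against
  square integrability.\<close>

lemma H1_pair_tendsto_0:
  assumes H: "H1_pair f d"
  shows "(f \<longlongrightarrow> 0) at_top"
proof -
  define h where "h s = (f s)\<^sup>2 + (d s)\<^sup>2" for s
  have hi: "set_integrable lborel {0..} h"
    unfolding h_def using H1_pairD(3,4)[OF H] by (rule set_integral_add)
  have osc: "(f x)\<^sup>2 - (f y)\<^sup>2 \<le> (LINT s:{x..}|lborel. h s)" if "0 \<le> x" "x \<le> y" for x y
  proof -
    have hx: "set_integrable lborel {x..} h" by (rule set_integrable_subset[OF hi]) (use that in auto)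
    have "\<bar>f y * \<bar>f y\<bar> - f x * \<bar>f x\<bar>\<bar> \<le> (LINT s:{x..y}|lborel. 2 * \<bar>f s\<bar> * \<bar>d s\<bar>)"
      by (rule H1_pair_chain[OF H that, where g = "\<lambda>t. 2 * \<bar>t\<bar>", OF _ _ abs_mult_self_has_derivative])
         (auto intro!: continuous_intros)
    also have "\<dots> \<le> (LINT s:{x..y}|lborel. h s)"
    proof (rule set_integral_mono)
      have "continuous_on {x..y} f" by (rule continuous_on_subset[OF H1_pairD(1)[OF H]]) (use that in auto)
      then show "set_integrable lborel {x..y} (\<lambda>s. 2 * \<bar>f s\<bar> * \<bar>d s\<bar>)"
        using set_integrable_abs[OF H1_pair_Icc[OF H that(1)]]
        by (intro set_integrable_mult_continuous) (auto intro!: continuous_intros)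
      show "set_integrable lborel {x..y} h" by (rule set_integrable_subset[OF hx]) auto
      show "2 * \<bar>f s\<bar> * \<bar>d s\<bar> \<le> h s" for s
        using zero_le_power2[of "\<bar>f s\<bar> - \<bar>d s\<bar>"] by (simp add: h_def power2_diff)
    qed
    also have "\<dots> \<le> (LINT s:{x..}|lborel. h s)"
      by (rule set_integral_nonneg_mono_set[OF hx]) (auto simp: h_def)
    finally have "\<bar>f y * \<bar>f y\<bar> - f x * \<bar>f x\<bar>\<bar> \<le> (LINT s:{x..}|lborel. h s)" .
    moreover have "\<bar>t * \<bar>t\<bar>\<bar> = t\<^sup>2" for t :: real by (simp add: abs_mult power2_eq_square)
    ultimately show ?thesis by (smt (verit))
  qed
  have "((\<lambda>s. (f s)\<^sup>2) \<longlongrightarrow> 0) at_top"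
  proof (rule tendstoI)
    fix e :: real assume e: "0 < e"
    have "\<forall>\<^sub>F b in at_top. dist (LINT s:{b..}|lborel. h s) 0 < e / 2"
      using set_integral_atLeast_tendsto_0[OF hi] e by (intro tendstoD) auto
    with eventually_ge_at_top[of "0::real"] show "\<forall>\<^sub>F x in at_top. dist ((f x)\<^sup>2) 0 < e"
    proof eventually_elim
      case (elim x)
      show ?case
      proof (rule ccontr)
        assume "\<not> ?thesis"
        then have big: "e \<le> (f x)\<^sup>2" by simp
        have low: "e / 2 \<le> (f y)\<^sup>2" if "x \<le> y" for y
          using osc[OF elim(1) that] elim(2) big by (auto simp: dist_real_def)
        define I where "I = (LINT s:{0..}|lborel. (f s)\<^sup>2)"
        obtain n where n: "I < real n * (e / 2)"
          using reals_Archimedean3[of "e / 2"] e by (meson half_gt_zero)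
        have "real n * (e / 2) = (LINT s:{x..x + real n}|lborel. e / 2)"
          by (simp add: set_integral_const)
        also have "\<dots> \<le> (LINT s:{x..x + real n}|lborel. (f s)\<^sup>2)"
        proof (rule set_integral_mono)
          show "set_integrable lborel {x..x + real n} (\<lambda>s. (f s)\<^sup>2)"
            by (rule set_integrable_subset[OF H1_pairD(3)[OF H]]) (use elim in auto)
          show "e / 2 \<le> (f s)\<^sup>2" if "s \<in> {x..x + real n}" for s using that by (intro low) simp
        qed (auto intro!: borel_integrable_atLeastAtMost')
        also have "\<dots> \<le> I" unfolding I_def
          by (rule set_integral_nonneg_mono_set[OF H1_pairD(3)[OF H]]) (use elim in auto)
        finally show False using n by simp
      qed
    qed
  qed
  then have "((\<lambda>s. sqrt ((f s)\<^sup>2)) \<longlongrightarrow> sqrt 0) at_top" by (rule tendsto_real_sqrt)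
  then show ?thesis by (simp add: tendsto_rabs_zero_iff)
qed

lemma H1_pair_bounded:
  assumes H: "H1_pair f d"
  obtains B where "\<And>s. 0 \<le> s \<Longrightarrow> \<bar>f s\<bar> \<le> B"
proof -
  obtain R where R: "\<And>s. R \<le> s \<Longrightarrow> \<bar>f s\<bar> < 1"
    using tendstoD[OF H1_pair_tendsto_0[OF H], of 1] by (auto simp: eventually_at_top_linorder)
  have "continuous_on {0..R} f" by (rule continuous_on_subset[OF H1_pairD(1)[OF H]]) auto
  from compact_continuous_image[OF this] obtain B where B: "\<And>s. s \<in> {0..R} \<Longrightarrow> norm (f s) \<le> B"
    using compact_imp_bounded bounded_iff by (metis compact_Icc imageI)
  show thesis
  proof (rule that[of "max B 1"])
    fix s :: real assume "0 \<le> s"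
    then show "\<bar>f s\<bar> \<le> max B 1" using R[of s] B[of s] by (cases "s \<le> R") auto
  qed
qed

lemma H1_pair_powr_integrable:
  assumes H: "H1_pair f d" and p: "2 < p"
  shows "set_integrable lborel {0..} (\<lambda>s. \<bar>f s\<bar> powr p)"
proof -
  obtain B where B: "\<And>s. 0 \<le> s \<Longrightarrow> \<bar>f s\<bar> \<le> B" using H1_pair_bounded[OF H] by blast
  have "set_integrable lborel {0..} (\<lambda>s. B powr (p - 2) * (f s)\<^sup>2)"
    using H1_pairD(3)[OF H] by simp
  then show ?thesis
  proof (rule set_integrable_bound)
    show "set_borel_measurable lborel {0..} (\<lambda>s. \<bar>f s\<bar> powr p)"
      using H1_pairD(1)[OF H] p
      by (intro set_borel_measurable_continuous_half continuous_on_powr' continuous_intros) auto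
    have "\<bar>f s\<bar> powr p \<le> B powr (p - 2) * (f s)\<^sup>2" if "0 \<le> s" for s
    proof (cases "f s = 0")
      case False
      then have "\<bar>f s\<bar> powr p = \<bar>f s\<bar> powr (p - 2) * (f s)\<^sup>2"
        using powr_add[of "\<bar>f s\<bar>" "p - 2" 2] by simp
      then show ?thesis using B[OF that] p by (simp add: powr_mono2 mult_right_mono)
    qed simp
    then show "AE s in lborel. s \<in> {0..} \<longrightarrow> norm (\<bar>f s\<bar> powr p) \<le> norm (B powr (p - 2) * (f s)\<^sup>2)"
      by auto
  qed
qed

lemma H1_pair_cmult:
  assumes H: "H1_pair f d"
  shows "H1_pair (\<lambda>s. c * f s) (\<lambda>s. c * d s)"
  unfolding H1_pair_def
proof (intro conjI allI impI)
  show "continuous_on {0..} (\<lambda>s. c * f s)" using H1_pairD(1)[OF H] by (intro continuous_intros)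
  have "(\<lambda>x. c * (indicat_real {0..} x *\<^sub>R d x)) \<in> borel_measurable lborel"
    using H1_pairD(2)[OF H] by (intro borel_measurable_times) (auto simp: set_borel_measurable_def)
  then show "set_borel_measurable lborel {0..} (\<lambda>s. c * d s)"
    by (simp add: set_borel_measurable_def mult.left_commute)
  show "set_integrable lborel {0..} (\<lambda>s. (c * f s)\<^sup>2)" "set_integrable lborel {0..} (\<lambda>s. (c * d s)\<^sup>2)"
    using H1_pairD(3,4)[OF H] by (auto simp: power_mult_distrib)
  fix a b :: real assume "0 \<le> a" "a \<le> b"
  then show "c * f b - c * f a = (LINT s:{a..b}|lborel. c * d s)"
    using H1_pairD(5)[OF H] by (simp add: right_diff_distrib[symmetric])
qed

subsection \<open>The phase-plane profile and its primitive\<close>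

text \<open>The positive zero of t^2 - (2/p) t^p, that is, the largest value at which the
  zero-energy orbit is real.\<close>

definition peak :: "real \<Rightarrow> real" where
  "peak p = (p / 2) powr (1 / (p - 2))"

text \<open>The zero-energy orbit of \<open>v'' = v - \<bar>v\<bar>\<^bsup>p-2\<^esup> v\<close> is \<open>\<bar>v'\<bar> = slope p v\<close>.\<close>

definition slope :: "real \<Rightarrow> real \<Rightarrow> real" where
  "slope p t = sqrt (max 0 (t\<^sup>2 - 2 / p * \<bar>t\<bar> powr p))"

text \<open>Measures the flux between two levels. The clamp \<open>max 0\<close> in
  \<open>slope\<close> makes it differentiable and nondecreasing on the whole line, as
  \<open>H1_pair_chain\<close> requires.\<close>

definition level :: "real \<Rightarrow> real \<Rightarrow> real" where
  "level p = (SOME G. (\<forall>t. (G has_real_derivative slope p t) (at t)) \<and> G 0 = 0)"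

text \<open>The common value of the energy and of the \<open>L\<^sup>p\<close> integral of \<open>vbar p\<close> on the line.\<close>

definition mass :: "real \<Rightarrow> real" where
  "mass p = 4 * level p (peak p) / (1 - 2 / p)"

context
  fixes p :: real
  assumes p: "2 < p"
begin

lemma peak_pos: "0 < peak p"
  using p by (simp add: peak_def)

lemma peak_powr: "peak p powr (p - 2) = p / 2"
  using p by (simp add: peak_def powr_powr)

lemma powr_split: "\<bar>t\<bar> powr p = \<bar>t\<bar> powr (p - 2) * t\<^sup>2"
proof (cases "t = 0")
  case False
  then show ?thesis using powr_add[of "\<bar>t\<bar>" "p - 2" 2] by simp
qed (use p in simp)

text \<open>Up to the peak (2/p) |t|^(p-2) is at most 1, so the clamp in \<open>slope\<close> is
  inactive.\<close>

lemma slope_square: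
  assumes "\<bar>t\<bar> \<le> peak p"
  shows "(slope p t)\<^sup>2 = t\<^sup>2 - 2 / p * \<bar>t\<bar> powr p"
proof -
  have "\<bar>t\<bar> powr (p - 2) \<le> p / 2"
    using powr_mono2[of "p - 2" "\<bar>t\<bar>" "peak p"] assms p by (simp add: peak_powr)
  then have "2 / p * \<bar>t\<bar> powr (p - 2) \<le> 1" using p by (simp add: field_simps)
  then have "2 / p * \<bar>t\<bar> powr (p - 2) * t\<^sup>2 \<le> 1 * t\<^sup>2" by (rule mult_right_mono) simp
  then show ?thesis by (simp add: slope_def powr_split)
qed

lemma slope_nonneg: "0 \<le> slope p t"
  by (simp add: slope_def)

lemma slope_even: "slope p (- t) = slope p t"
  by (simp add: slope_def)

lemma slope_le: "slope p t \<le> \<bar>t\<bar>"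
proof -
  have "sqrt (max 0 (t\<^sup>2 - 2 / p * \<bar>t\<bar> powr p)) \<le> sqrt (t\<^sup>2)"
    using p by (intro real_sqrt_le_mono) auto
  then show ?thesis by (simp add: slope_def)
qed

lemma slope_pos:
  assumes "0 < t" "t < peak p"
  shows "0 < slope p t"
proof -
  have "t powr (p - 2) < p / 2"
    using powr_less_mono2[of "p - 2" t "peak p"] assms p by (simp add: peak_powr)
  then have "2 / p * t powr (p - 2) < 1" using p by (simp add: field_simps)
  then have "2 / p * t powr (p - 2) * t\<^sup>2 < 1 * t\<^sup>2" by (rule mult_strict_right_mono) (use assms in simp)
  then show ?thesis using assms powr_split[of t] by (simp add: slope_def)
qed

lemma continuous_on_slope: "continuous_on S (slope p)"
  unfolding slope_def[abs_def] using p
  by (intro continuous_intros continuous_on_powr') auto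

lemma level_spec: "(\<forall>t. (level p has_real_derivative slope p t) (at t)) \<and> level p 0 = 0"
proof -
  obtain F where F: "\<And>x. (F has_real_derivative slope p x) (at x)"
    using einterval_antiderivative[of "-\<infinity>" "\<infinity>" "slope p"] continuous_on_slope[of UNIV]
    by (auto simp: continuous_on_eq_continuous_at has_real_derivative_iff_has_vector_derivative)
  have "((\<lambda>x. F x - F 0) has_real_derivative slope p x) (at x)" for x
    using DERIV_diff[OF F[of x] DERIV_const[of "F 0"]] by simp
  then have "\<exists>G. (\<forall>t. (G has_real_derivative slope p t) (at t)) \<and> G 0 = 0"
    by (intro exI[of _ "\<lambda>x. F x - F 0"]) simp
  from someI_ex[OF this] show ?thesis unfolding level_def .
qed

lemma level_has_derivative: "(level p has_real_derivative slope p t) (at t)"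
  using level_spec by blast

lemma level_0: "level p 0 = 0"
  using level_spec by blast

lemma level_odd: "level p (- t) = - level p t"
proof -
  have "((\<lambda>t. level p t + level p (- t)) has_real_derivative 0) (at x)" for x
  proof -
    have "((\<lambda>t::real. - t) has_real_derivative - 1) (at x)" by (auto intro!: derivative_eq_intros)
    from DERIV_add[OF level_has_derivative DERIV_chain2[OF level_has_derivative this]]
    show ?thesis by (simp add: slope_even)
  qed
  from DERIV_isconst_all[of "\<lambda>t. level p t + level p (- t)" t 0] this
  show ?thesis by (simp add: level_0)
qed

lemma level_mono: "s \<le> t \<Longrightarrow> level p s \<le> level p t"
  using level_has_derivative slope_nonneg by (metis DERIV_nonneg_imp_nondecreasing)

lemma continuous_level: "isCont (level p) t"
  using level_has_derivative by (rule DERIV_isCont)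

lemma level_pos:
  assumes "0 < t"
  shows "0 < level p t"
proof -
  define m where "m = min t (peak p)"
  have "level p 0 < level p m"
  proof (rule DERIV_pos_imp_increasing_open[of 0 m "level p"])
    show "0 < m" using assms peak_pos by (simp add: m_def)
    show "\<exists>y. (level p has_real_derivative y) (at x) \<and> 0 < y" if "0 < x" "x < m" for x
      using level_has_derivative slope_pos[of x] that by (auto simp: m_def)
    show "continuous_on {0..m} (level p)"
      by (intro continuous_at_imp_continuous_on ballI continuous_level)
  qed
  also have "\<dots> \<le> level p t" by (rule level_mono) (simp add: m_def)
  finally show ?thesis by (simp add: level_0)
qed

lemma abs_level: "\<bar>level p t\<bar> = level p \<bar>t\<bar>"
proof (cases "0 \<le> t")
  case True
  then show ?thesis using level_mono[of 0 t] by (simp add: level_0)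
next
  case False
  then show ?thesis using level_mono[of t 0] by (simp add: level_0 level_odd)
qed

lemma level_eq_0_iff: "level p t = 0 \<longleftrightarrow> t = 0"
  using abs_level[of t] level_pos[of "\<bar>t\<bar>"] level_0 by fastforce

lemma mass_pos: "0 < mass p"
  using level_pos[OF peak_pos] p by (simp add: mass_def)

lemma mass_eq: "4 * level p (peak p) = (1 - 2 / p) * mass p"
  using p by (simp add: mass_def)

subsection \<open>The sharp inequality on a star\<close>

lemma slope_flux_integrable:
  assumes H: "H1_pair f d"
  shows "set_integrable lborel {0..} (\<lambda>s. slope p (f s) * \<bar>d s\<bar>)"
proof -
  have "set_integrable lborel {0..} (\<lambda>s. (f s)\<^sup>2 + (d s)\<^sup>2)"
    using H1_pairD(3,4)[OF H] by (rule set_integral_add)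
  then show ?thesis
  proof (rule set_integrable_bound)
    have "continuous_on {0..} (\<lambda>s. slope p (f s))"
      by (rule continuous_on_compose2[OF continuous_on_slope H1_pairD(1)[OF H]]) auto
    from set_borel_measurable_continuous_half[OF this]
    have "(\<lambda>s. (indicat_real {0..} s *\<^sub>R slope p (f s)) * \<bar>indicat_real {0..} s *\<^sub>R d s\<bar>) \<in> borel_measurable lborel"
      using H1_pairD(2)[OF H] unfolding set_borel_measurable_def
      by (intro borel_measurable_times borel_measurable_abs) auto
    also have "(\<lambda>s. (indicat_real {0..} s *\<^sub>R slope p (f s)) * \<bar>indicat_real {0..} s *\<^sub>R d s\<bar>) =
       (\<lambda>s. indicat_real {0..} s *\<^sub>R (slope p (f s) * \<bar>d s\<bar>))"
      by (auto simp: indicator_def)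
    finally show "set_borel_measurable lborel {0..} (\<lambda>s. slope p (f s) * \<bar>d s\<bar>)"
      by (simp add: set_borel_measurable_def)
    have "slope p (f s) * \<bar>d s\<bar> \<le> (f s)\<^sup>2 + (d s)\<^sup>2" for s
    proof -
      have "slope p (f s) * \<bar>d s\<bar> \<le> \<bar>f s\<bar> * \<bar>d s\<bar>" using slope_le by (rule mult_right_mono) simp
      also have "\<dots> \<le> (f s)\<^sup>2 + (d s)\<^sup>2"
      proof -
        have "2 * (\<bar>f s\<bar> * \<bar>d s\<bar>) \<le> (f s)\<^sup>2 + (d s)\<^sup>2"
          using zero_le_power2[of "\<bar>f s\<bar> - \<bar>d s\<bar>"] by (simp add: power2_diff)
        moreover have "0 \<le> \<bar>f s\<bar> * \<bar>d s\<bar>" by simp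
        ultimately show ?thesis by linarith
      qed
      finally show ?thesis .
    qed
    then show "AE s in lborel. s \<in> {0..} \<longrightarrow> norm (slope p (f s) * \<bar>d s\<bar>) \<le> norm ((f s)\<^sup>2 + (d s)\<^sup>2)"
      by (auto simp: slope_nonneg)
  qed
qed

text \<open>Expand the square and insert \<open>slope_square\<close>. Keeping the square as an exact
  remainder, rather than only its sign, is what later decides the case of equality.\<close>

lemma edge_defect:
  assumes H: "H1_pair f d" and b: "\<And>s. 0 \<le> s \<Longrightarrow> \<bar>f s\<bar> \<le> peak p"
  shows "set_integrable lborel {0..} (\<lambda>s. (\<bar>d s\<bar> - slope p (f s))\<^sup>2)"
    and "(LINT s:{0..}|lborel. (d s)\<^sup>2 + (f s)\<^sup>2) - 2 / p * (LINT s:{0..}|lborel. \<bar>f s\<bar> powr p) =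
      2 * (LINT s:{0..}|lborel. slope p (f s) * \<bar>d s\<bar>) + (LINT s:{0..}|lborel. (\<bar>d s\<bar> - slope p (f s))\<^sup>2)"
proof -
  let ?q = "\<lambda>s. slope p (f s) * \<bar>d s\<bar>"
  let ?e = "\<lambda>s. (d s)\<^sup>2 + (f s)\<^sup>2 - 2 / p * \<bar>f s\<bar> powr p"
  have ei: "set_integrable lborel {0..} (\<lambda>s. (d s)\<^sup>2 + (f s)\<^sup>2)"
    using H1_pairD(4,3)[OF H] by (rule set_integral_add)
  have li: "set_integrable lborel {0..} (\<lambda>s. 2 / p * \<bar>f s\<bar> powr p)"
    using H1_pair_powr_integrable[OF H p] by simp
  have qi: "set_integrable lborel {0..} (\<lambda>s. 2 * ?q s)"
    using slope_flux_integrable[OF H] by (intro set_integrable_mult_right) auto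
  have eq: "(\<bar>d s\<bar> - slope p (f s))\<^sup>2 = ?e s - 2 * ?q s" if "0 \<le> s" for s
    using slope_square[OF b[OF that]] by (simp add: power2_diff)
  have eli: "set_integrable lborel {0..} ?e" by (rule set_integral_diff(1)[OF ei li])
  have "set_integrable lborel {0..} (\<lambda>s. ?e s - 2 * ?q s)" by (rule set_integral_diff(1)[OF eli qi])
  also have "?this \<longleftrightarrow> set_integrable lborel {0..} (\<lambda>s. (\<bar>d s\<bar> - slope p (f s))\<^sup>2)"
    by (rule set_integrable_cong) (use eq in auto)
  finally show "set_integrable lborel {0..} (\<lambda>s. (\<bar>d s\<bar> - slope p (f s))\<^sup>2)" .
  have "(LINT s:{0..}|lborel. (\<bar>d s\<bar> - slope p (f s))\<^sup>2) = (LINT s:{0..}|lborel. ?e s - 2 * ?q s)"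
    by (rule set_lebesgue_integral_cong) (use eq in auto)
  also have "\<dots> = (LINT s:{0..}|lborel. (d s)\<^sup>2 + (f s)\<^sup>2) - (LINT s:{0..}|lborel. 2 / p * \<bar>f s\<bar> powr p) - (LINT s:{0..}|lborel. 2 * ?q s)"
    by (simp only: set_integral_diff(2)[OF eli qi] set_integral_diff(2)[OF ei li])
  finally show "(LINT s:{0..}|lborel. (d s)\<^sup>2 + (f s)\<^sup>2) - 2 / p * (LINT s:{0..}|lborel. \<bar>f s\<bar> powr p) =
      2 * (LINT s:{0..}|lborel. slope p (f s) * \<bar>d s\<bar>) + (LINT s:{0..}|lborel. (\<bar>d s\<bar> - slope p (f s))\<^sup>2)"
    by (simp only: set_integral_mult_right)
qed

text \<open>\<open>level p (f s)\<close> moves from its value at the vertex to its value at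
  \<open>x\<close> and then to 0 at infinity; the flux dominates both variations. With x = 0 this
  serves an ordinary edge, with a maximum point the edge that carries the maximum.\<close>

lemma edge_flux:
  assumes H: "H1_pair f d" and x: "0 \<le> x"
  shows "\<bar>level p (f x)\<bar> + \<bar>level p (f x) - level p (f 0)\<bar> \<le> (LINT s:{0..}|lborel. slope p (f s) * \<bar>d s\<bar>)"
proof -
  let ?q = "\<lambda>s. slope p (f s) * \<bar>d s\<bar>"
  have qi: "set_integrable lborel {0..} ?q" by (rule slope_flux_integrable[OF H])
  then have qx: "set_integrable lborel {x..} ?q" by (rule set_integrable_subset) (use x in auto)
  have ch: "\<bar>level p (f b) - level p (f a)\<bar> \<le> (LINT s:{a..b}|lborel. ?q s)" if "0 \<le> a" "a \<le> b" for a b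
    by (rule H1_pair_chain[OF H that continuous_on_slope slope_nonneg level_has_derivative])
  have "\<bar>0 - level p (f x)\<bar> \<le> (LINT s:{x..}|lborel. ?q s)"
  proof (rule tendsto_le[OF trivial_limit_at_top_linorder])
    show "((\<lambda>b. LINT s:{x..b}|lborel. ?q s) \<longlongrightarrow> (LINT s:{x..}|lborel. ?q s)) at_top"
      by (rule tendsto_set_lebesgue_integral_at_top[OF _ qx]) auto
    have "((\<lambda>b. level p (f b)) \<longlongrightarrow> level p 0) at_top"
      by (rule isCont_tendsto_compose[OF continuous_level H1_pair_tendsto_0[OF H]])
    then show "((\<lambda>b. \<bar>level p (f b) - level p (f x)\<bar>) \<longlongrightarrow> \<bar>0 - level p (f x)\<bar>) at_top"
      unfolding level_0 by (intro tendsto_intros)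
    show "\<forall>\<^sub>F b in at_top. \<bar>level p (f b) - level p (f x)\<bar> \<le> (LINT s:{x..b}|lborel. ?q s)"
      using eventually_ge_at_top[of x] by eventually_elim (rule ch[OF x])
  qed
  then show ?thesis using ch[of 0 x] x set_integral_atLeast_split[OF qi x] by simp
qed

text \<open>Write G for \<open>level p\<close> and M for \<open>peak p\<close>. Edge
  \<open>j\<close> has flux at least 2 G(M) - G(|c|), each of the other N - 1 edges at least G(|c|).
  Twice the sum is 4 G(M) + 2 (N - 2) G(|c|), and 4 G(M) equals (1 - 2/p) \<open>mass p\<close> by
  definition.\<close>

lemma star_defect:
  fixes f d :: "nat \<Rightarrow> real \<Rightarrow> real"
  assumes N: "2 \<le> N" and H: "\<And>i. i < N \<Longrightarrow> H1_pair (f i) (d i)" and c: "\<And>i. i < N \<Longrightarrow> f i 0 = c"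
    and b: "\<And>i s. i < N \<Longrightarrow> 0 \<le> s \<Longrightarrow> \<bar>f i s\<bar> \<le> peak p"
    and j: "j < N" "0 \<le> x" "\<bar>f j x\<bar> = peak p"
  shows "2 / p * (\<Sum>i<N. LINT s:{0..}|lborel. \<bar>f i s\<bar> powr p) + (1 - 2 / p) * mass p +
      2 * (real N - 2) * level p \<bar>c\<bar> + (\<Sum>i<N. LINT s:{0..}|lborel. (\<bar>d i s\<bar> - slope p (f i s))\<^sup>2)
    \<le> (\<Sum>i<N. LINT s:{0..}|lborel. (d i s)\<^sup>2 + (f i s)\<^sup>2)"
proof -
  define Q where "Q i = (LINT s:{0..}|lborel. slope p (f i s) * \<bar>d i s\<bar>)" for i
  have Qi: "level p \<bar>c\<bar> \<le> Q i" if "i < N" for i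
    using edge_flux[OF H[OF that], of 0] c[OF that] by (simp add: abs_level Q_def)
  \<comment> \<open>The signs of \<open>f j x\<close> and \<open>c\<close> do not matter:
    \<open>abs_level\<close> and the reverse triangle inequality bound the first variation below by
    the difference of the levels.\<close>
  have "level p (peak p) + (level p (peak p) - level p \<bar>c\<bar>) \<le> Q j"
    using edge_flux[OF H[OF j(1)] j(2)] c[OF j(1)] abs_level[of "f j x"] abs_level[of c] j(3)
    unfolding Q_def by simp
  moreover have "(\<Sum>i\<in>{..<N} - {j}. level p \<bar>c\<bar>) \<le> (\<Sum>i\<in>{..<N} - {j}. Q i)"
    by (rule sum_mono) (use Qi in auto)
  then have "(real N - 1) * level p \<bar>c\<bar> \<le> (\<Sum>i\<in>{..<N} - {j}. Q i)"
    using j(1) N by (simp add: of_nat_diff)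
  moreover have "(\<Sum>i<N. Q i) = Q j + (\<Sum>i\<in>{..<N} - {j}. Q i)"
    by (rule sum.remove) (use j in auto)
  ultimately have flux: "2 * level p (peak p) + (real N - 2) * level p \<bar>c\<bar> \<le> (\<Sum>i<N. Q i)"
    by (simp add: algebra_simps)
  have "(\<Sum>i<N. LINT s:{0..}|lborel. (d i s)\<^sup>2 + (f i s)\<^sup>2) - 2 / p * (\<Sum>i<N. LINT s:{0..}|lborel. \<bar>f i s\<bar> powr p) =
    (\<Sum>i<N. (LINT s:{0..}|lborel. (d i s)\<^sup>2 + (f i s)\<^sup>2) - 2 / p * (LINT s:{0..}|lborel. \<bar>f i s\<bar> powr p))"
    by (simp only: sum_subtractf sum_distrib_left)
  also have "\<dots> = (\<Sum>i<N. 2 * Q i + (LINT s:{0..}|lborel. (\<bar>d i s\<bar> - slope p (f i s))\<^sup>2))"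
    unfolding Q_def by (intro sum.cong refl edge_defect(2) H b) auto
  also have "\<dots> = 2 * (\<Sum>i<N. Q i) + (\<Sum>i<N. LINT s:{0..}|lborel. (\<bar>d i s\<bar> - slope p (f i s))\<^sup>2)"
    by (simp only: sum.distrib sum_distrib_left)
  finally have 1: "(\<Sum>i<N. LINT s:{0..}|lborel. (d i s)\<^sup>2 + (f i s)\<^sup>2) - 2 / p * (\<Sum>i<N. LINT s:{0..}|lborel. \<bar>f i s\<bar> powr p) =
      2 * (\<Sum>i<N. Q i) + (\<Sum>i<N. LINT s:{0..}|lborel. (\<bar>d i s\<bar> - slope p (f i s))\<^sup>2)" .
  have 2: "(1 - 2 / p) * mass p + 2 * (real N - 2) * level p \<bar>c\<bar> \<le> 2 * (\<Sum>i<N. Q i)"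
    using flux unfolding mass_eq[symmetric] mult.assoc by linarith
  show ?thesis using 1 2 by linarith
qed

text \<open>Gronwall's inequality for \<open>\<integral>\<^sub>0\<^sup>x \<bar>f\<bar>\<close>.\<close>

lemma orbit_through_0:
  assumes H: "H1_pair f d" and f0: "f 0 = 0"
    and d: "AE s in lborel. s \<in> {0..} \<longrightarrow> \<bar>d s\<bar> = slope p (f s)" and x: "0 \<le> x"
  shows "f x = 0"
proof -
  define B where "B = x + 1"
  define u where "u y = integral {0..y} (\<lambda>s. \<bar>f s\<bar>)" for y
  have cf: "continuous_on {0..y} (\<lambda>s. \<bar>f s\<bar>)" for y
    by (intro continuous_intros continuous_on_subset[OF H1_pairD(1)[OF H]]) auto
  have fi: "set_integrable lborel {0..y} (\<lambda>s. \<bar>f s\<bar>)" for y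
    by (rule borel_integrable_atLeastAtMost'[OF cf])
  have fu: "\<bar>f y\<bar> \<le> u y" if y: "0 \<le> y" for y
  proof -
    have di: "set_integrable lborel {0..y} d" by (rule H1_pair_Icc[OF H]) simp
    have "f y = (LINT s:{0..y}|lborel. d s)" using H1_pairD(5)[OF H, of 0 y] y f0 by simp
    then have "\<bar>f y\<bar> \<le> (LINT s:{0..y}|lborel. \<bar>d s\<bar>)"
      unfolding set_lebesgue_integral_def
      using integral_abs_bound[of lborel "\<lambda>s. indicat_real {0..y} s *\<^sub>R d s"] by (simp add: abs_mult)
    \<comment> \<open>\<open>slope_le\<close> makes the equation linear at 0. Starting at 0 is
      essential: at the peak \<open>slope\<close> is not Lipschitz and orbits are not unique, a
      constant and \<open>vbar\<close> both passing through it.\<close>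
    also have "\<dots> \<le> (LINT s:{0..y}|lborel. \<bar>f s\<bar>)"
    proof (rule set_integral_mono_AE[OF set_integrable_abs[OF di] fi])
      show "AE s\<in>{0..y} in lborel. \<bar>d s\<bar> \<le> \<bar>f s\<bar>"
        using d by eventually_elim (use slope_le in auto)
    qed
    also have "\<dots> = u y" unfolding u_def by (rule set_borel_integral_eq_integral(2)[OF fi])
    finally show ?thesis .
  qed
  have du: "(u has_real_derivative \<bar>f y\<bar>) (at y within {0..B})" if "0 \<le> y" "y \<le> B" for y
    unfolding u_def[abs_def] by (rule integral_has_real_derivative[OF cf]) (use that in auto)
  have "u x * exp (- x) \<le> u 0 * exp (- 0)"
  proof (cases "x = 0")
    case False
    show ?thesis
    proof (rule DERIV_nonpos_imp_decreasing_open[of 0 x "\<lambda>y. u y * exp (- y)"])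
      fix y assume y: "0 < y" "y < x"
      have "(u has_real_derivative \<bar>f y\<bar>) (at y)"
        using du[of y] y at_within_Icc_at[of 0 y B] by (simp add: B_def)
      moreover have "((\<lambda>y. exp (- y)) has_real_derivative - exp (- y)) (at y)"
        by (auto intro!: derivative_eq_intros)
      ultimately have "((\<lambda>y. u y * exp (- y)) has_real_derivative \<bar>f y\<bar> * exp (- y) + - exp (- y) * u y) (at y)"
        by (rule DERIV_mult)
      moreover have "\<bar>f y\<bar> * exp (- y) + - exp (- y) * u y = (\<bar>f y\<bar> - u y) * exp (- y)"
        by (simp add: algebra_simps)
      then have "\<bar>f y\<bar> * exp (- y) + - exp (- y) * u y \<le> 0"
        using fu[of y] y by (simp add: mult_nonpos_nonneg)
      ultimately show "\<exists>z. ((\<lambda>y. u y * exp (- y)) has_real_derivative z) (at y) \<and> z \<le> 0" by blast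
    next
      have "continuous_on {0..B} u"
        unfolding continuous_on_eq_continuous_within using DERIV_continuous[OF du] by simp
      then have "continuous_on {0..x} u" by (rule continuous_on_subset) (simp add: B_def)
      then show "continuous_on {0..x} (\<lambda>y. u y * exp (- y))" by (intro continuous_intros)
    qed (use x in simp)
  qed simp
  then have "u x \<le> 0" by (simp add: u_def mult_le_0_iff)
  then show ?thesis using fu[OF x] by simp
qed

section \<open>Scaling to the sharp constant, and strictness for three or more edges\<close>

lemma powr_integral_pos:
  assumes H: "H1_pair f d" and x: "0 \<le> x" "f x \<noteq> 0"
  shows "0 < (LINT s:{0..}|lborel. \<bar>f s\<bar> powr p)"
proof -
  define e where "e = \<bar>f x\<bar> / 2"
  have e: "0 < e" using x by (simp add: e_def)
  obtain \<delta> where \<delta>: "\<delta> > 0" "\<And>y. y \<ge> 0 \<Longrightarrow> dist y x < \<delta> \<Longrightarrow> dist (f y) (f x) < e"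
    using H1_pairD(1)[OF H] x(1) e unfolding continuous_on_iff by (metis atLeast_iff)
  have "0 < \<delta> / 2 * e powr p" using \<delta> e by simp
  also have "\<dots> = (LINT s:{x..x + \<delta> / 2}|lborel. e powr p)"
    using \<delta> by (simp add: set_integral_const)
  also have "\<dots> \<le> (LINT s:{x..x + \<delta> / 2}|lborel. \<bar>f s\<bar> powr p)"
  proof (rule set_integral_mono)
    show "set_integrable lborel {x..x + \<delta> / 2} (\<lambda>s. \<bar>f s\<bar> powr p)"
      by (rule set_integrable_subset[OF H1_pair_powr_integrable[OF H p]]) (use x in auto)
    fix s assume s: "s \<in> {x..x + \<delta> / 2}"
    then have "\<bar>f s - f x\<bar> < e" using \<delta>(1) \<delta>(2)[of s] x by (auto simp: dist_real_def)
    then have "e \<le> \<bar>f s\<bar>" unfolding e_def by linarith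
    then show "e powr p \<le> \<bar>f s\<bar> powr p" using e p by (intro powr_mono2) auto
  qed (auto intro!: borel_integrable_atLeastAtMost')
  also have "\<dots> \<le> (LINT s:{0..}|lborel. \<bar>f s\<bar> powr p)"
    by (rule set_integral_nonneg_mono_set[OF H1_pair_powr_integrable[OF H p]]) (use x in auto)
  finally show ?thesis .
qed

text \<open>Beyond some \<open>R\<close> all edges stay below the nonzero value |f k y|, so only
  finitely many compact segments compete for the maximum.\<close>

lemma star_max_attained:
  fixes f d :: "nat \<Rightarrow> real \<Rightarrow> real"
  assumes H: "\<And>i. i < N \<Longrightarrow> H1_pair (f i) (d i)" and nz: "k < N" "0 \<le> y" "f k y \<noteq> 0"
  obtains j x where "j < N" "0 \<le> x" "f j x \<noteq> 0" "\<And>i s. i < N \<Longrightarrow> 0 \<le> s \<Longrightarrow> \<bar>f i s\<bar> \<le> \<bar>f j x\<bar>"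
proof -
  have "\<forall>\<^sub>F s in at_top. \<forall>i\<in>{..<N}. \<bar>f i s\<bar> < \<bar>f k y\<bar>"
  proof (intro eventually_ball_finite ballI)
    fix i assume "i \<in> {..<N}"
    then show "\<forall>\<^sub>F s in at_top. \<bar>f i s\<bar> < \<bar>f k y\<bar>"
      using tendstoD[OF H1_pair_tendsto_0[OF H], of i "\<bar>f k y\<bar>"] nz by simp
  qed simp
  then obtain R where R: "\<And>s i. R \<le> s \<Longrightarrow> i < N \<Longrightarrow> \<bar>f i s\<bar> < \<bar>f k y\<bar>"
    by (auto simp: eventually_at_top_linorder)
  have yR: "y < R" using R[of y k] nz by force
  have "\<exists>x\<in>{0..R}. \<forall>s\<in>{0..R}. \<bar>f i s\<bar> \<le> \<bar>f i x\<bar>" if "i < N" for i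
  proof (rule continuous_attains_sup)
    show "continuous_on {0..R} (\<lambda>s. \<bar>f i s\<bar>)"
      by (intro continuous_intros continuous_on_subset[OF H1_pairD(1)[OF H[OF that]]]) auto
  qed (use yR nz in auto)
  then obtain X where X: "\<And>i. i < N \<Longrightarrow> X i \<in> {0..R}" "\<And>i s. i < N \<Longrightarrow> s \<in> {0..R} \<Longrightarrow> \<bar>f i s\<bar> \<le> \<bar>f i (X i)\<bar>"
    by metis
  define A where "A = (\<lambda>i. \<bar>f i (X i)\<bar>) ` {..<N}"
  have "Max A \<in> A" unfolding A_def using nz by (intro Max_in) auto
  then obtain j where j: "j < N" "Max A = \<bar>f j (X j)\<bar>" by (auto simp: A_def)
  have maxi: "\<bar>f i (X i)\<bar> \<le> \<bar>f j (X j)\<bar>" if "i < N" for i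
    using that j(2) Max_ge[of A "\<bar>f i (X i)\<bar>"] by (auto simp: A_def)
  have fk: "\<bar>f k y\<bar> \<le> \<bar>f j (X j)\<bar>"
    using X(2)[of k y] maxi[of k] nz yR by force
  show thesis
  proof (rule that)
    show "j < N" "0 \<le> X j" using j X by auto
    show "f j (X j) \<noteq> 0" using fk nz by auto
    fix i :: nat and s :: real assume is': "i < N" "0 \<le> s"
    show "\<bar>f i s\<bar> \<le> \<bar>f j (X j)\<bar>"
    proof (cases "s \<le> R")
      case True
      then show ?thesis using X(2)[of i s] maxi[of i] is' by force
    next
      case False
      then show ?thesis using R[of s i] is' fk by force
    qed
  qed
qed

text \<open>\<open>star_defect\<close> is applied to the multiple of \<open>f\<close> whose maximum
  is the peak. Young's inequality turns the inhomogeneous bound into one where every main term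
  carries the factor a^2, so the multiple disappears. The remainders \<open>r\<close> and
  \<open>D\<close> survive and control equality.\<close>

theorem star_sobolev:
  fixes f d :: "nat \<Rightarrow> real \<Rightarrow> real"
  assumes N: "2 \<le> N" and H: "\<And>i. i < N \<Longrightarrow> H1_pair (f i) (d i)" and c: "\<And>i. i < N \<Longrightarrow> f i 0 = c"
    and nz: "k < N" "0 \<le> y" "f k y \<noteq> 0"
  defines "L \<equiv> (\<Sum>i<N. LINT s:{0..}|lborel. \<bar>f i s\<bar> powr p)"
  defines "E \<equiv> (\<Sum>i<N. LINT s:{0..}|lborel. (d i s)\<^sup>2 + (f i s)\<^sup>2)"
  shows "0 < L" "mass p powr (1 - 2 / p) * L powr (2 / p) \<le> E"
    "3 \<le> N \<Longrightarrow> mass p powr (1 - 2 / p) * L powr (2 / p) < E"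
proof -
  have L0: "0 \<le> (LINT s:{0..}|lborel. \<bar>f i s\<bar> powr p)" for i
    unfolding set_lebesgue_integral_def by (intro integral_nonneg_AE) auto
  have "0 < (LINT s:{0..}|lborel. \<bar>f k s\<bar> powr p)"
    by (rule powr_integral_pos[OF H]) (use nz in auto)
  then show L: "0 < L" unfolding L_def using nz L0 by (intro sum_pos2[of _ k]) auto
  obtain j x where j: "j < N" "0 \<le> x" "f j x \<noteq> 0" "\<And>i s. i < N \<Longrightarrow> 0 \<le> s \<Longrightarrow> \<bar>f i s\<bar> \<le> \<bar>f j x\<bar>"
    using star_max_attained[of N f d, OF H nz] by blast
  define a where "a = peak p / \<bar>f j x\<bar>"
  have a: "0 < a" using j peak_pos by (simp add: a_def)
  define D where "D i = (LINT s:{0..}|lborel. (\<bar>a * d i s\<bar> - slope p (a * f i s))\<^sup>2)" for i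
  define r where "r = 2 * (real N - 2) * level p \<bar>a * c\<bar>"
  have Ha: "H1_pair (\<lambda>s. a * f i s) (\<lambda>s. a * d i s)" if "i < N" for i
    by (rule H1_pair_cmult[OF H[OF that]])
  have ba: "\<bar>a * f i s\<bar> \<le> peak p" if "i < N" "0 \<le> s" for i s
    using j(4)[OF that] j(3) peak_pos by (simp add: a_def abs_mult field_simps)
  have "2 / p * (\<Sum>i<N. LINT s:{0..}|lborel. \<bar>a * f i s\<bar> powr p) + (1 - 2 / p) * mass p + r + (\<Sum>i<N. D i)
    \<le> (\<Sum>i<N. LINT s:{0..}|lborel. (a * d i s)\<^sup>2 + (a * f i s)\<^sup>2)"
    unfolding D_def r_def
  proof (rule star_defect[where j = j and x = x and c = "a * c"])
    show "\<bar>a * f j x\<bar> = peak p" using j peak_pos by (simp add: a_def abs_mult)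
  qed (use N Ha ba c j in auto)
  also have "(\<Sum>i<N. LINT s:{0..}|lborel. \<bar>a * f i s\<bar> powr p) = a powr p * L"
    unfolding L_def sum_distrib_left using a by (simp add: abs_mult powr_mult)
  also have "(\<Sum>i<N. LINT s:{0..}|lborel. (a * d i s)\<^sup>2 + (a * f i s)\<^sup>2) = a\<^sup>2 * E"
    unfolding E_def sum_distrib_left by (simp add: power_mult_distrib distrib_left[symmetric])
  finally have main: "2 / p * (a powr p * L) + (1 - 2 / p) * mass p + r + (\<Sum>i<N. D i) \<le> a\<^sup>2 * E" .
  have r0: "0 \<le> r" using N abs_level[of "\<bar>a * c\<bar>"] by (simp add: r_def)
  have D0: "0 \<le> D i" for i unfolding D_def set_lebesgue_integral_def by (intro integral_nonneg_AE) auto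
  then have DS0: "0 \<le> (\<Sum>i<N. D i)" by (intro sum_nonneg) auto
  \<comment> \<open>Weighted means of a^p L and \<open>mass p\<close>; the exponent 2/p reduces a^p
    to the a^2 carried by the energy.\<close>
  have "(a powr p * L) powr (2 / p) * mass p powr (1 - 2 / p) \<le> 2 / p * (a powr p * L) + (1 - 2 / p) * mass p"
    using Youngs_inequality_0[of "2 / p" "1 - 2 / p" "a powr p * L" "mass p"] p L a mass_pos by simp
  moreover have "(a powr p * L) powr (2 / p) = a\<^sup>2 * L powr (2 / p)"
    using a L p by (simp add: powr_mult powr_powr)
  ultimately have young: "a\<^sup>2 * (mass p powr (1 - 2 / p) * L powr (2 / p)) + r + (\<Sum>i<N. D i) \<le> a\<^sup>2 * E"
    using main by (simp add: mult_ac)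
  then have "a\<^sup>2 * (mass p powr (1 - 2 / p) * L powr (2 / p)) \<le> a\<^sup>2 * E" using r0 DS0 by linarith
  then show le: "mass p powr (1 - 2 / p) * L powr (2 / p) \<le> E" using a by simp
  assume N3: "3 \<le> N"
  show "mass p powr (1 - 2 / p) * L powr (2 / p) < E"
  proof (rule ccontr)
    assume "\<not> ?thesis"
    with le have "E = mass p powr (1 - 2 / p) * L powr (2 / p)" by simp
    with young have "r + (\<Sum>i<N. D i) \<le> 0" by simp
    with r0 DS0 have "r = 0" "(\<Sum>i<N. D i) = 0" by auto
    \<comment> \<open>The factor N - 2 is positive here, so the vertex value must vanish. Edge
      \<open>j\<close> then runs along the zero-energy orbit from 0 and cannot reach its nonzero
      maximum.\<close>
    then have "level p \<bar>a * c\<bar> = 0" "D j = 0"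
      using N3 D0 j(1) by (auto simp: r_def sum_nonneg_eq_0_iff)
    then have c0: "c = 0" using a level_eq_0_iff by simp
    have "AE s in lborel. indicat_real {0..} s *\<^sub>R (\<bar>a * d j s\<bar> - slope p (a * f j s))\<^sup>2 = 0"
    proof (rule integral_nonneg_eq_0_iff_AE[THEN iffD1])
      show "integrable lborel (\<lambda>s. indicat_real {0..} s *\<^sub>R (\<bar>a * d j s\<bar> - slope p (a * f j s))\<^sup>2)"
        using edge_defect(1)[OF Ha[OF j(1)]] ba[OF j(1)] unfolding set_integrable_def by simp
      show "(LINT s|lborel. indicat_real {0..} s *\<^sub>R (\<bar>a * d j s\<bar> - slope p (a * f j s))\<^sup>2) = 0"
        using \<open>D j = 0\<close> by (simp add: D_def set_lebesgue_integral_def)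
    qed auto
    then have "AE s in lborel. s \<in> {0..} \<longrightarrow> \<bar>a * d j s\<bar> = slope p (a * f j s)"
      by eventually_elim (auto simp: indicator_def)
    from orbit_through_0[OF Ha[OF j(1)] _ this j(2)] c[OF j(1)] c0 a j(3) show False by simp
  qed
qed

end

subsection \<open>The soliton \<open>vbar\<close>\<close>

text \<open>In the form with tanh, the sign, the oddness and the zero-energy relation can be read
  off.\<close>

definition vbar' :: "real \<Rightarrow> real \<Rightarrow> real" where
  "vbar' p s = - tanh ((p - 2) / 2 * s) * vbar p s"

text \<open>The derivative is written as p |t|^(p-2) t to match the nonlinearity of the equation.
  Away from 0 use |t|^p = (t^2)^(p/2); at 0 the difference quotient is bounded by |h|^(p-1).\<close>

lemma has_real_derivative_abs_powr:
  fixes p t :: real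
  assumes p: "2 < p"
  shows "((\<lambda>t. \<bar>t\<bar> powr p) has_real_derivative p * \<bar>t\<bar> powr (p - 2) * t) (at t)"
proof (cases "t = 0")
  case False
  have eq: "\<bar>t\<bar> powr q = (t\<^sup>2) powr (q / 2)" for t q :: real
  proof -
    have "(t\<^sup>2) powr (q / 2) = (\<bar>t\<bar> powr 2) powr (q / 2)" by (cases "t = 0") auto
    also have "\<dots> = \<bar>t\<bar> powr q" by (simp only: powr_powr) simp
    finally show ?thesis by simp
  qed
  have "((\<lambda>t. t\<^sup>2) has_real_derivative 2 * t) (at t)" by (auto intro!: derivative_eq_intros)
  from DERIV_fun_powr[OF this, of "p / 2"] False
  have "((\<lambda>t. (t\<^sup>2) powr (p / 2)) has_real_derivative p / 2 * (t\<^sup>2) powr (p / 2 - 1) * (2 * t)) (at t)"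
    by simp
  moreover have "p / 2 - 1 = (p - 2) / 2" by simp
  ultimately show ?thesis unfolding eq by (simp add: mult_ac)
next
  case True
  have "((\<lambda>h. \<bar>h\<bar> powr p / h) \<longlongrightarrow> 0) (at (0::real))"
  proof (rule Lim_null_comparison)
    show "\<forall>\<^sub>F h in at (0::real). norm (\<bar>h\<bar> powr p / h) \<le> \<bar>h\<bar> powr (p - 1)"
    proof (rule always_eventually, rule allI)
      fix h :: real
      show "norm (\<bar>h\<bar> powr p / h) \<le> \<bar>h\<bar> powr (p - 1)"
        by (cases "h = 0") (auto simp: powr_diff)
    qed
    have "((\<lambda>h::real. \<bar>h\<bar> powr (p - 1)) \<longlongrightarrow> \<bar>0\<bar> powr (p - 1)) (at 0)"
      using p by (intro tendsto_powr' tendsto_intros) auto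
    then show "((\<lambda>h::real. \<bar>h\<bar> powr (p - 1)) \<longlongrightarrow> 0) (at 0)" by simp
  qed
  then show ?thesis using True p by (simp add: DERIV_def)
qed

context
  fixes p :: real
  assumes p: "2 < p"
begin

lemma vbar_eq: "vbar p s = peak p * cosh ((p - 2) / 2 * s) powr (- 2 / (p - 2))"
  by (simp add: vbar_def peak_def)

lemma vbar_pos: "0 < vbar p s"
  using peak_pos[OF p] by (simp add: vbar_eq)

lemma vbar_0: "vbar p 0 = peak p"
  by (simp add: vbar_eq)

lemma vbar_even: "vbar p (- s) = vbar p s"
  by (simp add: vbar_eq)

lemma vbar'_odd: "vbar' p (- s) = - vbar' p s"
  by (simp add: vbar'_def vbar_even)

lemma vbar'_neg: "0 < s \<Longrightarrow> vbar' p s < 0"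
  using p vbar_pos[of s] by (simp add: vbar'_def)

lemma vbar_has_derivative: "(vbar p has_real_derivative vbar' p s) (at s)"
proof -
  let ?k = "(p - 2) / 2"
  have "((\<lambda>s. cosh (?k * s)) has_real_derivative sinh (?k * s) * ?k) (at s)"
    using p by (auto intro!: derivative_eq_intros)
  from DERIV_cmult[OF DERIV_fun_powr[OF this, of "- 2 / (p - 2)"], of "peak p"]
  have "(vbar p has_real_derivative
      peak p * (- 2 / (p - 2) * cosh (?k * s) powr (- 2 / (p - 2) - of_nat 1) * (sinh (?k * s) * ?k))) (at s)"
    unfolding vbar_eq[abs_def] by simp
  moreover have "- 2 / (p - 2) * cosh (?k * s) powr (- 2 / (p - 2) - of_nat 1) * (sinh (?k * s) * ?k) =
     - tanh (?k * s) * cosh (?k * s) powr (- 2 / (p - 2))"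
  proof -
    have q: "- 2 / (p - 2) * ?k = - 1" using p by (simp add: field_simps)
    have c: "c powr (r - of_nat 1) = c powr r / c" if "0 < c" for c r :: real
      using that by (simp add: powr_diff)
    have "- 2 / (p - 2) * cosh (?k * s) powr (- 2 / (p - 2) - of_nat 1) * (sinh (?k * s) * ?k) =
       (- 2 / (p - 2) * ?k) * sinh (?k * s) * cosh (?k * s) powr (- 2 / (p - 2) - of_nat 1)"
      by (simp only: mult_ac)
    then show ?thesis unfolding q c[OF cosh_real_pos] by (simp add: tanh_def)
  qed
  ultimately show ?thesis by (simp add: vbar'_def vbar_eq mult_ac)
qed

text \<open>\<open>peak_powr\<close> and 1/cosh^2 = 1 - tanh^2. The nonlinearity becomes a
  polynomial in tanh, which makes the equation and the zero-energy relation purely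
  algebraic.\<close>

lemma vbar_powr: "vbar p s powr (p - 2) = p / 2 * (1 - (tanh ((p - 2) / 2 * s))\<^sup>2)"
proof -
  let ?c = "cosh ((p - 2) / 2 * s)"
  have "vbar p s powr (p - 2) = p / 2 * (?c powr (- 2 / (p - 2))) powr (p - 2)"
    using peak_pos[OF p] by (simp add: vbar_eq powr_mult peak_powr[OF p])
  also have "(?c powr (- 2 / (p - 2))) powr (p - 2) = ?c powr (- 2)"
  proof -
    have "- 2 / (p - 2) * (p - 2) = - 2" using p by (simp add: divide_simps)
    then show ?thesis by (simp only: powr_powr)
  qed
  also have "\<dots> = 1 / ?c\<^sup>2" by (simp add: powr_minus_divide)
  also have "\<dots> = 1 - (tanh ((p - 2) / 2 * s))\<^sup>2"
  proof -
    have "(sinh ((p - 2) / 2 * s))\<^sup>2 = ?c\<^sup>2 - 1" by (simp add: cosh_square_eq)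
    then show ?thesis by (simp only: tanh_def power_divide) (simp add: diff_divide_distrib)
  qed
  finally show ?thesis .
qed

lemma vbar'_has_derivative:
  "(vbar' p has_real_derivative vbar p s - vbar p s powr (p - 2) * vbar p s) (at s)"
proof -
  let ?k = "(p - 2) / 2"
  let ?t = "tanh (?k * s)"
  have "((\<lambda>s. - tanh (?k * s)) has_real_derivative - ((1 - ?t\<^sup>2) * ?k)) (at s)"
    using p by (auto intro!: derivative_eq_intros)
  from DERIV_mult[OF this vbar_has_derivative]
  have "(vbar' p has_real_derivative - ((1 - ?t\<^sup>2) * ?k) * vbar p s + vbar' p s * - ?t) (at s)"
    unfolding vbar'_def[abs_def] .
  moreover have "- ((1 - ?t\<^sup>2) * ?k) * vbar p s + vbar' p s * - ?t = vbar p s - vbar p s powr (p - 2) * vbar p s"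
    by (simp add: vbar_powr vbar'_def power2_eq_square) (simp add: field_simps)
  ultimately show ?thesis by simp
qed

lemma vbar_le_peak: "vbar p s \<le> peak p"
proof -
  have "vbar p s powr (p - 2) \<le> peak p powr (p - 2)"
    using p by (simp add: vbar_powr peak_powr[OF p])
  then show ?thesis
    using powr_less_mono2[of "p - 2" "peak p" "vbar p s"] p peak_pos[OF p] by force
qed

lemma vbar'_square: "(vbar' p s)\<^sup>2 = (vbar p s)\<^sup>2 - 2 / p * vbar p s powr p"
proof -
  have "vbar p s powr p = vbar p s powr (p - 2) * (vbar p s)\<^sup>2"
    using powr_split[OF p, of "vbar p s"] vbar_pos[of s] by simp
  then have "vbar p s powr p = p / 2 * ((1 - (tanh ((p - 2) / 2 * s))\<^sup>2) * (vbar p s)\<^sup>2)"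
    by (simp only: vbar_powr mult.assoc)
  then have "2 / p * vbar p s powr p = (1 - (tanh ((p - 2) / 2 * s))\<^sup>2) * (vbar p s)\<^sup>2"
    using p by (simp only:) simp
  moreover have "(vbar' p s)\<^sup>2 = (tanh ((p - 2) / 2 * s))\<^sup>2 * (vbar p s)\<^sup>2"
    by (simp add: vbar'_def power_mult_distrib)
  ultimately show ?thesis by (simp add: algebra_simps)
qed

text \<open>Along \<open>vbar\<close> the defect in Young's inequality is therefore zero.\<close>

lemma slope_vbar: "slope p (vbar p s) = \<bar>vbar' p s\<bar>"
proof -
  have "(slope p (vbar p s))\<^sup>2 = (vbar' p s)\<^sup>2"
    using slope_square[OF p, of "vbar p s"] vbar_le_peak[of s] vbar_pos[of s] by (simp add: vbar'_square)
  then show ?thesis using slope_nonneg[OF p, of "vbar p s"]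
    by (metis abs_of_nonneg power2_eq_iff_nonneg abs_ge_zero power2_abs)
qed

lemma vbar_strict_antimono: "0 \<le> s \<Longrightarrow> s < t \<Longrightarrow> vbar p t < vbar p s"
proof (rule DERIV_neg_imp_decreasing_open[of s t "vbar p"])
  fix x assume "0 \<le> s" "s < x"
  then show "\<exists>y. (vbar p has_real_derivative y) (at x) \<and> y < 0"
    using vbar_has_derivative vbar'_neg[of x] by (intro exI[of _ "vbar' p x"]) auto
next
  show "continuous_on {s..t} (vbar p)"
    using vbar_has_derivative by (intro continuous_at_imp_continuous_on ballI) (rule DERIV_isCont)
qed auto

lemma vbar_eq_iff: "vbar p s = vbar p t \<longleftrightarrow> \<bar>s\<bar> = \<bar>t\<bar>"
proof -
  have "vbar p s = vbar p \<bar>s\<bar>" for s by (cases "0 \<le> s") (simp_all add: vbar_even)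
  then show ?thesis
    using vbar_strict_antimono[of "\<bar>s\<bar>" "\<bar>t\<bar>"] vbar_strict_antimono[of "\<bar>t\<bar>" "\<bar>s\<bar>"]
    by (metis abs_ge_zero less_irrefl linorder_neqE_linordered_idom)
qed

lemma continuous_on_vbar: "continuous_on S (vbar p)" "continuous_on S (vbar' p)"
  using vbar_has_derivative vbar'_has_derivative
  by (blast intro: continuous_at_imp_continuous_on DERIV_isCont)+

subsection \<open>Solutions on a half-line\<close>

context
  fixes v d :: "real \<Rightarrow> real"
  assumes H: "H1_pair v d"
    and v1: "\<And>s. 0 < s \<Longrightarrow> v field_differentiable (at s)"
    and v2: "\<And>s. 0 < s \<Longrightarrow> deriv v field_differentiable (at s)"
    and ode: "\<And>s. 0 < s \<Longrightarrow> - deriv (deriv v) s + v s = \<bar>v s\<bar> powr (p - 2) * v s"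
begin

lemma v_deriv: "0 < s \<Longrightarrow> (v has_real_derivative deriv v s) (at s)"
  using v1 by (simp add: field_differentiable_derivI)

lemma v_deriv2: "0 < s \<Longrightarrow> (deriv v has_real_derivative v s - \<bar>v s\<bar> powr (p - 2) * v s) (at s)"
  by (rule DERIV_cong[OF field_differentiable_derivI[OF v2[of s]]]) (use ode[of s] in simp_all)

text \<open>The quantity e = v'^2 - v^2 + (2/p)|v|^p is constant. No decay of v' is known in
  advance, but the mean value theorem on unit intervals gives points going to infinity at which v'
  is a difference of two small values of v, and this forces the constant to be 0.\<close>

lemma zero_energy:
  assumes "0 < s"
  shows "(deriv v s)\<^sup>2 = (v s)\<^sup>2 - 2 / p * \<bar>v s\<bar> powr p"
proof -
  define e where "e s = (deriv v s)\<^sup>2 - (v s)\<^sup>2 + 2 / p * \<bar>v s\<bar> powr p" for s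
  have "(e has_real_derivative 0) (at s within {0<..})" if "s \<in> {0<..}" for s
  proof -
    have s: "0 < s" using that by simp
    let ?A = "v s - \<bar>v s\<bar> powr (p - 2) * v s"
    have "(e has_real_derivative 2 * deriv v s * ?A - 2 * v s * deriv v s +
        2 / p * (p * \<bar>v s\<bar> powr (p - 2) * v s * deriv v s)) (at s)"
      unfolding e_def[abs_def]
      by (intro DERIV_add DERIV_diff DERIV_cmult DERIV_chain2[OF has_real_derivative_abs_powr[OF p] v_deriv[OF s]]
          DERIV_cong[OF DERIV_power[OF v_deriv2[OF s], of 2]] DERIV_cong[OF DERIV_power[OF v_deriv[OF s], of 2]])
         auto
    moreover have "2 * deriv v s * ?A - 2 * v s * deriv v s +
        2 / p * (p * \<bar>v s\<bar> powr (p - 2) * v s * deriv v s) = 0"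
      using p by (simp add: field_simps)
    ultimately show ?thesis by (simp add: has_field_derivative_at_within)
  qed
  then obtain C where C: "\<And>s. 0 < s \<Longrightarrow> e s = C"
    using has_field_derivative_zero_constant[of "{0<..}" e] by auto
  \<comment> \<open>The intervals start at 1 because differentiability is only given in the open
    half-line.\<close>
  have "\<exists>z. real n + 1 < z \<and> z < real n + 2 \<and> v (real n + 2) - v (real n + 1) = deriv v z" for n
    using MVT2[of "real n + 1" "real n + 2" v "deriv v"] v_deriv by force
  then obtain z where z: "\<And>n. real n + 1 < z n" "\<And>n. v (real n + 2) - v (real n + 1) = deriv v (z n)"
    by metis
  note v0 = H1_pair_tendsto_0[OF H]
  have lim: "filterlim (\<lambda>n. real n + c) at_top sequentially" for c
    by (subst add.commute) (intro filterlim_tendsto_add_at_top[OF tendsto_const filterlim_real_sequentially])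
  have "filterlim z at_top sequentially"
    by (rule filterlim_at_top_mono[OF lim[of 1]]) (use z(1) in \<open>auto intro!: always_eventually less_imp_le\<close>)
  then have vz: "(\<lambda>n. v (z n)) \<longlonglongrightarrow> 0" by (rule filterlim_compose[OF v0])
  have "(\<lambda>n. v (real n + 2) - v (real n + 1)) \<longlonglongrightarrow> 0 - 0"
    by (intro tendsto_diff filterlim_compose[OF v0 lim])
  then have dz: "(\<lambda>n. deriv v (z n)) \<longlonglongrightarrow> 0" by (simp add: z(2))
  have "(\<lambda>n. e (z n)) \<longlonglongrightarrow> 0\<^sup>2 - 0\<^sup>2 + 2 / p * \<bar>0\<bar> powr p"
    unfolding e_def using p by (intro tendsto_intros tendsto_powr' vz dz) auto
  moreover have "e (z n) = C" for n using z(1)[of n] by (intro C) linarith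
  ultimately have "C = 0" using p by (simp add: LIMSEQ_const_iff)
  then show ?thesis using C[OF assms] by (simp add: e_def)
qed

lemma abs_deriv_le: "0 < s \<Longrightarrow> \<bar>deriv v s\<bar> \<le> \<bar>v s\<bar>"
  using zero_energy[of s] p by (simp add: abs_le_square_iff)

text \<open>From |v'| <= |v| it follows that v^2 exp(-2 s) is nonincreasing and v^2 exp(2 s)
  nondecreasing, so a zero spreads to the right and to the left. The sign of v is left open, which
  serves the case of an outer vertex.\<close>

lemma vanishes:
  assumes x: "0 \<le> x" "v x = 0" and y: "0 \<le> y"
  shows "v y = 0"
proof -
  have cv: "continuous_on {a..b} v" if "0 \<le> a" for a b
    by (rule continuous_on_subset[OF H1_pairD(1)[OF H]]) (use that in auto)
  have D: "((\<lambda>s. (v s)\<^sup>2 * exp (c * s)) has_real_derivative (2 * v s * deriv v s + c * (v s)\<^sup>2) * exp (c * s)) (at s)"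
    if "0 < s" for c s
    by (rule DERIV_cong[OF DERIV_mult[OF DERIV_power[OF v_deriv[OF that], of 2]]])
       (auto intro!: derivative_eq_intros simp: algebra_simps)
  have bd: "\<bar>2 * v s * deriv v s\<bar> \<le> 2 * (v s)\<^sup>2" if "0 < s" for s
    using mult_left_mono[OF abs_deriv_le[OF that], of "2 * \<bar>v s\<bar>"] by (simp add: abs_mult power2_eq_square)
  have "(v y)\<^sup>2 * exp (c * y) \<le> 0" if c: "c = (if x \<le> y then - 2 else 2)" for c
  proof (cases "x \<le> y")
    case True
    have "(v x)\<^sup>2 * exp (c * x) \<ge> (v y)\<^sup>2 * exp (c * y)"
    proof (rule DERIV_nonpos_imp_decreasing_open[OF True])
      fix s assume "x < s" "s < y"
      then have s: "0 < s" using x by simp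
      show "\<exists>z. ((\<lambda>s. (v s)\<^sup>2 * exp (c * s)) has_real_derivative z) (at s) \<and> z \<le> 0"
        using D[OF s, of c] bd[OF s] True c by (auto intro!: exI mult_nonpos_nonneg)
    qed (intro continuous_intros cv x)
    then show ?thesis using x by simp
  next
    case False
    have "(v y)\<^sup>2 * exp (c * y) \<le> (v x)\<^sup>2 * exp (c * x)"
    proof (rule DERIV_nonneg_imp_increasing_open[of y x])
      fix s assume "y < s" "s < x"
      then have s: "0 < s" using y by simp
      show "\<exists>z. ((\<lambda>s. (v s)\<^sup>2 * exp (c * s)) has_real_derivative z) (at s) \<and> z \<ge> 0"
        using D[OF s, of c] bd[OF s] False c by (auto intro!: exI)
    qed (use False in \<open>auto intro!: continuous_intros cv y\<close>)
    then show ?thesis using x by simp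
  qed
  then have "(v y)\<^sup>2 \<le> 0" by (simp add: mult_le_0_iff)
  then show ?thesis by simp
qed

text \<open>The substitution \<open>w = v\<^bsup>-k\<^esup>\<close> with \<open>k = (p - 2) / 2\<close> makes the equation linear: \<open>w'' = k\<^sup>2 w\<close>.\<close>

lemma positive_is_vbar:
  assumes pos: "\<And>s. 0 \<le> s \<Longrightarrow> 0 < v s"
  obtains a where "\<And>s. 0 \<le> s \<Longrightarrow> v s = vbar p (s + a)"
proof -
  define k where "k = (p - 2) / 2"
  have k: "0 < k" using p by (simp add: k_def)
  have kk: "2 * k = p - 2" by (simp add: k_def)
  then have p2: "p = 2 * (k + 1)" by simp
  define w where "w s = v s powr (- k)" for s
  define w' where "w' s = - k * v s powr (- k - 1) * deriv v s" for s
  have wpos: "0 < w s" if "0 < s" for s using pos[of s] that by (simp add: w_def)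
  have dw: "(w has_real_derivative w' s) (at s)" if s: "0 < s" for s
    using DERIV_fun_powr[OF v_deriv[OF s], of "- k"] pos[of s] s by (simp add: w_def[abs_def] w'_def)
  have en: "(deriv v s)\<^sup>2 = (v s)\<^sup>2 - 2 / p * v s powr (2 * k) * (v s)\<^sup>2" if s: "0 < s" for s
    using zero_energy[OF s] powr_split[OF p, of "v s"] pos[of s] s by (simp add: kk)
  have dw': "(w' has_real_derivative k\<^sup>2 * w s) (at s)" if s: "0 < s" for s
  proof -
    have vs: "0 < v s" using pos[of s] s by simp
    have "(w' has_real_derivative
        (- k * ((- k - 1) * v s powr (- k - 1 - of_nat 1) * deriv v s)) * deriv v s +
        (v s - \<bar>v s\<bar> powr (p - 2) * v s) * (- k * v s powr (- k - 1))) (at s)"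
      unfolding w'_def[abs_def]
      by (intro DERIV_mult DERIV_cmult DERIV_fun_powr v_deriv v_deriv2 s vs)
    moreover have "(- k * ((- k - 1) * v s powr (- k - 1 - of_nat 1) * deriv v s)) * deriv v s +
        (v s - \<bar>v s\<bar> powr (p - 2) * v s) * (- k * v s powr (- k - 1)) = k\<^sup>2 * w s"
    proof -
      have e1: "v s powr (- k - 1 - of_nat 1) * (v s)\<^sup>2 = w s"
      proof -
        have "- k - 1 - of_nat 1 = - k - (2::real)" by simp
        then show ?thesis using vs powr_add[of "v s" "- k - 2" 2] by (simp only: w_def) simp
      qed
      have e2: "v s powr (- k - 1) * v s = w s"
        using vs powr_add[of "v s" "- k - 1" 1] by (simp add: w_def)
      have e3: "\<bar>v s\<bar> powr (p - 2) = v s powr (2 * k)" using vs by (simp add: kk)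
      define X where "X = v s powr (2 * k)"
      have "(- k * ((- k - 1) * v s powr (- k - 1 - of_nat 1) * deriv v s)) * deriv v s =
        k * (k + 1) * v s powr (- k - 1 - of_nat 1) * (deriv v s)\<^sup>2"
        by (simp add: power2_eq_square algebra_simps)
      also have "\<dots> = k * (k + 1) * (1 - 2 / p * X) * w s"
        unfolding en[OF s] e1[symmetric] X_def by (simp add: add_divide_distrib algebra_simps)
      also have "\<dots> = (k * (k + 1) - k * X) * w s"
        using k unfolding p2 by (simp add: field_simps)
      finally have t1: "(- k * ((- k - 1) * v s powr (- k - 1 - of_nat 1) * deriv v s)) * deriv v s = (k * (k + 1) - k * X) * w s" .
      have t2: "(v s - \<bar>v s\<bar> powr (p - 2) * v s) * (- k * v s powr (- k - 1)) = - k * (1 - X) * w s"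
        unfolding e3 e2[symmetric] X_def by (simp add: algebra_simps)
      show ?thesis unfolding t1 t2 by (simp add: power2_eq_square algebra_simps)
    qed
    ultimately show ?thesis by simp
  qed
  \<comment> \<open>The operator w'' - k^2 w factors into two first-order ones; c = k and c = - k
    give the two first integrals.\<close>
  have const: "\<exists>C. \<forall>s\<in>{0<..}. (w' s + c * w s) * exp (- c * s) = C" if c: "c\<^sup>2 = k\<^sup>2" for c
  proof (rule has_field_derivative_zero_constant)
    fix s :: real assume "s \<in> {0<..}"
    then have s: "0 < s" by simp
    have "((\<lambda>s. exp (- c * s)) has_real_derivative - c * exp (- c * s)) (at s)"
      by (auto intro!: derivative_eq_intros)
    from DERIV_mult[OF DERIV_add[OF dw'[OF s] DERIV_cmult[OF dw[OF s], of c]] this]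
    have "((\<lambda>s. (w' s + c * w s) * exp (- c * s)) has_real_derivative
       (k\<^sup>2 * w s + c * w' s) * exp (- c * s) + - c * exp (- c * s) * (w' s + c * w s)) (at s)" .
    moreover have "(k\<^sup>2 * w s + c * w' s) * exp (- c * s) + - c * exp (- c * s) * (w' s + c * w s) = 0"
      unfolding c[symmetric] by (simp add: power2_eq_square algebra_simps)
    ultimately show "((\<lambda>s. (w' s + c * w s) * exp (- c * s)) has_real_derivative 0) (at s within {0<..})"
      by (simp add: has_field_derivative_at_within)
  qed simp
  obtain A where A: "\<And>s. 0 < s \<Longrightarrow> (w' s + k * w s) * exp (- k * s) = A" using const[of k] by auto
  obtain B where B: "\<And>s. 0 < s \<Longrightarrow> (w' s - k * w s) * exp (k * s) = B" using const[of "- k"] by auto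
  have wA: "w' s + k * w s = A * exp (k * s)" if "0 < s" for s
    using A[OF that] by (auto simp: exp_minus field_simps)
  have wB: "w' s - k * w s = B * exp (- (k * s))" if "0 < s" for s
    using B[OF that] by (auto simp: exp_minus field_simps)
  have ww: "w s = (A * exp (k * s) - B * exp (- (k * s))) / (2 * k)" if "0 < s" for s
    using wA[OF that] wB[OF that] k by (simp add: field_simps)
  \<comment> \<open>A B is the invariant w'^2 - k^2 w^2, evaluated at the arbitrary point 1; zero
    energy of v fixes its value.\<close>
  have AB: "A * B = - (k\<^sup>2 * (2 / p))"
  proof -
    have v1: "0 < v 1" using pos[of 1] by simp
    have sq: "(v 1 powr q)\<^sup>2 = v 1 powr (2 * q)" for q
      using powr_add[of "v 1" q q] by (simp add: power2_eq_square)
    have "A * B = (w' 1 + k * w 1) * (w' 1 - k * w 1)"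
      using wA[of 1] wB[of 1] by (simp add: exp_minus)
    also have "\<dots> = (w' 1)\<^sup>2 - k\<^sup>2 * (w 1)\<^sup>2" by (simp add: power2_eq_square algebra_simps)
    also have "(w' 1)\<^sup>2 = k\<^sup>2 * (v 1 powr (2 * (- k - 1)) * (deriv v 1)\<^sup>2)"
      by (simp only: w'_def power_mult_distrib sq) simp
    also have "v 1 powr (2 * (- k - 1)) * (deriv v 1)\<^sup>2 = v 1 powr (2 * (- k - 1)) * (v 1)\<^sup>2 * (1 - 2 / p * v 1 powr (2 * k))"
    proof -
      have "(deriv v 1)\<^sup>2 = (v 1)\<^sup>2 * (1 - 2 / p * v 1 powr (2 * k))"
        unfolding en[OF zero_less_one] by (simp add: right_diff_distrib)
      then show ?thesis by (simp only: mult.assoc)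
    qed
    also have "v 1 powr (2 * (- k - 1)) * (v 1)\<^sup>2 = v 1 powr (2 * (- k))"
      using v1 powr_add[of "v 1" "2 * (- k - 1)" 2] by (simp add: algebra_simps)
    also have "(w 1)\<^sup>2 = v 1 powr (2 * (- k))" by (simp only: w_def sq)
    also have "k\<^sup>2 * (v 1 powr (2 * (- k)) * (1 - 2 / p * v 1 powr (2 * k))) - k\<^sup>2 * v 1 powr (2 * (- k)) =
      - (k\<^sup>2 * (2 / p * (v 1 powr (2 * (- k)) * v 1 powr (2 * k))))"
      by (simp add: algebra_simps)
    also have "v 1 powr (2 * (- k)) * v 1 powr (2 * k) = 1"
      using v1 powr_add[of "v 1" "2 * (- k)" "2 * k"] by simp
    finally show ?thesis by simp
  qed
  have ABneg: "A * B < 0" using AB k p by simp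
  \<comment> \<open>A and B have opposite signs by the previous step, and A < 0 < B would make w
    negative.\<close>
  have "0 < A"
  proof (rule ccontr)
    assume "\<not> 0 < A"
    with ABneg have "A < 0" "0 < B" by (auto simp: mult_less_0_iff)
    then have "A * exp (k * 1) - B * exp (- (k * 1)) < 0"
      by (smt (verit) exp_gt_zero mult_neg_pos mult_pos_pos)
    then have "w 1 < 0" using ww[of 1] k by (simp add: divide_less_0_iff)
    then show False using wpos[of 1] by simp
  qed
  \<comment> \<open>q^2 = - A B, so A and - B are q exp(k a) and q exp(- k a) for one shift
    \<open>a\<close>. The exponentials then combine to a cosh.\<close>
  define q where "q = k * sqrt (2 / p)"
  have q: "0 < q" "q\<^sup>2 = k\<^sup>2 * (2 / p)" using k p by (auto simp: q_def power_mult_distrib)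
  define a where "a = ln (A / q) / k"
  have Aa: "A = q * exp (k * a)" using k q \<open>0 < A\<close> by (simp add: a_def)
  have Ba: "B = - (q * exp (- (k * a)))"
  proof -
    have "q * (B * exp (k * a)) = q * (- q)"
      using AB q by (simp add: Aa power2_eq_square mult_ac)
    then have "B * exp (k * a) = - q" using q(1) mult_left_cancel[of q] by blast
    then show ?thesis by (simp add: exp_minus field_simps)
  qed
  have wc: "w s = sqrt (2 / p) * cosh (k * (s + a))" if "0 < s" for s
  proof -
    have "w s = q * (exp (k * a) * exp (k * s) + exp (- (k * a)) * exp (- (k * s))) / (2 * k)"
      unfolding ww[OF that] Aa Ba by (simp add: algebra_simps)
    also have "\<dots> = q / k * cosh (k * (s + a))"
      using k by (simp add: cosh_def exp_add[symmetric] add_divide_distrib algebra_simps)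
    finally show ?thesis using k by (simp add: q_def)
  qed
  have veq: "v s = vbar p (s + a)" if s: "0 < s" for s
  proof -
    have "v s = w s powr (- 1 / k)" using k pos[of s] s by (simp add: w_def powr_powr)
    also have "\<dots> = sqrt (2 / p) powr (- 1 / k) * cosh (k * (s + a)) powr (- 1 / k)"
      unfolding wc[OF s] using p by (simp add: powr_mult)
    also have "sqrt (2 / p) powr (- 1 / k) = (2 / p) powr (- 1 / (p - 2))"
      using p by (simp add: powr_half_sqrt[symmetric] powr_powr k_def field_simps del: powr_half_sqrt)
    also have "\<dots> = peak p"
    proof -
      have "2 / p = inverse (p / 2)" by simp
      then have "(2 / p) powr (- 1 / (p - 2)) = (p / 2) powr (- (- 1 / (p - 2)))"
        using p by (metis powr_minus inverse_powr divide_nonneg_pos less_imp_le powr_ge_zero zero_less_numeral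
            inverse_inverse_eq order.strict_trans)
      then show ?thesis by (simp add: peak_def)
    qed
    also have "- 1 / k = - 2 / (p - 2)" using p by (simp add: k_def)
    finally show ?thesis by (simp add: vbar_eq k_def)
  qed
  show thesis
  proof (rule that)
    fix s :: real assume s: "0 \<le> s"
    show "v s = vbar p (s + a)"
    \<comment> \<open>The identity is available only for s > 0; the vertex value follows by
      continuity from the right.\<close>
    proof (cases "s = 0")
      case True
      have "(v \<longlongrightarrow> v 0) (at 0 within {0..})"
        using H1_pairD(1)[OF H] by (simp add: continuous_on)
      then have l1: "(v \<longlongrightarrow> v 0) (at_right 0)" by (rule tendsto_within_subset) auto
      have "((\<lambda>s. vbar p (s + a)) \<longlongrightarrow> vbar p (0 + a)) (at_right 0)"
        by (intro isCont_tendsto_compose[OF DERIV_isCont[OF vbar_has_derivative]] tendsto_intros)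
      moreover have "\<forall>\<^sub>F s in at_right 0. vbar p (s + a) = v s"
        using eventually_at_right_less[of "0::real"] by eventually_elim (simp add: veq)
      ultimately have "(v \<longlongrightarrow> vbar p (0 + a)) (at_right 0)" by (rule Lim_transform_eventually)
      then show ?thesis using tendsto_unique[OF _ l1] True by simp
    qed (use veq s in simp)
  qed
qed

end

end

subsection \<open>Stars of translated solitons\<close>

lemma set_integral_FTC_atLeast:
  fixes h F :: "real \<Rightarrow> real"
  assumes h: "set_integrable lborel {a..} h" "continuous_on {a..} h"
    and F: "\<And>s. a \<le> s \<Longrightarrow> (F has_real_derivative h s) (at s)" and T: "(F \<longlongrightarrow> T) at_top"
  shows "(LINT s:{a..}|lborel. h s) = T - F a"
proof (rule tendsto_unique[OF trivial_limit_at_top_linorder])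
  show "((\<lambda>b. LINT s:{a..b}|lborel. h s) \<longlongrightarrow> (LINT s:{a..}|lborel. h s)) at_top"
    by (rule tendsto_set_lebesgue_integral_at_top[OF _ h(1)]) auto
  have "((\<lambda>b. F b - F a) \<longlongrightarrow> T - F a) at_top" by (intro tendsto_intros T)
  moreover have "\<forall>\<^sub>F b in at_top. F b - F a = (LINT s:{a..b}|lborel. h s)"
    using eventually_ge_at_top[of a]
  proof eventually_elim
    case (elim b)
    show ?case unfolding set_lebesgue_integral_def
      by (rule integral_FTC_atLeastAtMost[symmetric, OF elim])
         (use F in \<open>auto simp: has_real_derivative_iff_has_vector_derivative[symmetric]
            intro: has_field_derivative_at_within continuous_on_subset[OF h(2)]\<close>)
  qed
  ultimately show "((\<lambda>b. LINT s:{a..b}|lborel. h s) \<longlongrightarrow> T - F a) at_top"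
    by (rule Lim_transform_eventually)
qed

lemma set_integrable_exp_atLeast: "set_integrable lborel {0..} (\<lambda>s::real. exp (- 2 * s))"
proof -
  have lim: "((\<lambda>s::real. - exp (- 2 * s) / 2) \<longlongrightarrow> 0) at_top"
  proof -
    have "filterlim (\<lambda>s::real. - 2 * s) at_bot at_top"
      by (rule filterlim_tendsto_neg_mult_at_bot[OF tendsto_const _ filterlim_ident]) simp
    from filterlim_compose[OF exp_at_bot this] have "((\<lambda>s::real. exp (- 2 * s)) \<longlongrightarrow> 0) at_top" .
    then have "((\<lambda>s::real. - exp (- 2 * s) / 2) \<longlongrightarrow> - 0 / 2) at_top" by (intro tendsto_intros) auto
    then show ?thesis by simp
  qed
  have "(\<integral>\<^sup>+s. ennreal (exp (- 2 * s)) * indicator {0..} s \<partial>lborel) = ennreal (0 - (- exp (- 2 * 0) / 2))"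
    by (rule nn_integral_FTC_atLeast[OF _ _ _ lim]) (auto intro!: derivative_eq_intros)
  also have "(\<integral>\<^sup>+s. ennreal (exp (- 2 * s)) * indicator {0..} s \<partial>lborel) =
     (\<integral>\<^sup>+s. ennreal (indicat_real {0..} s *\<^sub>R exp (- 2 * s)) \<partial>lborel)"
    by (rule nn_integral_cong) (auto simp: indicator_def)
  finally have eq: "(\<integral>\<^sup>+s. ennreal (indicat_real {0..} s *\<^sub>R exp (- 2 * s)) \<partial>lborel) = ennreal (0 - (- exp (- 2 * 0) / 2))" .
  show ?thesis unfolding set_integrable_def
  proof (rule integrableI_nonneg)
    show "(\<integral>\<^sup>+s. ennreal (indicat_real {0..} s *\<^sub>R exp (- 2 * s)) \<partial>lborel) < \<infinity>"
      unfolding eq infinity_ennreal_def by (rule ennreal_less_top)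
  qed auto
qed

text \<open>A positive shift leaves a decreasing tail on the edge, a negative one puts the peak at
  distance \<open>- a i\<close> from the vertex. The value 0 off the graph matches the normalisation
  in \<open>cont_star\<close>.\<close>

definition translates :: "real \<Rightarrow> nat \<Rightarrow> (nat \<Rightarrow> real) \<Rightarrow> nat \<Rightarrow> real \<Rightarrow> real" where
  "translates p N a i s = (if i < N \<and> 0 \<le> s then vbar p (s + a i) else 0)"

definition tail_energy :: "real \<Rightarrow> real \<Rightarrow> real" where
  "tail_energy p a = (LINT s:{0..}|lborel. (vbar' p (s + a))\<^sup>2 + (vbar p (s + a))\<^sup>2)"

definition tail_powr :: "real \<Rightarrow> real \<Rightarrow> real" where
  "tail_powr p a = (LINT s:{0..}|lborel. vbar p (s + a) powr p)"

section \<open>Decay and weak derivatives of translated solitons\<close>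

context
  fixes p :: real
  assumes p: "2 < p"
begin

text \<open>cosh is at least exp/2, the exponent is negative, and (p - 2)/2 times 2/(p - 2) is 1:
  the decay rate does not depend on p.\<close>

lemma vbar_exp_bound:
  obtains C where "0 < C" "\<And>s. vbar p s \<le> C * exp (- s)"
proof
  let ?k = "(p - 2) / 2" and ?r = "- 2 / (p - 2)"
  show "0 < peak p * (1 / 2) powr ?r" using peak_pos[OF p] by simp
  fix s :: real
  have "cosh (?k * s) powr ?r \<le> (exp (?k * s) / 2) powr ?r"
    using p by (intro powr_mono2') (auto simp: cosh_def divide_nonpos_nonneg)
  also have "\<dots> = exp (?k * s) powr ?r * (1 / 2) powr ?r"
    by (simp add: powr_mult[symmetric])
  also have "exp (?k * s) powr ?r = exp (- s)"
    using p by (simp add: powr_def)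
  finally have "peak p * cosh (?k * s) powr ?r \<le> peak p * (exp (- s) * (1 / 2) powr ?r)"
    using peak_pos[OF p] by (intro mult_left_mono) auto
  then show "vbar p s \<le> peak p * (1 / 2) powr ?r * exp (- s)"
    unfolding vbar_eq[OF p] by (simp add: mult_ac)
qed

lemma vbar_tendsto_0: "((\<lambda>s. vbar p (s + a)) \<longlongrightarrow> 0) at_top"
proof -
  obtain C where C: "0 < C" "\<And>s. vbar p s \<le> C * exp (- s)" by (rule vbar_exp_bound) blast
  have "filterlim (\<lambda>s::real. a + s) at_top at_top"
    by (rule filterlim_tendsto_add_at_top[OF tendsto_const filterlim_ident])
  then have "filterlim (\<lambda>s::real. - (s + a)) at_bot at_top"
    unfolding filterlim_uminus_at_bot by (simp add: add.commute)
  from filterlim_compose[OF exp_at_bot this] have "((\<lambda>s. C * exp (- (s + a))) \<longlongrightarrow> C * 0) at_top"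
    by (intro tendsto_intros)
  then have lim: "((\<lambda>s. C * exp (- (s + a))) \<longlongrightarrow> 0) at_top" by simp
  have "0 \<le> vbar p (s + a)" "vbar p (s + a) \<le> C * exp (- (s + a))" for s
    using C(2)[of "s + a"] vbar_pos[OF p, of "s + a"] by auto
  then show ?thesis
    by (intro tendsto_sandwich[OF _ _ tendsto_const lim] always_eventually allI)
qed

lemma abs_vbar'_le: "\<bar>vbar' p s\<bar> \<le> vbar p s"
proof -
  have "(vbar' p s)\<^sup>2 \<le> (vbar p s)\<^sup>2" using p by (simp add: vbar'_square)
  then have "\<bar>vbar' p s\<bar> \<le> \<bar>vbar p s\<bar>" by (rule abs_le_square_iff[THEN iffD2])
  then show ?thesis using vbar_pos[OF p, of s] by simp
qed

lemma DERIV_shift_vbar: "((\<lambda>s. vbar p (s + a)) has_real_derivative vbar' p (s + a)) (at s)"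
  using vbar_has_derivative[OF p, of "s + a"] by (simp add: DERIV_shift)

lemma DERIV_shift_vbar': "((\<lambda>s. vbar' p (s + a)) has_real_derivative vbar p (s + a) - vbar p (s + a) powr (p - 2) * vbar p (s + a)) (at s)"
  using vbar'_has_derivative[OF p, of "s + a"] by (simp add: DERIV_shift)

lemma continuous_on_shift_vbar:
  "continuous_on S (\<lambda>s. vbar p (s + a))" "continuous_on S (\<lambda>s. vbar' p (s + a))"
  by (intro continuous_on_compose2[OF continuous_on_vbar(1)[OF p, of UNIV]]
        continuous_on_compose2[OF continuous_on_vbar(2)[OF p, of UNIV]] continuous_intros; simp)+

lemma tail_integrable:
  "set_integrable lborel {0..} (\<lambda>s. (vbar p (s + a))\<^sup>2)"
  "set_integrable lborel {0..} (\<lambda>s. (vbar' p (s + a))\<^sup>2)"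
proof -
  obtain C where C: "0 < C" "\<And>s. vbar p s \<le> C * exp (- s)" by (rule vbar_exp_bound) blast
  have b: "(vbar p (s + a))\<^sup>2 \<le> C\<^sup>2 * exp (- 2 * a) * exp (- 2 * s)" for s
  proof -
    have "(vbar p (s + a))\<^sup>2 \<le> (C * exp (- (s + a)))\<^sup>2"
      using C(2)[of "s + a"] vbar_pos[OF p, of "s + a"] by (intro power_mono) auto
    also have "\<dots> = C\<^sup>2 * (exp (- (s + a)) * exp (- (s + a)))" by (simp add: power2_eq_square mult_ac)
    also have "exp (- (s + a)) * exp (- (s + a)) = exp (- 2 * a) * exp (- 2 * s)"
      by (simp add: exp_add[symmetric])
    finally show ?thesis by (simp add: mult_ac)
  qed
  have e: "set_integrable lborel {0..} (\<lambda>s. C\<^sup>2 * exp (- 2 * a) * exp (- 2 * s))"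
    using set_integrable_exp_atLeast by (intro set_integrable_mult_right) auto
  show v: "set_integrable lborel {0..} (\<lambda>s. (vbar p (s + a))\<^sup>2)"
    by (rule set_integrable_bound[OF e])
       (use b in \<open>auto intro!: set_borel_measurable_continuous_half continuous_intros continuous_on_shift_vbar\<close>)
  show "set_integrable lborel {0..} (\<lambda>s. (vbar' p (s + a))\<^sup>2)"
    by (rule set_integrable_bound[OF v])
       (use abs_vbar'_le in \<open>auto intro!: set_borel_measurable_continuous_half continuous_intros continuous_on_shift_vbar
          simp: abs_le_square_iff[symmetric] vbar_pos[OF p] less_imp_le\<close>)
qed

text \<open>Only the values on the half-line are prescribed, because members of
  \<open>cont_star\<close> are cut off to 0 at negative arguments.\<close>

lemma H1_pair_translate:
  assumes f: "\<And>s. 0 \<le> s \<Longrightarrow> f s = vbar p (s + a)"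
  shows "H1_pair f (\<lambda>s. vbar' p (s + a))"
  unfolding H1_pair_def
proof (intro conjI allI impI)
  show "continuous_on {0..} f"
    by (rule continuous_on_cong[THEN iffD2, OF refl _ continuous_on_shift_vbar(1)[of _ a]]) (use f in auto)
  show "set_borel_measurable lborel {0..} (\<lambda>s. vbar' p (s + a))"
    by (intro set_borel_measurable_continuous_half continuous_on_shift_vbar)
  have "set_integrable lborel {0..} (\<lambda>s. (f s)\<^sup>2) \<longleftrightarrow> set_integrable lborel {0..} (\<lambda>s. (vbar p (s + a))\<^sup>2)"
    by (rule set_integrable_cong) (use f in auto)
  then show "set_integrable lborel {0..} (\<lambda>s. (f s)\<^sup>2)" by (simp add: tail_integrable)
  show "set_integrable lborel {0..} (\<lambda>s. (vbar' p (s + a))\<^sup>2)" by (rule tail_integrable)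
  fix x y :: real assume xy: "0 \<le> x" "x \<le> y"
  have "(LINT s:{x..y}|lborel. vbar' p (s + a)) = vbar p (y + a) - vbar p (x + a)"
    unfolding set_lebesgue_integral_def
    by (rule integral_FTC_atLeastAtMost[OF xy(2)])
       (auto simp: has_real_derivative_iff_has_vector_derivative[symmetric]
         intro!: has_field_derivative_at_within DERIV_shift_vbar continuous_on_shift_vbar)
  then show "f y - f x = (LINT s:{x..y}|lborel. vbar' p (s + a))" using f xy by simp
qed

text \<open>Integration by parts for the smooth translate on a compact interval [z, y] at whose ends
  the test function vanishes.\<close>

lemma has_weak_deriv_translate:
  assumes f: "\<And>s. 0 \<le> s \<Longrightarrow> f s = vbar p (s + a)"
  shows "has_weak_deriv f (\<lambda>s. vbar' p (s + a))"
  unfolding has_weak_deriv_def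
proof (intro conjI allI impI)
  show "L2_half (\<lambda>s. vbar' p (s + a))"
    using H1_pair_translate[OF f] by (simp add: L2_half_def H1_pair_def)
  fix \<phi> assume tf: "test_function \<phi>"
  then obtain x y0 where xy0: "0 < x" "\<And>s. s \<notin> {x..y0} \<Longrightarrow> \<phi> s = 0"
    unfolding test_function_def by blast
  define y where "y = max x y0 + 1"
  \<comment> \<open>Strictly between 0 and the support, so the test function vanishes at
    \<open>z\<close>; the 1 added in \<open>y\<close> does the same on the right.\<close>
  define z where "z = x / 2"
  have z: "0 < z" "z < x" "z \<le> y" using xy0 by (auto simp: z_def y_def)
  have out: "\<phi> s = 0" if "s \<notin> {z<..<y}" for s
    by (rule xy0(2)) (use that z in \<open>auto simp: y_def\<close>)
  have supp: "\<phi> s \<noteq> 0 \<Longrightarrow> 0 \<le> s \<and> z \<le> s \<and> s \<le> y" for s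
    using out[of s] z by force
  have D: "(\<phi> has_real_derivative deriv \<phi> s) (at s)" for s
    using tf by (simp add: test_function_def field_differentiable_derivI)
  have dout: "deriv \<phi> s = 0" if "s \<notin> {z..y}" for s
  proof -
    have "\<forall>\<^sub>F t in nhds s. \<phi> t = 0"
      by (rule eventually_mono[OF eventually_nhds_in_open[of "- {z..y}"]]) (use that out in auto)
    then have "deriv \<phi> s = deriv (\<lambda>_. 0) s" by (intro deriv_cong_ev) auto
    then show ?thesis by simp
  qed
  have cd: "isCont (deriv \<phi>) s" for s
    using tf by (simp add: test_function_def continuous_on_eq_continuous_at)
  have "(LINT s:{0..}|lborel. f s * deriv \<phi> s) = (\<integral>s. (vbar p (s + a) * deriv \<phi> s) * indicator {z..y} s \<partial>lborel)"
    unfolding set_lebesgue_integral_def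
    by (rule Bochner_Integration.integral_cong) (use f dout z in \<open>auto simp: indicator_def\<close>)
  also have "\<dots> = vbar p (y + a) * \<phi> y - vbar p (z + a) * \<phi> z - (\<integral>s. (vbar' p (s + a) * \<phi> s) * indicator {z..y} s \<partial>lborel)"
    by (rule integral_by_parts) (use z cd D DERIV_shift_vbar DERIV_isCont[OF DERIV_shift_vbar'] in auto)
  also have "(\<integral>s. (vbar' p (s + a) * \<phi> s) * indicator {z..y} s \<partial>lborel) = (LINT s:{0..}|lborel. vbar' p (s + a) * \<phi> s)"
    unfolding set_lebesgue_integral_def
    by (rule Bochner_Integration.integral_cong) (use supp in \<open>auto simp: indicator_def\<close>)
  finally show "(LINT s:{0..}|lborel. f s * deriv \<phi> s) = - (LINT s:{0..}|lborel. vbar' p (s + a) * \<phi> s)"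
    using out[of y] out[of z] by simp
qed

lemma H1_half_translate:
  assumes f: "\<And>s. 0 \<le> s \<Longrightarrow> f s = vbar p (s + a)"
  shows "H1_half f"
  using has_weak_deriv_translate[OF f] H1_pair_translate[OF f]
  by (auto simp: H1_half_def L2_half_def H1_pair_def intro: set_borel_measurable_continuous_half)

end

text \<open>The passage from the given definitions to \<open>H1_pair\<close>, and the one place
  where the choice in \<open>weak_deriv\<close> is unfolded.\<close>

lemma H1_half_pair:
  assumes "continuous_on {0..} f" "H1_half f"
  shows "H1_pair f (weak_deriv f)"
proof -
  have "has_weak_deriv f (weak_deriv f)"
    using assms(2) unfolding H1_half_def weak_deriv_def by (metis someI_ex)
  then show ?thesis using assms by (intro H1_pair_weak_deriv) (auto simp: H1_half_def)
qed

section \<open>Energy and L^p integral of soliton tails\<close>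

context
  fixes p :: real
  assumes p: "2 < p"
begin

lemma edge_energy_translate:
  assumes f: "\<And>s. 0 \<le> s \<Longrightarrow> f s = vbar p (s + a)"
  shows "(LINT s:{0..}|lborel. \<bar>weak_deriv f s\<bar>\<^sup>2 + \<bar>f s\<bar>\<^sup>2) = tail_energy p a"
proof -
  note H = H1_pair_translate[OF p, of f, OF f]
  have W: "H1_pair f (weak_deriv f)"
    by (rule H1_half_pair[OF H1_pairD(1)[OF H] H1_half_translate[OF p, of f, OF f]])
  have m: "set_borel_measurable lborel {0..} (\<lambda>s. (e s)\<^sup>2 + (f s)\<^sup>2)" if "H1_pair f e" for e
    using set_integral_add(1)[OF H1_pairD(4)[OF that] H1_pairD(3)[OF that]]
    by (auto simp: set_integrable_def set_borel_measurable_def dest: borel_measurable_integrable)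
  have "(LINT s:{0..}|lborel. (weak_deriv f s)\<^sup>2 + (f s)\<^sup>2) = (LINT s:{0..}|lborel. (vbar' p (s + a))\<^sup>2 + (f s)\<^sup>2)"
    unfolding set_lebesgue_integral_def
    by (rule integral_cong_AE)
       (use m[OF W] m[OF H] H1_pair_unique[OF W H] in
         \<open>auto simp: set_borel_measurable_def indicator_def elim!: eventually_mono\<close>)
  also have "\<dots> = tail_energy p a"
    unfolding tail_energy_def by (rule set_lebesgue_integral_cong) (use f in auto)
  finally show ?thesis by simp
qed

lemma tail_powr_integrable: "set_integrable lborel {0..} (\<lambda>s. vbar p (s + a) powr p)"
  using H1_pair_powr_integrable[OF H1_pair_translate[OF p refl] p, of a] vbar_pos[OF p]
  by (simp add: less_imp_le)

lemma tail_energy_integrable: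
  "set_integrable lborel {0..} (\<lambda>s. (vbar' p (s + a))\<^sup>2 + (vbar p (s + a))\<^sup>2)"
  by (intro set_integral_add(1) tail_integrable p)

lemma tail_powr_nonneg: "0 \<le> tail_powr p a"
  unfolding tail_powr_def set_lebesgue_integral_def by (intro integral_nonneg_AE) auto

text \<open>Multiply the equation by the solution: (v v')' = v'^2 + v^2 - v^p. The boundary term is
  odd in \<open>a\<close>, so it cancels between the shifts \<open>a\<close> and
  \<open>- a\<close>.\<close>

lemma tail_virial: "tail_energy p a - tail_powr p a = - (vbar p a * vbar' p a)"
proof -
  let ?h = "\<lambda>s. (vbar' p (s + a))\<^sup>2 + (vbar p (s + a))\<^sup>2 - vbar p (s + a) powr p"
  have "tail_energy p a - tail_powr p a = (LINT s:{0..}|lborel. ?h s)"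
    unfolding tail_energy_def tail_powr_def
    by (rule set_integral_diff(2)[symmetric, OF tail_energy_integrable tail_powr_integrable])
  also have "\<dots> = 0 - vbar p (0 + a) * vbar' p (0 + a)"
  proof (rule set_integral_FTC_atLeast)
    show "set_integrable lborel {0..} ?h"
      by (rule set_integral_diff(1)[OF tail_energy_integrable tail_powr_integrable])
    show "continuous_on {0..} ?h"
    proof -
      have "vbar p s \<noteq> 0" for s using vbar_pos[OF p, of s] by simp
      then show ?thesis by (intro continuous_intros continuous_on_shift_vbar p) auto
    qed
    show "((\<lambda>s. vbar p (s + a) * vbar' p (s + a)) \<longlongrightarrow> 0) at_top"
    proof (rule Lim_null_comparison)
      show "\<forall>\<^sub>F s in at_top. norm (vbar p (s + a) * vbar' p (s + a)) \<le> vbar p (s + a) * vbar p (s + a)"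
        using abs_vbar'_le[OF p] vbar_pos[OF p] by (intro always_eventually) (auto simp: abs_mult mult_mono less_imp_le)
      have "((\<lambda>s. vbar p (s + a) * vbar p (s + a)) \<longlongrightarrow> 0 * 0) at_top"
        by (intro tendsto_mult vbar_tendsto_0 p)
      then show "((\<lambda>s. vbar p (s + a) * vbar p (s + a)) \<longlongrightarrow> 0) at_top" by simp
    qed
    fix s :: real
    have "vbar p (s + a) powr p = vbar p (s + a) powr (p - 2) * (vbar p (s + a))\<^sup>2"
      using powr_split[OF p, of "vbar p (s + a)"] vbar_pos[OF p, of "s + a"] by simp
    then show "((\<lambda>s. vbar p (s + a) * vbar' p (s + a)) has_real_derivative ?h s) (at s)"
      by (intro DERIV_cong[OF DERIV_mult[OF DERIV_shift_vbar[OF p] DERIV_shift_vbar'[OF p]]])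
         (simp add: power2_eq_square algebra_simps)
  qed
  finally show ?thesis by simp
qed

text \<open>Zero energy replaces v^2 - (2/p) v^p by v'^2.\<close>

lemma tail_defect: "tail_energy p a - 2 / p * tail_powr p a = (LINT s:{0..}|lborel. 2 * (vbar' p (s + a))\<^sup>2)"
proof -
  have "tail_energy p a - 2 / p * tail_powr p a =
     (LINT s:{0..}|lborel. (vbar' p (s + a))\<^sup>2 + (vbar p (s + a))\<^sup>2 - 2 / p * vbar p (s + a) powr p)"
    unfolding tail_energy_def tail_powr_def set_integral_mult_right[symmetric]
    by (rule set_integral_diff(2)[symmetric, OF tail_energy_integrable]) (simp add: tail_powr_integrable)
  then show ?thesis by (simp add: vbar'_square[OF p])
qed

lemma DERIV_level_vbar:
  "((\<lambda>s. level p (vbar p (s + a))) has_real_derivative \<bar>vbar' p (s + a)\<bar> * vbar' p (s + a)) (at s)"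
  using DERIV_chain2[OF level_has_derivative[OF p] DERIV_shift_vbar[OF p]] by (simp add: slope_vbar[OF p])

text \<open>To the right of the peak v' <= 0, so v'^2 = - g(v) v' and the integrand is the
  derivative of \<open>- 2 * level p\<close> along v.\<close>

lemma descending_tail:
  assumes x: "0 \<le> x" "0 \<le> x + a"
  shows "(LINT s:{x..}|lborel. 2 * (vbar' p (s + a))\<^sup>2) = 2 * level p (vbar p (x + a))"
proof -
  have "(LINT s:{x..}|lborel. 2 * (vbar' p (s + a))\<^sup>2) = - 2 * level p 0 - - 2 * level p (vbar p (x + a))"
  proof (rule set_integral_FTC_atLeast)
    have "set_integrable lborel {0..} (\<lambda>s. 2 * (vbar' p (s + a))\<^sup>2)" by (simp add: tail_integrable[OF p])
    then show "set_integrable lborel {x..} (\<lambda>s. 2 * (vbar' p (s + a))\<^sup>2)"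
      by (rule set_integrable_subset) (use x in auto)
    show "continuous_on {x..} (\<lambda>s. 2 * (vbar' p (s + a))\<^sup>2)"
      by (intro continuous_intros continuous_on_shift_vbar p)
    show "((\<lambda>s. - 2 * level p (vbar p (s + a))) \<longlongrightarrow> - 2 * level p 0) at_top"
      by (intro tendsto_intros isCont_tendsto_compose[OF continuous_level[OF p]] vbar_tendsto_0 p)
    fix s assume s: "x \<le> s"
    then have "vbar' p (s + a) \<le> 0"
    proof (cases "s + a = 0")
      case False
      then show ?thesis using vbar'_neg[OF p, of "s + a"] s x by simp
    qed (simp add: vbar'_def)
    then have "- 2 * (\<bar>vbar' p (s + a)\<bar> * vbar' p (s + a)) = 2 * (vbar' p (s + a))\<^sup>2"
      by (simp add: power2_eq_square)
    then show "((\<lambda>s. - 2 * level p (vbar p (s + a))) has_real_derivative 2 * (vbar' p (s + a))\<^sup>2) (at s)"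
      using DERIV_cmult[OF DERIV_level_vbar, of "- 2"] by metis
  qed
  then show ?thesis by (simp add: level_0[OF p])
qed

text \<open>Mirror image of the descending case: on [0, a] the translate climbs from
  \<open>vbar p a\<close> to the peak, reached at s = a.\<close>

lemma ascending_part:
  assumes a: "0 \<le> a"
  shows "(LINT s:{0..a}|lborel. 2 * (vbar' p (s + - a))\<^sup>2) = 2 * level p (peak p) - 2 * level p (vbar p a)"
proof -
  have "(LINT s:{0..a}|lborel. 2 * (vbar' p (s + - a))\<^sup>2) = 2 * level p (vbar p (a + - a)) - 2 * level p (vbar p (0 + - a))"
    unfolding set_lebesgue_integral_def
  proof (rule integral_FTC_atLeastAtMost[OF a])
    show "continuous_on {0..a} (\<lambda>s. 2 * (vbar' p (s + - a))\<^sup>2)"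
      by (intro continuous_intros continuous_on_shift_vbar p)
    fix s assume s: "0 \<le> s" "s \<le> a"
    then have "0 \<le> vbar' p (s + - a)"
    proof (cases "s = a")
      case False
      then show ?thesis using vbar'_neg[OF p, of "a - s"] vbar'_odd[OF p, of "a - s"] s by simp
    qed (simp add: vbar'_def)
    then have "2 * (\<bar>vbar' p (s + - a)\<bar> * vbar' p (s + - a)) = 2 * (vbar' p (s + - a))\<^sup>2"
      by (simp add: power2_eq_square)
    then have "((\<lambda>s. 2 * level p (vbar p (s + - a))) has_real_derivative 2 * (vbar' p (s + - a))\<^sup>2) (at s)"
      using DERIV_cmult[OF DERIV_level_vbar, of 2] by metis
    then show "((\<lambda>s. 2 * level p (vbar p (s + - a))) has_vector_derivative 2 * (vbar' p (s + - a))\<^sup>2) (at s within {0..a})"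
      by (simp add: has_real_derivative_iff_has_vector_derivative has_vector_derivative_at_within)
  qed
  then show ?thesis by (simp add: vbar_0[OF p] vbar_even[OF p])
qed

text \<open>Two half-lines carrying opposite translates form one complete soliton.\<close>

lemma tail_pair_sum:
  "tail_energy p a + tail_energy p (- a) = mass p" "tail_powr p a + tail_powr p (- a) = mass p"
proof -
  have *: "tail_energy p a + tail_energy p (- a) = mass p \<and> tail_powr p a + tail_powr p (- a) = mass p"
    if a: "0 \<le> a" for a
  proof -
    have i: "set_integrable lborel {0..} (\<lambda>s. 2 * (vbar' p (s + - a))\<^sup>2)" by (simp only: set_integrable_mult_right tail_integrable[OF p])
    have "tail_energy p a - 2 / p * tail_powr p a = 2 * level p (vbar p a)"
      unfolding tail_defect using descending_tail[of 0 a] a by simp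
    \<comment> \<open>This edge contains the peak at s = a: an ascending piece up to there, then
      half a soliton.\<close>
    moreover have "tail_energy p (- a) - 2 / p * tail_powr p (- a) = 4 * level p (peak p) - 2 * level p (vbar p a)"
      unfolding tail_defect set_integral_atLeast_split[OF i a] ascending_part[OF a]
      using descending_tail[of a "- a"] a by (simp add: vbar_0[OF p])
    ultimately have 1: "(tail_energy p a + tail_energy p (- a)) - 2 / p * (tail_powr p a + tail_powr p (- a)) = (1 - 2 / p) * mass p"
      unfolding mass_eq[OF p, symmetric] by (simp add: distrib_left)
    have 2: "tail_energy p a + tail_energy p (- a) = tail_powr p a + tail_powr p (- a)"
      using tail_virial[of a] tail_virial[of "- a"] by (simp add: vbar_even[OF p] vbar'_odd[OF p])
    \<comment> \<open>Two linear relations, E - (2/p) L = (1 - 2/p) \<open>mass p\<close> and E = L,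
      determine both sums.\<close>
    have "(1 - 2 / p) * (tail_powr p a + tail_powr p (- a)) = (1 - 2 / p) * mass p"
      using 1 unfolding 2 by (simp only: left_diff_distrib mult_1)
    then show ?thesis using 2 p by simp
  qed
  show "tail_energy p a + tail_energy p (- a) = mass p" "tail_powr p a + tail_powr p (- a) = mass p"
    using *[of a] *[of "- a"] by (cases "0 \<le> a"; simp add: add.commute)+
qed

lemma tail_energy_tendsto_0: "(tail_energy p \<longlongrightarrow> 0) at_top"
proof -
  obtain C where C: "0 < C" "\<And>s. vbar p s \<le> C * exp (- s)" by (rule vbar_exp_bound[OF p]) blast
  define D where "D = (LINT s:{0..}|lborel. 2 * C\<^sup>2 * exp (- 2 * s))"
  have b: "tail_energy p a \<le> exp (- 2 * a) * D" for a
  proof -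
    have "tail_energy p a \<le> (LINT s:{0..}|lborel. exp (- 2 * a) * (2 * C\<^sup>2 * exp (- 2 * s)))"
      unfolding tail_energy_def
    proof (rule set_integral_mono[OF tail_energy_integrable])
      show "set_integrable lborel {0..} (\<lambda>s. exp (- 2 * a) * (2 * C\<^sup>2 * exp (- 2 * s)))"
        using set_integrable_exp_atLeast by (intro set_integrable_mult_right) auto
      fix s :: real
      have "(vbar' p (s + a))\<^sup>2 \<le> (vbar p (s + a))\<^sup>2" using p by (simp add: vbar'_square[OF p])
      moreover have "(vbar p (s + a))\<^sup>2 \<le> (C * exp (- (s + a)))\<^sup>2"
        using C(2)[of "s + a"] vbar_pos[OF p, of "s + a"] by (intro power_mono) auto
      moreover have "(C * exp (- (s + a)))\<^sup>2 = C\<^sup>2 * (exp (- (s + a)) * exp (- (s + a)))"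
        by (simp add: power2_eq_square mult_ac)
      moreover have "exp (- (s + a)) * exp (- (s + a)) = exp (- 2 * a) * exp (- 2 * s)"
        by (simp add: exp_add[symmetric])
      ultimately show "(vbar' p (s + a))\<^sup>2 + (vbar p (s + a))\<^sup>2 \<le> exp (- 2 * a) * (2 * C\<^sup>2 * exp (- 2 * s))"
        by (simp add: mult_ac)
    qed
    then show ?thesis unfolding D_def by simp
  qed
  have "filterlim (\<lambda>s::real. - 2 * s) at_bot at_top"
    by (rule filterlim_tendsto_neg_mult_at_bot[OF tendsto_const _ filterlim_ident]) simp
  from filterlim_compose[OF exp_at_bot this] have "((\<lambda>a. exp (- 2 * a) * D) \<longlongrightarrow> 0 * D) at_top"
    by (intro tendsto_intros)
  then have lim: "((\<lambda>a. exp (- 2 * a) * D) \<longlongrightarrow> 0) at_top" by simp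
  have nn: "0 \<le> tail_energy p a" for a
    unfolding tail_energy_def set_lebesgue_integral_def by (intro integral_nonneg_AE) auto
  show ?thesis
    by (rule tendsto_sandwich[OF _ _ tendsto_const lim]) (use b nn in \<open>auto intro!: always_eventually\<close>)
qed

end

subsection \<open>Classification of the solutions\<close>

context
  fixes p :: real
  assumes p: "2 < p"
begin

lemma vbar'_eq_0_iff: "vbar' p s = 0 \<longleftrightarrow> s = 0"
proof (cases "s = 0")
  case False
  then show ?thesis
    using vbar'_neg[OF p, of "\<bar>s\<bar>"] vbar'_odd[OF p, of s] by (cases "0 < s") auto
qed (simp add: vbar'_def)

lemma H10_starD:
  assumes "v \<in> H10_star N"
  shows "\<not> (i < N \<and> 0 \<le> s) \<Longrightarrow> v i s = 0" "i < N \<Longrightarrow> continuous_on {0..} (v i)" "i < N \<Longrightarrow> H1_half (v i)"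
    "i < N \<Longrightarrow> j < N \<Longrightarrow> v i 0 = v j 0"
  using assms unfolding H10_star_def H1_star_def cont_star_def mem_Collect_eq by blast+

lemma H10_star_pair:
  assumes "v \<in> H10_star N" "i < N"
  shows "H1_pair (v i) (weak_deriv (v i))"
proof (rule H1_half_pair)
  show "continuous_on {0..} (v i)" by (rule H10_starD(2)[OF assms])
  show "H1_half (v i)" by (rule H10_starD(3)[OF assms])
qed

lemma translates_H10:
  assumes N: "2 \<le> N" and a: "\<And>i j. i < N \<Longrightarrow> j < N \<Longrightarrow> \<bar>a i\<bar> = \<bar>a j\<bar>"
  shows "translates p N a \<in> H10_star N"
proof -
  have H: "H1_half (translates p N a i)" if "i < N" for i
    by (rule H1_half_translate[OF p]) (use that in \<open>simp add: translates_def\<close>)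
  have C: "continuous_on {0..} (translates p N a i)" if "i < N" for i
    by (rule H1_pairD(1)[OF H1_pair_translate[OF p]]) (use that in \<open>simp add: translates_def\<close>)
  have "translates p N a i 0 = translates p N a j 0" if "i < N" "j < N" for i j
    using that a[OF that] by (simp add: translates_def vbar_eq_iff[OF p])
  moreover have "translates p N a i s = 0" if "\<not> (i < N \<and> 0 \<le> s)" for i s
    using that by (auto simp: translates_def)
  moreover have "N = 1 \<longrightarrow> translates p N a 0 0 = 0" using N by simp
  ultimately show ?thesis
    unfolding H10_star_def H1_star_def cont_star_def mem_Collect_eq using H C by blast
qed

lemma translates_positive: "positive_star N (translates p N a)"
  using vbar_pos[OF p] by (simp add: positive_star_def translates_def)

lemma translates_nontrivial: "0 < N \<Longrightarrow> nontrivial N (translates p N a)"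
  using vbar_pos[OF p, of "a 0"] unfolding nontrivial_def translates_def
  by (intro exI[of _ 0]) (auto intro!: exI[of _ "0::real"])

lemma translates_derivative_0:
  assumes "i < N"
  shows "(translates p N a i has_real_derivative vbar' p (a i)) (at 0 within {0..})"
proof (rule has_field_derivative_transform_within[OF _ zero_less_one])
  show "((\<lambda>s. vbar p (s + a i)) has_real_derivative vbar' p (a i)) (at 0 within {0..})"
    using DERIV_shift_vbar[OF p, of "a i" 0] by (auto intro: has_field_derivative_at_within)
qed (use assms in \<open>auto simp: translates_def\<close>)

lemma translates_solution:
  assumes N: "2 \<le> N" and a: "\<And>i j. i < N \<Longrightarrow> j < N \<Longrightarrow> \<bar>a i\<bar> = \<bar>a j\<bar>"
    and K: "(\<Sum>i<N. vbar' p (a i)) = 0"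
  shows "nonneg_solution p N (translates p N a)"
proof -
  let ?v = "translates p N a"
  have D: "(?v i has_real_derivative vbar' p (s + a i)) (at s)" if "i < N" "0 < s" for i s
  proof (rule has_field_derivative_transform_within_open[OF DERIV_shift_vbar[OF p], of "{0<..}"])
    show "vbar p (x + a i) = ?v i x" if "x \<in> {0<..}" for x
      using that \<open>i < N\<close> by (simp add: translates_def)
  qed (use that in auto)
  have D2: "(deriv (?v i) has_real_derivative vbar p (s + a i) - vbar p (s + a i) powr (p - 2) * vbar p (s + a i)) (at s)"
    if "i < N" "0 < s" for i s
  proof (rule has_field_derivative_transform_within_open[OF DERIV_shift_vbar'[OF p], of "{0<..}"])
    show "vbar' p (x + a i) = deriv (?v i) x" if "x \<in> {0<..}" for x
      using DERIV_imp_deriv[OF D[of i x]] that \<open>i < N\<close> by simp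
  qed (use that in auto)
  have "?v i field_differentiable (at s) \<and> deriv (?v i) field_differentiable (at s) \<and>
        - deriv (deriv (?v i)) s + ?v i s = \<bar>?v i s\<bar> powr (p - 2) * ?v i s" if is': "i < N" "0 < s" for i s
  proof (intro conjI)
    show "?v i field_differentiable (at s)" "deriv (?v i) field_differentiable (at s)"
      using D[OF is'] D2[OF is'] by (auto simp: field_differentiable_def)
    show "- deriv (deriv (?v i)) s + ?v i s = \<bar>?v i s\<bar> powr (p - 2) * ?v i s"
      using DERIV_imp_deriv[OF D2[OF is']] is' vbar_pos[OF p, of "s + a i"] by (simp add: translates_def)
  qed
  moreover have "kirchhoff N ?v"
    unfolding kirchhoff_def using translates_derivative_0 K by (intro exI[of _ "\<lambda>i. vbar' p (a i)"]) auto
  ultimately have "kirchhoff_solution p N ?v"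
    unfolding kirchhoff_solution_def using translates_H10[OF N a] by auto
  then show ?thesis
    using translates_positive[of N a] translates_nontrivial[of N a] N
    by (auto simp: nonneg_solution_def nonneg_star_def positive_star_def less_imp_le)
qed

text \<open>Positivity comes first, since \<open>positive_is_vbar\<close> divides by powers of v.
  Continuity at the vertex and evenness of \<open>vbar\<close> then leave only the sign of each
  shift free, and the one-sided derivatives turn Kirchhoff's condition into a condition on these
  signs.\<close>

lemma nonneg_solution_translates:
  assumes N: "2 \<le> N" and v: "nonneg_solution p N v"
  obtains a where "v = translates p N a" "\<And>i j. i < N \<Longrightarrow> j < N \<Longrightarrow> \<bar>a i\<bar> = \<bar>a j\<bar>"
    "(\<Sum>i<N. vbar' p (a i)) = 0"
proof -
  have vH: "v \<in> H10_star N" and K: "kirchhoff N v" and nn: "nonneg_star N v" and nt: "nontrivial N v"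
    and d1: "\<And>i s. i < N \<Longrightarrow> 0 < s \<Longrightarrow> v i field_differentiable (at s)"
    and d2: "\<And>i s. i < N \<Longrightarrow> 0 < s \<Longrightarrow> deriv (v i) field_differentiable (at s)"
    and ode: "\<And>i s. i < N \<Longrightarrow> 0 < s \<Longrightarrow> - deriv (deriv (v i)) s + v i s = \<bar>v i s\<bar> powr (p - 2) * v i s"
    using v N by (auto simp: nonneg_solution_def kirchhoff_solution_def)
  have vc: "\<And>i s. \<not> (i < N \<and> 0 \<le> s) \<Longrightarrow> v i s = 0" "\<And>i j. i < N \<Longrightarrow> j < N \<Longrightarrow> v i 0 = v j 0"
    using H10_starD(1,4)[OF vH] by blast+
  have van: "v i y = 0" if "i < N" "0 \<le> x" "v i x = 0" "0 \<le> y" for i x y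
    by (rule vanishes[OF p H10_star_pair[OF vH that(1)] d1 d2 ode]) (use that in auto)
  obtain k s where ks: "k < N" "0 \<le> s" "v k s \<noteq> 0" using nt by (auto simp: nontrivial_def)
  have pos: "0 < v i x" if "i < N" "0 \<le> x" for i x
  proof -
    \<comment> \<open>A zero on one edge spreads to the vertex, and from there along edge
      \<open>k\<close>, where the solution is known not to vanish.\<close>
    have "v i x \<noteq> 0"
      using van[of i x 0] van[of k 0 s] vc(2)[of i k] that ks by auto
    then show ?thesis using nn that by (auto simp: nonneg_star_def less_le)
  qed
  have "\<exists>b. \<forall>s\<ge>0. v i s = vbar p (s + b)" if "i < N" for i
  proof -
    note sol = H10_star_pair[OF vH that] d1[OF that] d2[OF that] ode[OF that] pos[OF that]
    show ?thesis by (rule positive_is_vbar[OF p sol]) blast+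
  qed
  then obtain a where a: "\<And>i s. i < N \<Longrightarrow> 0 \<le> s \<Longrightarrow> v i s = vbar p (s + a i)" by metis
  have eq: "v = translates p N a"
    using a vc(1) by (intro ext) (auto simp: translates_def)
  obtain d where d: "\<And>i. i < N \<Longrightarrow> (v i has_real_derivative d i) (at 0 within {0..})" "(\<Sum>i<N. d i) = 0"
    using K by (auto simp: kirchhoff_def)
  have "d i = vbar' p (a i)" if "i < N" for i
  proof (rule has_field_derivative_unique)
    show "(v i has_real_derivative d i) (at 0 within {0<..})"
      by (rule DERIV_subset[OF d(1)[OF that]]) auto
    show "(v i has_real_derivative vbar' p (a i)) (at 0 within {0<..})"
      unfolding eq by (rule DERIV_subset[OF translates_derivative_0[OF that]]) auto
  qed simp
  then have "(\<Sum>i<N. vbar' p (a i)) = 0" using d(2) by simp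
  moreover have "\<bar>a i\<bar> = \<bar>a j\<bar>" if "i < N" "j < N" for i j
    using vc(2)[OF that] a[OF that(1), of 0] a[OF that(2), of 0] by (simp add: vbar_eq_iff[OF p])
  ultimately show thesis using that eq by blast
qed

text \<open>The boundary condition at the outer vertex supplies a zero, which spreads over the whole
  edge whatever the sign of v.\<close>

lemma no_solution_outer:
  assumes v: "kirchhoff_solution p 1 v"
  shows "\<not> nontrivial 1 v"
proof -
  have vH: "v \<in> H10_star 1" and v0: "v 0 0 = 0"
    using v by (auto simp: kirchhoff_solution_def H10_star_def)
  have "v 0 s = 0" if "0 \<le> s" for s
    by (rule vanishes[OF p H10_star_pair[OF vH], of 0 0])
       (use v v0 that in \<open>auto simp: kirchhoff_solution_def\<close>)
  then show ?thesis by (auto simp: nontrivial_def)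
qed

text \<open>All outward derivatives are plus or minus the same number. A sum of an odd number of
  signs is odd, hence not 0, so the common number vanishes, and \<open>vbar'\<close> vanishes only
  at 0.\<close>

lemma odd_shifts_zero:
  fixes a :: "nat \<Rightarrow> real"
  assumes N: "odd N" and a: "\<And>i j. i < N \<Longrightarrow> j < N \<Longrightarrow> \<bar>a i\<bar> = \<bar>a j\<bar>"
    and K: "(\<Sum>i<N. vbar' p (a i)) = 0" and i: "i < N"
  shows "a i = 0"
proof -
  define e :: "nat \<Rightarrow> int" where "e j = (if 0 \<le> a j then 1 else - 1)" for j
  have "vbar' p (a j) = of_int (e j) * vbar' p \<bar>a i\<bar>" if "j < N" for j
    using a[OF that i] vbar'_odd[OF p, of "a j"] by (auto simp: e_def abs_if split: if_splits)
  then have "of_int (\<Sum>j<N. e j) * vbar' p \<bar>a i\<bar> = 0"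
    using K by (simp add: sum_distrib_right)
  moreover have "odd (\<Sum>j<M. e j) \<longleftrightarrow> odd M" for M
    by (induction M) (auto simp: e_def)
  then have "(\<Sum>j<N. e j) \<noteq> 0" using N by fastforce
  ultimately show ?thesis using vbar'_eq_0_iff by (auto simp del: of_int_sum)
qed

subsection \<open>The minimization problem\<close>

lemma energy_translates: "energy N (translates p N a) = (\<Sum>i<N. tail_energy p (a i))"
  unfolding energy_def
  by (intro sum.cong refl edge_energy_translate[OF p]) (simp add: translates_def)

lemma Lp_integral_translates: "Lp_integral p N (translates p N a) = (\<Sum>i<N. tail_powr p (a i))"
  unfolding Lp_integral_def tail_powr_def
  by (intro sum.cong refl set_lebesgue_integral_cong) (auto simp: translates_def vbar_pos[OF p] less_imp_le)

lemma quotient_bound: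
  assumes N: "2 \<le> N" and w: "w \<in> H10_star N" and nt: "nontrivial N w"
  shows "0 < Lp_integral p N w" "mass p powr (1 - 2 / p) * Lp_integral p N w powr (2 / p) \<le> energy N w"
    "mass p powr (1 - 2 / p) \<le> energy_quotient p N w"
    "3 \<le> N \<Longrightarrow> mass p powr (1 - 2 / p) < energy_quotient p N w"
proof -
  obtain k y where k: "k < N" "0 \<le> y" "w k y \<noteq> 0" using nt by (auto simp: nontrivial_def)
  have c: "w i 0 = w 0 0" if "i < N" for i
    using N by (intro H10_starD(4)[OF w that]) simp
  have E: "energy N w = (\<Sum>i<N. LINT s:{0..}|lborel. (weak_deriv (w i) s)\<^sup>2 + (w i s)\<^sup>2)"
    by (simp add: energy_def)
  note S = star_sobolev[OF p N, where f = w and d = "\<lambda>i. weak_deriv (w i)", OF H10_star_pair[OF w] c k,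
      folded E Lp_integral_def]
  show L: "0 < Lp_integral p N w" using S(1) by simp
  then have L': "0 < Lp_integral p N w powr (2 / p)" by simp
  show le: "mass p powr (1 - 2 / p) * Lp_integral p N w powr (2 / p) \<le> energy N w" using S(2) by simp
  show "mass p powr (1 - 2 / p) \<le> energy_quotient p N w"
    using le L' by (simp add: energy_quotient_def pos_le_divide_eq)
  show "mass p powr (1 - 2 / p) < energy_quotient p N w" if "3 \<le> N"
    using S(3) that L' by (simp add: energy_quotient_def pos_less_divide_eq)
qed

text \<open>The quotient of a complete soliton, both of whose integrals are \<open>mass p\<close>,
  is exactly the lower bound of \<open>star_sobolev\<close>.\<close>

lemma soliton_quotient: "mass p / mass p powr (2 / p) = mass p powr (1 - 2 / p)"
  using mass_pos[OF p] by (simp add: powr_diff)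

text \<open>A soliton centred far away from the vertex on one edge nearly realizes the infimum.\<close>

lemma INF_quotient:
  assumes N: "2 \<le> N"
  shows "(INF v\<in>{v \<in> H10_star N. nontrivial N v}. energy_quotient p N v) = mass p powr (1 - 2 / p)"
proof (rule antisym)
  let ?A = "{v \<in> H10_star N. nontrivial N v}"
  \<comment> \<open>For r >= 0, the peak sits at distance \<open>r\<close> on edge 0. This edge and
    one other carry a complete soliton; the remaining N - 2 edges carry tails whose energy dies out
    as \<open>r\<close> grows.\<close>
  define tr where "tr r = translates p N (\<lambda>i. if i = 0 then - r else r)" for r
  have trA: "tr r \<in> ?A" for r
    unfolding tr_def using N by (auto intro!: translates_H10 translates_nontrivial)
  have bdd: "bdd_below (energy_quotient p N ` ?A)"
    using quotient_bound(3)[OF N] by (intro bdd_belowI) auto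
  show "mass p powr (1 - 2 / p) \<le> (INF v\<in>?A. energy_quotient p N v)"
  proof (rule cINF_greatest)
    show "?A \<noteq> {}" using trA[of 0] by (rule ex_in_conv[THEN iffD1, OF exI])
  qed (use quotient_bound(3)[OF N] in auto)
  have sum2: "(\<Sum>i<N. if i = 0 then x else y) = (x + y) + (real N - 2) * y" for x y :: real
  proof -
    have "(\<Sum>i<N. if i = 0 then x else y) = x + (\<Sum>i\<in>{..<N} - {0}. if i = 0 then x else y)"
      using N by (subst sum.remove[of _ 0]) auto
    also have "(\<Sum>i\<in>{..<N} - {0}. if i = 0 then x else y) = (\<Sum>i\<in>{..<N} - {0}. y)"
      by (rule sum.cong) auto
    also have "\<dots> = (real N - 1) * y" using N by (simp add: of_nat_diff)
    finally show ?thesis by (simp add: algebra_simps)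
  qed
  have E: "energy N (tr r) = mass p + (real N - 2) * tail_energy p r" for r
  proof -
    have "energy N (tr r) = (\<Sum>i<N. if i = 0 then tail_energy p (- r) else tail_energy p r)"
      unfolding tr_def energy_translates by (rule sum.cong) auto
    then show ?thesis using tail_pair_sum(1)[OF p, of r] unfolding sum2 by (simp add: add.commute)
  qed
  \<comment> \<open>A lower bound is enough in the denominator, so the surplus of the N - 2 tails is
    dropped.\<close>
  have L: "mass p \<le> Lp_integral p N (tr r)" for r
  proof -
    have "Lp_integral p N (tr r) = (\<Sum>i<N. if i = 0 then tail_powr p (- r) else tail_powr p r)"
      unfolding tr_def Lp_integral_translates by (rule sum.cong) auto
    also have "\<dots> = mass p + (real N - 2) * tail_powr p r"
      using tail_pair_sum(2)[OF p, of r] unfolding sum2 by (simp add: add.commute)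
    finally show ?thesis using tail_powr_nonneg[OF p, of r] N by simp
  qed
  have Q: "energy_quotient p N (tr r) \<le> (mass p + (real N - 2) * tail_energy p r) / mass p powr (2 / p)" for r
  proof -
    have "0 \<le> tail_energy p r"
      unfolding tail_energy_def set_lebesgue_integral_def by (intro integral_nonneg_AE) auto
    then show ?thesis
      unfolding energy_quotient_def E using L[of r] mass_pos[OF p] N p
      by (intro divide_left_mono powr_mono2 mult_pos_pos) auto
  qed
  show "(INF v\<in>?A. energy_quotient p N v) \<le> mass p powr (1 - 2 / p)"
  proof (rule tendsto_lowerbound[OF _ _ trivial_limit_at_top_linorder])
    have "((\<lambda>r. (mass p + (real N - 2) * tail_energy p r) / mass p powr (2 / p)) \<longlongrightarrow>
        (mass p + (real N - 2) * 0) / mass p powr (2 / p)) at_top"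
      using mass_pos[OF p] by (intro tendsto_intros tail_energy_tendsto_0[OF p]) auto
    then show "((\<lambda>r. (mass p + (real N - 2) * tail_energy p r) / mass p powr (2 / p)) \<longlongrightarrow> mass p powr (1 - 2 / p)) at_top"
      by (simp add: soliton_quotient)
    show "\<forall>\<^sub>F r in at_top. (INF v\<in>?A. energy_quotient p N v) \<le> (mass p + (real N - 2) * tail_energy p r) / mass p powr (2 / p)"
      by (intro always_eventually allI order_trans[OF cINF_lower[OF bdd trA] Q])
  qed
qed

text \<open>The admissible constants form exactly the half-line from 1/S with S =
  \<open>mass p powr (1 - 2 / p)\<close>. An admissible C is positive and makes 1/C a lower bound of
  the quotient, hence at most S by \<open>INF_quotient\<close>.\<close>

lemma best_const_eq:
  assumes N: "2 \<le> N"
  shows "best_const p N = 1 / mass p powr (1 - 2 / p)"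
proof -
  let ?A = "{v \<in> H10_star N. nontrivial N v}"
  let ?S = "mass p powr (1 - 2 / p)"
  have S: "0 < ?S" using mass_pos[OF p] by simp
  have e0: "0 \<le> energy N v" for v
    unfolding energy_def set_lebesgue_integral_def by (intro sum_nonneg integral_nonneg_AE) auto
  have "(\<forall>v\<in>H10_star N. Lp_integral p N v powr (2 / p) \<le> C * energy N v) \<longleftrightarrow> 1 / ?S \<le> C" for C
  proof
    assume C: "1 / ?S \<le> C"
    then have C0: "0 \<le> C" using S by (smt (verit) divide_nonneg_pos)
    show "\<forall>v\<in>H10_star N. Lp_integral p N v powr (2 / p) \<le> C * energy N v"
    proof
      fix v assume v: "v \<in> H10_star N"
      show "Lp_integral p N v powr (2 / p) \<le> C * energy N v"
      proof (cases "nontrivial N v")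
        case True
        have "Lp_integral p N v powr (2 / p) \<le> 1 / ?S * energy N v"
          using quotient_bound(2)[OF N v True] S by (simp add: field_simps)
        also have "\<dots> \<le> C * energy N v" using C e0 by (rule mult_right_mono)
        finally show ?thesis .
      next
        \<comment> \<open>\<open>nontrivial\<close> excludes the zero function from the quotient,
          but the defining inequality of \<open>best_const\<close> includes it; here it reads 0 <=
          0.\<close>
        case False
        have "(LINT s:{0..}|lborel. \<bar>v i s\<bar> powr p) = 0" if "i < N" for i
        proof -
          have "(\<lambda>s. indicat_real {0..} s *\<^sub>R (\<bar>v i s\<bar> powr p)) = (\<lambda>s. 0)"
            using False that p by (auto simp: nontrivial_def indicator_def)
          then show ?thesis unfolding set_lebesgue_integral_def by simp
        qed
        then have "Lp_integral p N v = 0" by (simp add: Lp_integral_def)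
        then show ?thesis using C0 e0[of v] by simp
      qed
    qed
  next
    assume C: "\<forall>v\<in>H10_star N. Lp_integral p N v powr (2 / p) \<le> C * energy N v"
    have ne: "?A \<noteq> {}"
      using translates_H10[OF N, of "\<lambda>_. 0"] translates_nontrivial[of N "\<lambda>_. 0"] N by auto
    have *: "0 < C \<and> 1 / C \<le> energy_quotient p N v" if v: "v \<in> ?A" for v
    proof -
      have "0 < Lp_integral p N v powr (2 / p)" using quotient_bound(1)[OF N, of v] v by simp
      moreover have "Lp_integral p N v powr (2 / p) \<le> C * energy N v" using C v by simp
      ultimately have "0 < C * energy N v" by (rule less_le_trans)
      then have "0 < C" using e0[of v] by (simp add: zero_less_mult_iff)
      then show ?thesis
        using \<open>0 < Lp_integral p N v powr (2 / p)\<close> \<open>Lp_integral p N v powr (2 / p) \<le> C * energy N v\<close>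
        by (simp add: energy_quotient_def field_simps)
    qed
    then have "1 / C \<le> (INF v\<in>?A. energy_quotient p N v)" by (intro cINF_greatest[OF ne]) auto
    then have "1 / C \<le> ?S" by (simp only: INF_quotient[OF N])
    moreover have "0 < C" using * ne by blast
    ultimately show "1 / ?S \<le> C" using S by (simp add: field_simps)
  qed
  then have "{C. \<forall>v\<in>H10_star N. Lp_integral p N v powr (2 / p) \<le> C * energy N v} = {1 / ?S..}"
    by auto
  then show ?thesis by (simp add: best_const_def)
qed

lemma inverse_best_const:
  assumes "2 \<le> N"
  shows "1 / best_const p N = (INF v\<in>{v \<in> H10_star N. nontrivial N v}. energy_quotient p N v)"
  unfolding best_const_eq[OF assms] INF_quotient[OF assms] by simp

text \<open>A minimizer would attain the infimum, which is the bound that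
  \<open>quotient_bound\<close> makes strict for every competitor.\<close>

lemma no_minimizer:
  assumes N: "3 \<le> N"
  shows "\<not> minimizer p N w"
proof
  assume w: "minimizer p N w"
  let ?A = "{v \<in> H10_star N. nontrivial N v}"
  have N2: "2 \<le> N" using N by simp
  have "energy_quotient p N w \<le> (INF v\<in>?A. energy_quotient p N v)"
    by (rule cINF_greatest) (use w in \<open>auto simp: minimizer_def\<close>)
  moreover have "mass p powr (1 - 2 / p) < energy_quotient p N w"
    using quotient_bound(4)[OF N2 _ _ N, of w] w by (simp add: minimizer_def)
  ultimately show False unfolding INF_quotient[OF N2] by simp
qed

text \<open>With two edges the shifts are opposite: if they were equal, Kirchhoff's condition would
  make them both 0. The solution is thus one complete soliton cut at the vertex, with energy and L^p
  integral \<open>mass p\<close>.\<close>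

lemma solution_minimizes_2:
  assumes v: "nonneg_solution p 2 v"
  shows "minimizer p 2 v \<and> extremal p 2 v"
proof -
  obtain a where a: "v = translates p 2 a" "\<And>i j. i < 2 \<Longrightarrow> j < 2 \<Longrightarrow> \<bar>a i\<bar> = \<bar>a j\<bar>"
    "(\<Sum>i<2. vbar' p (a i)) = 0"
    using nonneg_solution_translates[OF order_refl v] by blast
  have sum2: "(\<Sum>i<2. g i) = g 0 + g 1" for g :: "nat \<Rightarrow> real" by (simp add: numeral_2_eq_2)
  have a1: "a 1 = - a 0"
  proof (rule ccontr)
    assume "a 1 \<noteq> - a 0"
    with a(2)[of 1 0] have "a 1 = a 0" by (auto simp: abs_eq_iff)
    with a(3) have "a 0 = 0" by (simp add: sum2 vbar'_eq_0_iff)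
    with \<open>a 1 = a 0\<close> \<open>a 1 \<noteq> - a 0\<close> show False by simp
  qed
  have E: "energy 2 v = mass p" and L: "Lp_integral p 2 v = mass p"
    using tail_pair_sum[OF p, of "a 0"] unfolding a(1) energy_translates Lp_integral_translates sum2 a1 by auto
  have vv: "v \<in> H10_star 2" "nontrivial 2 v"
    using v by (auto simp: nonneg_solution_def kirchhoff_solution_def)
  have "energy_quotient p 2 v = mass p powr (1 - 2 / p)"
    unfolding energy_quotient_def E L by (rule soliton_quotient)
  then have "minimizer p 2 v" using vv quotient_bound(3)[of 2] by (simp add: minimizer_def)
  moreover have "extremal p 2 v"
    using vv mass_pos[OF p] unfolding extremal_def E L best_const_eq[OF order_refl] soliton_quotient[symmetric] by simp
  ultimately show ?thesis ..
qed

text \<open>Alternating shifts \<open>r\<close> and \<open>- r\<close> cancel in pairs in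
  Kirchhoff's condition. Different r >= 0 give different values at the vertex.\<close>

lemma infinitely_many_even:
  assumes N: "2 \<le> N" "even N"
  shows "infinite {v. nonneg_solution p N v}"
proof -
  define tr where "tr r = translates p N (\<lambda>i. if even i then r else - r)" for r
  have cancel: "(\<Sum>i<2 * m. vbar' p (if even i then r else - r)) = 0" for m :: nat and r
    by (induction m) (simp_all add: vbar'_odd[OF p])
  have sol: "nonneg_solution p N (tr r)" for r
    unfolding tr_def
  proof (rule translates_solution[OF N(1)])
    show "(\<Sum>i<N. vbar' p (if even i then r else - r)) = 0"
      using cancel[of r "N div 2"] N(2) by simp
  qed auto
  have "inj_on tr {0..}"
  proof (rule inj_onI)
    fix r q :: real assume rq: "r \<in> {0..}" "q \<in> {0..}" "tr r = tr q"
    then have "tr r 0 0 = tr q 0 0" by simp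
    then show "r = q" using rq N by (simp add: tr_def translates_def vbar_eq_iff[OF p])
  qed
  then have "infinite (tr ` {0..})" using infinite_Ici[of "0::real"] by (simp add: finite_image_iff)
  then show ?thesis by (rule contrapos_nn) (rule finite_subset[rotated], use sol in auto)
qed

lemma nonneg_solution_odd_iff:
  assumes N: "2 \<le> N" "odd N"
  shows "nonneg_solution p N v \<longleftrightarrow> v = translates p N (\<lambda>_. 0)"
proof
  assume "nonneg_solution p N v"
  from nonneg_solution_translates[OF N(1) this] obtain a where a: "v = translates p N a"
    "\<And>i j. i < N \<Longrightarrow> j < N \<Longrightarrow> \<bar>a i\<bar> = \<bar>a j\<bar>" "(\<Sum>i<N. vbar' p (a i)) = 0" by blast
  have "a i = 0" if "i < N" for i by (rule odd_shifts_zero[OF N(2) a(2,3) that])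
  then show "v = translates p N (\<lambda>_. 0)" unfolding a(1) by (intro ext) (simp add: translates_def)
next
  assume "v = translates p N (\<lambda>_. 0)"
  then show "nonneg_solution p N v"
    using translates_solution[OF N(1), of "\<lambda>_. 0"] by (simp add: vbar'_def)
qed

lemma nonneg_solution_positive:
  assumes "2 \<le> N" "nonneg_solution p N v"
  shows "positive_star N v"
proof -
  obtain a where "v = translates p N a" using nonneg_solution_translates[OF assms] by blast
  then show ?thesis using translates_positive by simp
qed

end

theorem theorem12:
  fixes p :: real and N :: nat
  assumes "p > 2" and "N \<ge> 1"
  shows
    "(even N \<longrightarrow>
        infinite {v. nonneg_solution p N v} \<and>
        (\<forall>v. nonneg_solution p N v \<longrightarrow> positive_star N v) \<and>
        1 / best_const p N = (INF v\<in>{v \<in> H10_star N. nontrivial N v}. energy_quotient p N v) \<and>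
        (N > 2 \<longrightarrow> (\<forall>v. nonneg_solution p N v \<longrightarrow> \<not> minimizer p N v)) \<and>
        (N = 2 \<longrightarrow> (\<forall>v. nonneg_solution p N v \<longrightarrow> minimizer p N v \<and> extremal p N v))) \<and>
     (N = 1 \<longrightarrow> \<not> (\<exists>v. kirchhoff_solution p N v \<and> nontrivial N v)) \<and>
     (odd N \<and> N > 1 \<longrightarrow>
        (\<exists>!v. nonneg_solution p N v) \<and>
        (\<forall>v. nonneg_solution p N v \<longrightarrow>
           (\<forall>i<N. v i 0 = vbar p 0 \<and>
              (v i has_real_derivative 0) (at 0 within {0..})) \<and>
           \<not> minimizer p N v) \<and>
        1 / best_const p N = (INF w\<in>{w \<in> H10_star N. nontrivial N w}. energy_quotient p N w) \<and>
        \<not> (\<exists>w. minimizer p N w))"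
proof (intro conjI impI allI)
  note p = assms(1)
  have even: "2 \<le> N" if "even N" using that assms(2) by (auto elim!: evenE)
  have odd: "2 \<le> N" "3 \<le> N" if "odd N \<and> N > 1" using that by (auto elim!: oddE)
  show "infinite {v. nonneg_solution p N v}" if "even N"
    by (rule infinitely_many_even[OF p even[OF that] that])
  show "positive_star N v" if "even N" "nonneg_solution p N v" for v
    by (rule nonneg_solution_positive[OF p even[OF that(1)] that(2)])
  show "1 / best_const p N = (INF v\<in>{v \<in> H10_star N. nontrivial N v}. energy_quotient p N v)" if "even N"
    by (rule inverse_best_const[OF p even[OF that]])
  show "\<not> minimizer p N v" if "N > 2" for v
    by (rule no_minimizer[OF p]) (use that in simp)
  show "minimizer p N v" "extremal p N v" if "N = 2" "nonneg_solution p N v" for v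
    using solution_minimizes_2[OF p, of v] that by simp_all
  show "\<not> (\<exists>v. kirchhoff_solution p N v \<and> nontrivial N v)" if "N = 1"
    using no_solution_outer[OF p] that by auto
  assume N: "odd N \<and> N > 1"
  note iff = nonneg_solution_odd_iff[OF p odd(1)[OF N] conjunct1[OF N]]
  show "\<exists>!v. nonneg_solution p N v" unfolding iff by simp
  show "v i 0 = vbar p 0" "(v i has_real_derivative 0) (at 0 within {0..})"
    if "nonneg_solution p N v" "i < N" for v i
    using translates_derivative_0[OF p that(2), of "\<lambda>_. 0"] that unfolding iff
    by (simp_all add: translates_def vbar'_def)
  show "1 / best_const p N = (INF w\<in>{w \<in> H10_star N. nontrivial N w}. energy_quotient p N w)"
    by (rule inverse_best_const[OF p odd(1)[OF N]])
  show "\<not> minimizer p N v" for v by (rule no_minimizer[OF p odd(2)[OF N]])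
  then show "\<not> (\<exists>w. minimizer p N w)" by blast
qed

end
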